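(* Let $n\ge 2$ and let $\mathcal X$ denote either $\mathcal{TO}$ or $\mathcal O$. Let $1\le i,j\le n-1$ be integers such that $i$ is the smallest element of $[i]$ and $j$ is the smallest element of $[j]$. Then: (a) $\mathcal X_{n,[i]}\le\mathcal X_{n,[j]}$ if and only if $[i]$ divides $[j]$; (b) if $[r]$ is the lowest common multiple of $[i]$ and $[j]$, then $[r]$ is minimal such that $\langle\mathcal X_{n,[i]},\mathcal X_{n,[j]}\rangle\le\mathcal X_{n,[r]}$; (c) if $[r]$, where $r$ is the smallest element of $[r]$, is the greatest common divisor of $[i]$ and $[j]$, then $\mathcal X_{n,[i]}\cap\mathcal X_{n,[j]}=\mathcal X_{n,[r]}$.
   Context: Notation. Maps act on the right. $X_n=\{0,\ldots,n-1\}$; $X_n^*$ (resp. $X_n^k$) is the set of finite words (words of length $k$) over $X_n$; $\epsilon$ is the empty word; for $1\le r\le n-1$, $\dot{\mathbf r}=\{\dot 0,\ldots,\dot{(r-1)}\}$ is a further ordered alphabet; $X_{n,r}^+=\{\dot a w:\dot a\in\dot{\mathbf r},\,w\in X_n^*\}$, $X_{n,r}^*=X_{n,r}^+\cup\{\epsilon\}$. $\mathfrak C_n=X_n^\omega$ and $\mathfrak C_{n,r}=\{\dot a x:\dot a\in\dot{\mathbf r},\,x\in\mathfrak C_n\}$ are Cantor spaces. The relation $\simeq$ on $\mathfrak C_{n,r}$: $x\simeq y$ iff $x=y$, or $\{x,y\}=\{w\,i\,000\ldots,\;w\,(i-1)(n-1)(n-1)\ldots\}$ with $w\in X_{n,r}^+$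 and $0<i\le n-1$, or $\{x,y\}=\{\dot a\,00\ldots,\;\dot{(a-1)}(n-1)(n-1)\ldots\}$ with $0<a\le r-1$, or $\{x,y\}=\{\dot 0\,00\ldots,\;\dot{(r-1)}(n-1)(n-1)\ldots\}$. Transducers over $X_n$. A transducer $\langle X_n,Q,\pi,\lambda\rangle$ has transition function $\pi:X_n\times Q\to Q$ and output function $\lambda:X_n\times Q\to X_n^*$, extended to words by $\pi(wi,q)=\pi(i,\pi(w,q))$, $\lambda(wi,q)=\lambda(w,q)\lambda(i,\pi(w,q))$, such that infinite inputs give infinite outputs; $h_q:\mathfrak C_n\to\mathfrak C_n$ is the continuous map $\delta\mapsto\lambda(\delta,q)$. Fixing an initial state $q_0$ gives an initial transducer, representing $h_{q_0}$; it is minimal if all states are reachable from $q_0$, $h_q\neq h_p$ for distinct states $q,p$, and for every state $q$ and letter $i$, $\lambda(i,q)$ is the greatest common prefix of $\{(i\delta)h_q:\delta\in\mathfrak C_n\}$. A transducer is synchronizing at level $k$ if for each $\Gamma\in X_n^k$ the state $\pi(\Gamma,q)$ does not depend on $q$ (the state forced by $\Gamma$); its core is the sub-transducer on the states forced by words of $X_n^k$. Transducers over $\mathfrak C_{n,r}$. An initial transducer $A_{q_0}$ over $\mathfrak C_{n,r}$ has state set $Q=R\sqcup S$ with $R$ finite, $q_0\in R$, and functions $\pi,\lambda$ defined on $(\dot{\mathbf r}\times\{q_0\})\sqcup(X_n\times(Q\setminus\{q_0\}))$, $\pi$ with values in $Q\setminus\{q_0\}$ and $\lambda$ with values in $X_{n,r}^*\sqcup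 X_n^*$, such that: a transition from a state of $R$ outputs $\epsilon$ if it ends in $R$ and a word of $X_{n,r}^+$ if it ends in $S$; transitions from $S$ end in $S$ with output in $X_n^*$; infinite words read from states of $S$ give infinite output; no state of $R$ lies on a cycle. It represents the map $h_{q_0}:\mathfrak C_{n,r}\to\mathfrak C_{n,r}$. It is minimal if all its states are reachable from $q_0$, distinct states $q,p$ induce distinct maps $\delta\mapsto\lambda(\delta,q)$, $\delta\mapsto\lambda(\delta,p)$ on infinite words, and for every state $q$ and every letter $i$ readable from $q$, $\lambda(i,q)$ is the greatest common prefix of $\{\lambda(i\delta,q):\delta\in\mathfrak C_n\}$; every homeomorphism of $\mathfrak C_{n,r}$ is represented by a unique minimal transducer. It is synchronizing if for some $k$ the state reached by reading a word of length $k$ from any state from which it can be read depends only on the word; its core is then the transducer over $X_n$ formed by the states forced by words of $X_n^k$. Groups. $\mathcal B_{n,r}$ is the group of homeomorphisms $h$ of $\mathfrak C_{n,r}$ such that the minimal transducers of $h$ and $h^{-1}$ are finite and synchronizing; $\mathcal{TB}_{n,r}$ is the subgroup of those $h\in\mathcal B_{n,r}$ preserving $\simeq$. For $h\in\mathcal B_{n,r}$ let $\mathrm{Core}(h)$ be the core of its minimal transducer (a transducer over $X_n$, up to renaming states). $\mathcal O_{n,r}=\{\mathrm{Core}(h):h\in\mathcal B_{n,r}\}$, $\mathcal{TO}_{n,r}=\{\mathrm{Core}(h):h\in\mathcal{TB}_{n,r}\}$, $\mathcal O_n=\bigcup_{1\le r\le n-1}\mathcal O_{n,r}$. The product of $g,h\in\mathcal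 O_n$ is the core of the minimal transducer representing $h_{q_1}$ followed by $h_{q_2}$, for any states $q_1$ of $g$ and $q_2$ of $h$ (independent of the choice). With this product $\mathcal O_n$ is a group and each $\mathcal O_{n,r}$ and $\mathcal{TO}_{n,r}$ is a subgroup. Classes, atoms, divisibility (for fixed $\mathcal X\in\{\mathcal{TO},\mathcal O\}$). For $i\in\{1,\ldots,n-1\}$ let $[i]=\{j\in\{1,\ldots,n-1\}:\mathcal X_{n,j}=\mathcal X_{n,i}\}$, let $[\mathbb Z_n^0]$ be the set of all these classes, and put $\mathcal X_{n,[i]}=\mathcal X_{n,i}$. Classes are ordered by $[i]<[j]$ if the smallest element of $[i]$ is less than the smallest element of $[j]$; "minimal" and "smallest" for classes refer to this order. A class $[r]$ is an atom if there is $T\in\mathcal X_{n,[r]}$ which is not in $\mathcal X_{n,[s]}$ for any $[s]<[r]$. An atom of $[i]$ is an atom $[r]$ with $\mathcal X_{n,[r]}\le\mathcal X_{n,[i]}$. If $i,j$ are the smallest elements of $[i],[j]$, then $[i]$ divides $[j]$ if $r\mid j$ for every atom $[r]$ of $[i]$ (with $r$ the smallest element of $[r]$). The lowest common multiple of $[i]$ and $[j]$ is the smallest class $[l]$ such that $[i]$ and $[j]$ both divide $[l]$. The greatest common divisor of $[i]$ and $[j]$ (with $i,j$ the smallest elements) is the class $[r]$ whose smallest element $r$ is the greatest common divisor of the integers $i$ and $j$. *)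

theory Defs
  imports "HOL-Analysis.Function_Topology" "HOL-Algebra.Generated_Groups" "HOL-Library.Sublist"
begin

section \<open>Words and Cantor spaces\<close>

text \<open>One type holds both alphabets, the plain letters of \<open>X\<^sub>n\<close> and the dotted ones, so that
  transducers over \<open>X\<^sub>n\<close> and over \<open>\<CC>\<^sub>n\<^sub>,\<^sub>r\<close> share a type and a core is a restriction.\<close>

datatype letter = Lt nat | Dot nat

type_synonym iword = "nat \<Rightarrow> letter"

definition letters :: "nat \<Rightarrow> letter set" where
  "letters n = Lt ` {..<n}"

definition dots :: "nat \<Rightarrow> letter set" where
  "dots r = Dot ` {..<r}"

definition words_of_length :: "nat \<Rightarrow> nat \<Rightarrow> letter list set" where
  "words_of_length n k = {w \<in> lists (letters n). length w = k}"

text \<open>Words whose first letter lies in \<open>D\<close> and whose other letters lie in \<open>X\<^sub>n\<close>: for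
  \<open>D = letters n\<close> these are the words over \<open>X\<^sub>n\<close>, for \<open>D = dots r\<close> those of \<open>X\<^sub>n\<^sub>,\<^sub>r\<^sup>*\<close>.\<close>

definition fin_words :: "nat \<Rightarrow> letter set \<Rightarrow> letter list set" where
  "fin_words n D = insert [] {d # w | d w. d \<in> D \<and> w \<in> lists (letters n)}"

definition inf_words :: "nat \<Rightarrow> letter set \<Rightarrow> iword set" where
  "inf_words n D = {x. x 0 \<in> D \<and> (\<forall>k. x (Suc k) \<in> letters n)}"

definition dot_words :: "nat \<Rightarrow> nat \<Rightarrow> letter list set" where
  "dot_words n r = fin_words n (dots r) - {[]}"

definition cantor :: "nat \<Rightarrow> iword set" where
  "cantor n = inf_words n (letters n)"

definition cantor_dot :: "nat \<Rightarrow> nat \<Rightarrow> iword set" where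
  "cantor_dot n r = inf_words n (dots r)"

definition cantor_dot_topology :: "nat \<Rightarrow> nat \<Rightarrow> iword topology" where
  "cantor_dot_topology n r =
     subtopology (product_topology (\<lambda>_. discrete_topology UNIV) UNIV) (cantor_dot n r)"

definition take_word :: "nat \<Rightarrow> iword \<Rightarrow> letter list" where
  "take_word m x = map x [0..<m]"

definition append_word :: "letter list \<Rightarrow> iword \<Rightarrow> iword" where
  "append_word w x = (\<lambda>k. if k < length w then w ! k else x (k - length w))"

definition common_prefix :: "letter list \<Rightarrow> iword set \<Rightarrow> bool" where
  "common_prefix w A \<longleftrightarrow> (\<forall>x\<in>A. take_word (length w) x = w)"

definition is_gcp :: "letter list \<Rightarrow> iword set \<Rightarrow> bool" where
  "is_gcp w A \<longleftrightarrow> common_prefix w A \<and> (\<forall>v. common_prefix v A \<longrightarrow> prefix v w)"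

definition circ_equiv :: "nat \<Rightarrow> nat \<Rightarrow> iword \<Rightarrow> iword \<Rightarrow> bool" where
  "circ_equiv n r x y \<longleftrightarrow>
     x = y
   \<or> (\<exists>w\<in>dot_words n r. \<exists>i. 0 < i \<and> i \<le> n - 1 \<and>
        {x, y} = {append_word (w @ [Lt i]) (\<lambda>_. Lt 0),
                  append_word (w @ [Lt (i - 1)]) (\<lambda>_. Lt (n - 1))})
   \<or> (\<exists>a. 0 < a \<and> a \<le> r - 1 \<and>
        {x, y} = {append_word [Dot a] (\<lambda>_. Lt 0),
                  append_word [Dot (a - 1)] (\<lambda>_. Lt (n - 1))})
   \<or> {x, y} = {append_word [Dot 0] (\<lambda>_. Lt 0),
               append_word [Dot (r - 1)] (\<lambda>_. Lt (n - 1))}"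


section \<open>Transducers\<close>

text \<open>The values of \<open>step\<close> and \<open>outp\<close> are meaningful only for states and for letters that can be
  read from them.\<close>

record 'q transducer =
  states :: "'q set"
  step :: "letter \<Rightarrow> 'q \<Rightarrow> 'q"
  outp :: "letter \<Rightarrow> 'q \<Rightarrow> letter list"

primrec step_word :: "'q transducer \<Rightarrow> letter list \<Rightarrow> 'q \<Rightarrow> 'q" where
  "step_word T [] q = q"
| "step_word T (i # w) q = step_word T w (step T i q)"

primrec out_word :: "'q transducer \<Rightarrow> letter list \<Rightarrow> 'q \<Rightarrow> letter list" where
  "out_word T [] q = []"
| "out_word T (i # w) q = outp T i q @ out_word T w (step T i q)"

definition infinite_output :: "'q transducer \<Rightarrow> 'q \<Rightarrow> iword \<Rightarrow> bool" where
  "infinite_output T q x \<longleftrightarrow> (\<forall>k. \<exists>m. k < length (out_word T (take_word m x) q))"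

text \<open>The infinite word of which all \<open>out_word T (take_word m x) q\<close> are prefixes, provided that
  \<open>infinite_output T q x\<close> holds.\<close>

definition state_map :: "'q transducer \<Rightarrow> 'q \<Rightarrow> iword \<Rightarrow> iword" where
  "state_map T q x = (\<lambda>k.
     out_word T (take_word (LEAST m. k < length (out_word T (take_word m x) q)) x) q ! k)"

text \<open>The notions common to both kinds of transducer are parametrised by the function \<open>I\<close> giving
  the letters that can be read from a state as the first letter of a word; all further letters
  are in \<open>X\<^sub>n\<close>. It is \<open>plain_input\<close> over \<open>X\<^sub>n\<close> and \<open>dot_input\<close> over \<open>\<CC>\<^sub>n\<^sub>,\<^sub>r\<close>.\<close>

definition plain_input :: "nat \<Rightarrow> 'q \<Rightarrow> letter set" where
  "plain_input n = (\<lambda>_. letters n)"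

definition dot_input :: "nat \<Rightarrow> nat \<Rightarrow> 'q \<Rightarrow> 'q \<Rightarrow> letter set" where
  "dot_input n r q0 = (\<lambda>q. if q = q0 then dots r else letters n)"

definition minimal :: "nat \<Rightarrow> ('q \<Rightarrow> letter set) \<Rightarrow> 'q transducer \<Rightarrow> 'q \<Rightarrow> bool" where
  "minimal n I T q0 \<longleftrightarrow>
     (\<forall>q\<in>states T. \<exists>w\<in>fin_words n (I q0). step_word T w q0 = q)
   \<and> (\<forall>q\<in>states T. \<forall>p\<in>states T. q \<noteq> p \<longrightarrow>
        inf_words n (I q) \<noteq> inf_words n (I p)
      \<or> (\<exists>x\<in>inf_words n (I q). state_map T q x \<noteq> state_map T p x))
   \<and> (\<forall>q\<in>states T. \<forall>i\<in>I q.
        is_gcp (outp T i q) {state_map T q (append_word [i] x) | x. x \<in> cantor n})"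

definition sync_at :: "nat \<Rightarrow> ('q \<Rightarrow> letter set) \<Rightarrow> 'q transducer \<Rightarrow> nat \<Rightarrow> bool" where
  "sync_at n I T k \<longleftrightarrow>
     (\<forall>w p q. length w = k \<longrightarrow> p \<in> states T \<longrightarrow> q \<in> states T \<longrightarrow>
        w \<in> fin_words n (I p) \<longrightarrow> w \<in> fin_words n (I q) \<longrightarrow> step_word T w p = step_word T w q)"

definition synchronizing :: "nat \<Rightarrow> ('q \<Rightarrow> letter set) \<Rightarrow> 'q transducer \<Rightarrow> bool" where
  "synchronizing n I T \<longleftrightarrow> (\<exists>k. sync_at n I T k)"

text \<open>The set of states forced by words of length \<open>k\<close> is the same for every level \<open>k\<close> of
  synchronization.\<close>

definition core :: "nat \<Rightarrow> ('q \<Rightarrow> letter set) \<Rightarrow> 'q transducer \<Rightarrow> 'q transducer" where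
  "core n I T = T\<lparr>states := {step_word T w q | w q k.
     sync_at n I T k \<and> w \<in> words_of_length n k \<and> q \<in> states T \<and> w \<in> fin_words n (I q)}\<rparr>"

definition plain_transducer :: "nat \<Rightarrow> 'q transducer \<Rightarrow> bool" where
  "plain_transducer n T \<longleftrightarrow>
     (\<forall>q\<in>states T. \<forall>i\<in>letters n. step T i q \<in> states T \<and> outp T i q \<in> lists (letters n))
   \<and> (\<forall>q\<in>states T. \<forall>x\<in>cantor n. infinite_output T q x)"

definition dot_transducer :: "nat \<Rightarrow> nat \<Rightarrow> 'q transducer \<Rightarrow> 'q \<Rightarrow> bool" where
  "dot_transducer n r T q0 \<longleftrightarrow> (\<exists>R S.
     states T = R \<union> S \<and> R \<inter> S = {} \<and> finite R \<and> q0 \<in> R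
   \<and> (\<forall>q\<in>states T. \<forall>i\<in>dot_input n r q0 q. step T i q \<in> states T - {q0})
   \<and> (\<forall>q\<in>R. \<forall>i\<in>dot_input n r q0 q.
        (step T i q \<in> R \<longrightarrow> outp T i q = []) \<and> (step T i q \<in> S \<longrightarrow> outp T i q \<in> dot_words n r))
   \<and> (\<forall>q\<in>S. \<forall>i\<in>letters n. step T i q \<in> S \<and> outp T i q \<in> lists (letters n))
   \<and> (\<forall>q\<in>S. \<forall>x\<in>cantor n. infinite_output T q x)
   \<and> (\<forall>q\<in>R. \<forall>w\<in>fin_words n (dot_input n r q0 q). w \<noteq> [] \<longrightarrow> step_word T w q \<noteq> q))"

definition minimal_plain_transducer_of ::
    "nat \<Rightarrow> (iword \<Rightarrow> iword) \<Rightarrow> 'q transducer \<Rightarrow> 'q \<Rightarrow> bool" where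
  "minimal_plain_transducer_of n f T q0 \<longleftrightarrow>
     plain_transducer n T \<and> q0 \<in> states T \<and> minimal n (plain_input n) T q0
   \<and> (\<forall>x\<in>cantor n. state_map T q0 x = f x)"

definition minimal_dot_transducer_of ::
    "nat \<Rightarrow> nat \<Rightarrow> (iword \<Rightarrow> iword) \<Rightarrow> 'q transducer \<Rightarrow> 'q \<Rightarrow> bool" where
  "minimal_dot_transducer_of n r h T q0 \<longleftrightarrow>
     dot_transducer n r T q0 \<and> minimal n (dot_input n r q0) T q0
   \<and> (\<forall>x\<in>cantor_dot n r. state_map T q0 x = h x)"

definition transducer_iso :: "nat \<Rightarrow> 'q transducer \<Rightarrow> 'p transducer \<Rightarrow> bool" where
  "transducer_iso n T U \<longleftrightarrow> (\<exists>f. bij_betw f (states T) (states U)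
     \<and> (\<forall>q\<in>states T. \<forall>i\<in>letters n.
          step U i (f q) = f (step T i q) \<and> outp U i (f q) = outp T i q))"

text \<open>Transducers over \<open>X\<^sub>n\<close> up to renaming states. All states of a minimal transducer are
  reachable, so it has at most countably many of them and \<open>nat\<close> suffices as type of state names.\<close>

type_synonym transducer_class = "nat transducer set"

definition iso_class :: "nat \<Rightarrow> nat transducer \<Rightarrow> transducer_class" where
  "iso_class n T = {U. plain_transducer n U \<and> transducer_iso n T U}"


section \<open>The groups\<close>

definition finite_synchronizing :: "nat \<Rightarrow> nat \<Rightarrow> (iword \<Rightarrow> iword) \<Rightarrow> bool" where
  "finite_synchronizing n r h \<longleftrightarrow> (\<exists>(T :: nat transducer) q0.
     minimal_dot_transducer_of n r h T q0
   \<and> finite (states T) \<and> synchronizing n (dot_input n r q0) T)"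

definition B_nr :: "nat \<Rightarrow> nat \<Rightarrow> (iword \<Rightarrow> iword) set" where
  "B_nr n r = {h \<in> extensional (cantor_dot n r).
     homeomorphic_map (cantor_dot_topology n r) (cantor_dot_topology n r) h
   \<and> finite_synchronizing n r h
   \<and> finite_synchronizing n r (restrict (inv_into (cantor_dot n r) h) (cantor_dot n r))}"

definition TB_nr :: "nat \<Rightarrow> nat \<Rightarrow> (iword \<Rightarrow> iword) set" where
  "TB_nr n r = {h \<in> B_nr n r. \<forall>x\<in>cantor_dot n r. \<forall>y\<in>cantor_dot n r.
     circ_equiv n r x y \<longleftrightarrow> circ_equiv n r (h x) (h y)}"

definition Cores :: "nat \<Rightarrow> nat \<Rightarrow> (iword \<Rightarrow> iword) set \<Rightarrow> transducer_class set" where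
  "Cores n r H = {iso_class n (core n (dot_input n r q0) T) | T q0 h.
     h \<in> H \<and> minimal_dot_transducer_of n r h T q0}"

definition O_nr :: "nat \<Rightarrow> nat \<Rightarrow> transducer_class set" where
  "O_nr n r = Cores n r (B_nr n r)"

definition TO_nr :: "nat \<Rightarrow> nat \<Rightarrow> transducer_class set" where
  "TO_nr n r = Cores n r (TB_nr n r)"

text \<open>The classes obtained from the different representatives, and from the different states
  \<open>q1\<close> and \<open>q2\<close>, all coincide, so this union is a single isomorphism class.\<close>

definition core_mult ::
    "nat \<Rightarrow> transducer_class \<Rightarrow> transducer_class \<Rightarrow> transducer_class" where
  "core_mult n g h = \<Union> {iso_class n (core n (plain_input n) M) | M p0 T1 T2 q1 q2.
     T1 \<in> g \<and> T2 \<in> h \<and> q1 \<in> states T1 \<and> q2 \<in> states T2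
   \<and> minimal_plain_transducer_of n (state_map T2 q2 \<circ> state_map T1 q1) M p0}"

definition core_one :: "nat \<Rightarrow> transducer_class" where
  "core_one n = iso_class n \<lparr>states = {0}, step = (\<lambda>_ _. 0), outp = (\<lambda>i _. [i])\<rparr>"

definition O_group :: "nat \<Rightarrow> transducer_class monoid" where
  "O_group n = \<lparr>carrier = (\<Union>r\<in>{1..n - 1}. O_nr n r), mult = core_mult n, one = core_one n\<rparr>"

definition subgroup_le ::
    "nat \<Rightarrow> transducer_class set \<Rightarrow> transducer_class set \<Rightarrow> bool" where
  "subgroup_le n G H \<longleftrightarrow> subgroup G ((O_group n)\<lparr>carrier := H\<rparr>)"


section \<open>Classes, atoms and divisibility\<close>

text \<open>Here \<open>X\<close> is \<open>TO_nr\<close> or \<open>O_nr\<close>.\<close>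

type_synonym family = "nat \<Rightarrow> nat \<Rightarrow> transducer_class set"

definition cls :: "family \<Rightarrow> nat \<Rightarrow> nat \<Rightarrow> nat set" where
  "cls X n i = {j \<in> {1..n - 1}. X n j = X n i}"

definition all_classes :: "family \<Rightarrow> nat \<Rightarrow> nat set set" where
  "all_classes X n = cls X n ` {1..n - 1}"

text \<open>The common value of \<open>X n i\<close> for \<open>i \<in> c\<close>.\<close>

definition class_group :: "family \<Rightarrow> nat \<Rightarrow> nat set \<Rightarrow> transducer_class set" where
  "class_group X n c = the_elem (X n ` c)"

definition class_less :: "nat set \<Rightarrow> nat set \<Rightarrow> bool" where
  "class_less c d \<longleftrightarrow> Min c < Min d"

definition minimal_class :: "family \<Rightarrow> nat \<Rightarrow> (nat set \<Rightarrow> bool) \<Rightarrow> nat set \<Rightarrow> bool" where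
  "minimal_class X n P c \<longleftrightarrow>
     c \<in> all_classes X n \<and> P c \<and> (\<forall>d\<in>all_classes X n. class_less d c \<longrightarrow> \<not> P d)"

definition smallest_class :: "family \<Rightarrow> nat \<Rightarrow> (nat set \<Rightarrow> bool) \<Rightarrow> nat set \<Rightarrow> bool" where
  "smallest_class X n P c \<longleftrightarrow>
     c \<in> all_classes X n \<and> P c \<and> (\<forall>d\<in>all_classes X n. P d \<longrightarrow> c = d \<or> class_less c d)"

definition atom :: "family \<Rightarrow> nat \<Rightarrow> nat set \<Rightarrow> bool" where
  "atom X n a \<longleftrightarrow> a \<in> all_classes X n
   \<and> (\<exists>T\<in>class_group X n a. \<forall>s\<in>all_classes X n. class_less s a \<longrightarrow> T \<notin> class_group X n s)"

definition atom_of :: "family \<Rightarrow> nat \<Rightarrow> nat set \<Rightarrow> nat set \<Rightarrow> bool" where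
  "atom_of X n c a \<longleftrightarrow> atom X n a \<and> subgroup_le n (class_group X n a) (class_group X n c)"

definition class_dvd :: "family \<Rightarrow> nat \<Rightarrow> nat set \<Rightarrow> nat set \<Rightarrow> bool" where
  "class_dvd X n c d \<longleftrightarrow> (\<forall>a. atom_of X n c a \<longrightarrow> Min a dvd Min d)"

definition is_class_lcm :: "family \<Rightarrow> nat \<Rightarrow> nat set \<Rightarrow> nat set \<Rightarrow> nat set \<Rightarrow> bool" where
  "is_class_lcm X n c d l \<longleftrightarrow> smallest_class X n (\<lambda>e. class_dvd X n c e \<and> class_dvd X n d e) l"

definition is_class_gcd :: "family \<Rightarrow> nat \<Rightarrow> nat set \<Rightarrow> nat set \<Rightarrow> nat set \<Rightarrow> bool" where
  "is_class_gcd X n c d e \<longleftrightarrow> e \<in> all_classes X n \<and> Min e = gcd (Min c) (Min d)"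

end

theory Submission
  imports Defs "HOL-Number_Theory.Cong"
begin

text \<open>
  The states of a minimal transducer of \<open>f\<close> are the local maps \<open>loc f w\<close>: read \<open>w\<close>, then delete the
  greatest common prefix of the outputs. Hence a core is a finite set of continuous injections of
  Cantor space, \<open>h \<mapsto> Core(h)\<close> is a homomorphism, and \<open>\<O>\<^sub>n\<^sub>,\<^sub>r\<close> and \<open>\<T>\<O>\<^sub>n\<^sub>,\<^sub>r\<close> are images of groups of
  homeomorphisms.

  The image of a core map is clopen, and its number of cones modulo \<open>n - 1\<close> is the same number \<open>s\<close> for
  all maps of a core. Counting cones in \<open>h(\<CC>\<^sub>n\<^sub>,\<^sub>r) = \<CC>\<^sub>n\<^sub>,\<^sub>r\<close> gives \<open>r s \<equiv> r (mod n - 1)\<close>. Conversely, if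
  \<open>r' s \<equiv> r'\<close>, then the images of the core maps over deep cones of \<open>\<CC>\<^sub>n\<^sub>,\<^sub>r\<^sub>'\<close> can be cut into as many
  pieces as there are cones in some partition of \<open>\<CC>\<^sub>n\<^sub>,\<^sub>r\<^sub>'\<close>, and moving the pieces onto these cones yields a
  homeomorphism with the same core. If the core comes from a homeomorphism of the circle, its maps are
  all increasing or all decreasing, and pieces and cones can be matched in this order.

  So every \<open>T\<close> has an order \<open>m\<close> with \<open>T \<in> \<X>\<^sub>n\<^sub>,\<^sub>r\<close> iff \<open>m\<close> divides \<open>r\<close>. The atoms are the classes of these
  orders, and the three claims become statements on divisibility of integers.
\<close>

section \<open>Words\<close>

text \<open>A homeomorphism of the circle need not respect the linear order of
  \<open>cantor_dot n r\<close>, since it may move the point where the circle is cut. Its core maps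
  are monotone nevertheless: each can be read on a cone whose image avoids the end
  \<open>low\<close>, where gaps of the lexicographic order go to gaps, and a discrete intermediate
  value argument does the rest.

  The new homeomorphism must have a synchronizing inverse too. Core maps need not be onto, so this
  inverse is written through the inverse of the old homeomorphism, with the first letter exchanged.

  The modulus n - 1 comes from splitting a cone into \<open>n\<close> cones. Complete prefix codes
  over \<open>dots r\<close> have r + j (n - 1) words, so the congruence is what a bijection between
  pieces and code words requires. The order of \<open>T\<close> is (n - 1) / gcd (n - 1, s - 1). As
  it divides n - 1, the union of all groups is the single group \<open>O_nr n (n - 1)\<close>;
  closure under products of elements from different members rests on this.\<close>

notation append_word (infixr "\<frown>" 65)

definition drop_word :: "nat \<Rightarrow> iword \<Rightarrow> iword" where
  "drop_word m x = (\<lambda>k. x (m + k))"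

definition cone :: "nat \<Rightarrow> (iword \<Rightarrow> iword) \<Rightarrow> letter list \<Rightarrow> iword set" where
  "cone n f w = {f (w \<frown> x) | x. x \<in> cantor n}"

text \<open>Words that have left the initial state: past a nonempty word the remaining input ranges
  over \<open>cantor n\<close>, whatever the set \<open>D\<close> of first letters is.\<close>

definition nefin :: "nat \<Rightarrow> letter set \<Rightarrow> letter list set" where
  "nefin n D = fin_words n D - {[]}"

lemma append_word_Nil [simp]: "[] \<frown> x = x"
  by (simp add: append_word_def)

lemma append_word_append [simp]: "(u @ v) \<frown> x = u \<frown> v \<frown> x"
  by (auto simp: append_word_def fun_eq_iff nth_append)

lemma take_word_length [simp]: "length (take_word m x) = m"
  by (simp add: take_word_def)

lemma take_word_nth [simp]: "k < m \<Longrightarrow> take_word m x ! k = x k"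
  by (simp add: take_word_def)

lemma take_word_append_word: "take_word m (w \<frown> x) = take m w @ take_word (m - length w) x"
  by (rule nth_equalityI) (auto simp: append_word_def nth_append min_def)

lemma take_word_append_word_eq [simp]: "take_word (length w) (w \<frown> x) = w"
  by (rule nth_equalityI) (auto simp: append_word_def)

lemma drop_word_append_word [simp]: "drop_word (length w) (w \<frown> x) = x"
  by (auto simp: drop_word_def append_word_def)

lemma drop_word_append_le: "m \<le> length w \<Longrightarrow> drop_word m (w \<frown> x) = drop m w \<frown> x"
  by (auto simp: drop_word_def append_word_def fun_eq_iff add.commute)

lemma drop_word_add_append [simp]: "drop_word (length w + m) (w \<frown> x) = drop_word m x"
  by (auto simp: drop_word_def append_word_def fun_eq_iff add.assoc)

lemma drop_word_0 [simp]: "drop_word 0 x = x"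
  by (simp add: drop_word_def)

lemma take_drop_word [simp]: "take_word m x \<frown> drop_word m x = x"
  by (auto simp: drop_word_def append_word_def fun_eq_iff)

lemma append_word_cancel [simp]: "w \<frown> x = w \<frown> y \<longleftrightarrow> x = y"
  by (metis drop_word_append_word)

lemma take_take_word: "take k (take_word m x) = take_word (min k m) x"
  by (rule nth_equalityI) auto

lemma take_word_0 [simp]: "take_word 0 x = []"
  by (simp add: take_word_def)

lemma take_word_add: "take_word (k + m) x = take_word k x @ take_word m (drop_word k x)"
  by (rule nth_equalityI) (auto simp: nth_append drop_word_def)

lemma take_word_Suc: "take_word (Suc k) x = take_word k x @ [x k]"
  by (simp add: take_word_def)

lemma take_word_eq_iff: "take_word m x = take_word m y \<longleftrightarrow> (\<forall>k<m. x k = y k)"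
  by (auto simp: list_eq_iff_nth_eq)

lemma take_word_mono: "take_word m x = take_word m y \<Longrightarrow> k \<le> m \<Longrightarrow> take_word k x = take_word k y"
  by (simp add: take_word_eq_iff)

lemma take_word_eqD: "take_word (length w) x = w \<Longrightarrow> x = w \<frown> drop_word (length w) x"
  by (metis take_drop_word)

lemma fin_words_letters [simp]: "fin_words n (letters n) = lists (letters n)"
proof -
  have "w \<in> fin_words n (letters n) \<longleftrightarrow> w \<in> lists (letters n)" for w
    by (cases w) (auto simp: fin_words_def)
  then show ?thesis by blast
qed

lemma Nil_fin_words [simp]: "[] \<in> fin_words n D"
  by (simp add: fin_words_def)

lemma Cons_fin_words [simp]: "d # w \<in> fin_words n D \<longleftrightarrow> d \<in> D \<and> w \<in> lists (letters n)"
  by (auto simp: fin_words_def)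

lemma append_fin_words: "w \<noteq> [] \<Longrightarrow> w @ u \<in> fin_words n D \<longleftrightarrow> w \<in> fin_words n D \<and> u \<in> lists (letters n)"
  by (cases w) auto

lemma nefin_iff: "w \<in> nefin n D \<longleftrightarrow> w \<in> fin_words n D \<and> w \<noteq> []"
  by (simp add: nefin_def)

lemma Cons_nefin [simp]: "d # w \<in> nefin n D \<longleftrightarrow> d \<in> D \<and> w \<in> lists (letters n)"
  by (simp add: nefin_iff)

lemma Nil_nefin [simp]: "[] \<notin> nefin n D"
  by (simp add: nefin_iff)

lemma nefin_letters [simp]: "w \<in> nefin n (letters n) \<longleftrightarrow> w \<in> lists (letters n) \<and> w \<noteq> []"
  by (simp add: nefin_iff)

lemma nefinE:
  assumes "w \<in> nefin n D" obtains d v where "w = d # v" "d \<in> D" "v \<in> lists (letters n)"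
  using assms by (cases w) auto

lemma nefin_append: "w \<in> nefin n D \<Longrightarrow> u \<in> lists (letters n) \<Longrightarrow> w @ u \<in> nefin n D"
  by (cases w) auto

lemma cantor_eq: "x \<in> cantor n \<longleftrightarrow> (\<forall>k. x k \<in> letters n)"
  unfolding cantor_def inf_words_def by (auto) (metis not0_implies_Suc)

lemma inf_words_letters [simp]: "inf_words n (letters n) = cantor n"
  by (simp add: cantor_def)

lemma inf_words_append:
  "w \<noteq> [] \<Longrightarrow> w \<frown> x \<in> inf_words n D \<longleftrightarrow> w \<in> fin_words n D \<and> x \<in> cantor n"
proof (induction w)
  case (Cons d w)
  have 1: "((d # w) \<frown> x) 0 = d" by (simp add: append_word_def)
  have 2: "((d # w) \<frown> x) (Suc k) = (w \<frown> x) k" for k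
    by (simp add: append_word_def)
  have 3: "(\<forall>k. (w \<frown> x) k \<in> letters n) \<longleftrightarrow> w \<in> lists (letters n) \<and> x \<in> cantor n" (is "?a = ?b")
  proof
    assume a: ?a
    have "w ! k \<in> letters n" if "k < length w" for k
      using a[rule_format, of k] that by (simp add: append_word_def)
    moreover have "x k \<in> letters n" for k
      using a[rule_format, of "length w + k"] by (simp add: append_word_def)
    ultimately show ?b by (auto simp: cantor_eq in_set_conv_nth)
  next
    assume ?b then show ?a by (auto simp: append_word_def cantor_eq in_set_conv_nth) (metis in_lists_conv_set nth_mem)
  qed
  show ?case using 3 by (auto simp: inf_words_def 1 2)
qed simp

lemma cantor_append [simp]: "w \<frown> x \<in> cantor n \<longleftrightarrow> w \<in> lists (letters n) \<and> x \<in> cantor n"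
  using inf_words_append[of w x n "letters n"] by (cases "w = []") auto

lemma inf_words_appendI: "w \<in> nefin n D \<Longrightarrow> x \<in> cantor n \<Longrightarrow> w \<frown> x \<in> inf_words n D"
  by (simp add: nefin_iff inf_words_append)

lemma take_inf_words: "x \<in> inf_words n D \<Longrightarrow> take_word m x \<in> fin_words n D"
  using inf_words_append[of "take_word m x" "drop_word m x" n D] by (cases "take_word m x = []") auto

lemma take_inf_words_ne: "x \<in> inf_words n D \<Longrightarrow> m > 0 \<Longrightarrow> take_word m x \<in> nefin n D"
  using take_inf_words[of x n D m] by (auto simp: nefin_iff take_word_def)

lemma drop_inf_words: "x \<in> inf_words n D \<Longrightarrow> m > 0 \<Longrightarrow> drop_word m x \<in> cantor n"
  using inf_words_append[of "take_word m x" "drop_word m x" n D] take_inf_words_ne[of x n D m] by (simp add: nefin_iff)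

lemma drop_cantor: "x \<in> cantor n \<Longrightarrow> drop_word m x \<in> cantor n"
  by (simp add: cantor_eq drop_word_def)

lemma take_cantor: "x \<in> cantor n \<Longrightarrow> take_word m x \<in> lists (letters n)"
  using take_inf_words[of x n "letters n"] by simp

lemma inf_words_split:
  assumes "x \<in> inf_words n D" "m > 0"
  obtains w y where "x = w \<frown> y" "w \<in> nefin n D" "length w = m" "y \<in> cantor n"
  using that[of "take_word m x" "drop_word m x"] assms
  by (simp add: drop_inf_words take_inf_words_ne)

lemma finite_letters [simp]: "finite (letters n)"
  by (simp add: letters_def)

lemma card_letters [simp]: "card (letters n) = n"
  by (simp add: letters_def card_image inj_on_def)

lemma finite_dots [simp]: "finite (dots n)"
  by (simp add: dots_def)

lemma card_dots [simp]: "card (dots n) = n"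
  by (simp add: dots_def card_image inj_on_def)

lemma dots_letters_disjoint: "dots r \<inter> letters n = {}"
  by (auto simp: dots_def letters_def)

lemma words_of_length_eq: "words_of_length n k = {w. set w \<subseteq> letters n \<and> length w = k}"
  by (auto simp: words_of_length_def)

lemma finite_words_of_length [simp]: "finite (words_of_length n k)"
  by (simp add: words_of_length_eq finite_lists_length_eq)

lemma card_words_of_length: "card (words_of_length n k) = n ^ k"
  by (simp add: words_of_length_eq card_lists_length_eq)

lemma finite_fin_words_length:
  assumes "finite D" shows "finite {w \<in> fin_words n D. length w = k}"
proof -
  have "{w \<in> fin_words n D. length w = k} \<subseteq> {w. set w \<subseteq> D \<union> letters n \<and> length w = k}"
    by (auto simp: fin_words_def)
  then show ?thesis
    by (rule finite_subset) (use assms in \<open>simp add: finite_lists_length_eq\<close>)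
qed

lemma finite_fin_words_le:
  assumes "finite D" shows "finite {w \<in> fin_words n D. length w \<le> k}"
proof -
  have "{w \<in> fin_words n D. length w \<le> k} = (\<Union>j\<le>k. {w \<in> fin_words n D. length w = j})"
    by auto
  then show ?thesis using finite_fin_words_length[OF assms] by auto
qed


section \<open>Greatest common prefixes and local maps\<close>

definition gcp :: "iword set \<Rightarrow> letter list" where
  "gcp A = (THE w. is_gcp w A)"

lemma is_gcp_unique: "is_gcp v A \<Longrightarrow> is_gcp w A \<Longrightarrow> v = w"
  by (auto simp: is_gcp_def intro: prefix_order.antisym)

lemma gcp_eqI: "is_gcp v A \<Longrightarrow> gcp A = v"
  unfolding gcp_def by (auto intro: is_gcp_unique)

text \<open>Two distinct points bound the length of a common prefix, so a longest one exists. It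
  extends all others because all of them are prefixes of the same point \<open>x\<close>.\<close>

lemma ex_is_gcp:
  assumes "x \<in> A" "y \<in> A" "x \<noteq> y" shows "\<exists>v. is_gcp v A"
proof -
  obtain k where k: "x k \<noteq> y k" using assms(3) by auto
  define L where "L = {j. common_prefix (take_word j x) A}"
  have "j \<le> k" if "j \<in> L" for j
  proof (rule ccontr)
    assume "\<not> j \<le> k"
    then have "x k = take_word j x ! k" by simp
    also have "take_word j x = take_word j y"
      using that assms(2) unfolding L_def common_prefix_def by simp
    finally show False using k \<open>\<not> j \<le> k\<close> by simp
  qed
  then have "L \<subseteq> {..k}" by auto
  then have fin: "finite L" by (rule finite_subset) simp
  have "0 \<in> L" by (simp add: L_def common_prefix_def)
  then have M: "Max L \<in> L" using fin Max_in by blast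
  have "is_gcp (take_word (Max L) x) A"
    unfolding is_gcp_def
  proof (intro conjI allI impI)
    show "common_prefix (take_word (Max L) x) A" using M by (simp add: L_def)
    fix v assume v: "common_prefix v A"
    then have eq: "v = take_word (length v) x" using assms(1) by (simp add: common_prefix_def)
    then have "length v \<in> L" using v by (simp add: L_def)
    then have "length v \<le> Max L" using fin by simp
    then have "v = take (length v) (take_word (Max L) x)"
      using eq by (simp add: take_take_word min_def)
    then show "prefix v (take_word (Max L) x)" by (metis take_is_prefix)
  qed
  then show ?thesis by blast
qed

text \<open>A common prefix of the translated set either stops inside \<open>a\<close> or is
  \<open>a\<close> followed by a common prefix of \<open>A\<close>.\<close>

lemma is_gcp_append:
  assumes "A \<noteq> {}" "is_gcp v A" shows "is_gcp (a @ v) ((\<frown>) a ` A)"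
  unfolding is_gcp_def
proof (intro conjI allI impI)
  show "common_prefix (a @ v) ((\<frown>) a ` A)"
    using assms(2) by (auto simp: is_gcp_def common_prefix_def take_word_append_word)
  fix u assume u: "common_prefix u ((\<frown>) a ` A)"
  show "prefix u (a @ v)"
  proof (cases "length u \<le> length a")
    case True
    obtain x where "x \<in> A" using assms(1) by blast
    then have "u = take (length u) a"
      using u True by (auto simp: common_prefix_def take_word_append_word)
    then show ?thesis by (metis prefix_prefix take_is_prefix)
  next
    case False
    then have eq: "u = a @ take_word (length u - length a) x" if "x \<in> A" for x
      using u that by (auto simp: common_prefix_def take_word_append_word)
    obtain x where x: "x \<in> A" using assms(1) by blast
    have "common_prefix (take_word (length u - length a) x) A"
      unfolding common_prefix_def using eq x by (metis take_word_length same_append_eq)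
    then have "prefix (take_word (length u - length a) x) v"
      using assms(2) by (simp add: is_gcp_def)
    then show ?thesis using eq[OF x] by (metis same_prefix_prefix)
  qed
qed

text \<open>What a minimal transducer of \<open>f\<close> has written after reading
  \<open>w\<close>.\<close>

definition gcpf :: "nat \<Rightarrow> (iword \<Rightarrow> iword) \<Rightarrow> letter list \<Rightarrow> letter list" where
  "gcpf n f w = gcp (cone n f w)"

text \<open>The map of the state reached by \<open>w\<close>. The restriction makes equality of
  functions the same as equality of states.\<close>

definition loc :: "nat \<Rightarrow> (iword \<Rightarrow> iword) \<Rightarrow> letter list \<Rightarrow> iword \<Rightarrow> iword" where
  "loc n f w = (\<lambda>x\<in>cantor n. drop_word (length (gcpf n f w)) (f (w \<frown> x)))"

text \<open>Ensures that the definite description in \<open>gcp\<close> denotes; in all uses it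
  follows from injectivity.\<close>

definition splits :: "nat \<Rightarrow> (iword \<Rightarrow> iword) \<Rightarrow> letter list \<Rightarrow> bool" where
  "splits n f w \<longleftrightarrow> (\<exists>x\<in>cantor n. \<exists>y\<in>cantor n. f (w \<frown> x) \<noteq> f (w \<frown> y))"

lemma cone_cong: "(\<And>x. x \<in> cantor n \<Longrightarrow> f (w \<frown> x) = g (v \<frown> x)) \<Longrightarrow> cone n f w = cone n g v"
  unfolding cone_def by (auto; metis)

lemma gcpf_cong: "(\<And>x. x \<in> cantor n \<Longrightarrow> f (w \<frown> x) = g (v \<frown> x)) \<Longrightarrow> gcpf n f w = gcpf n g v"
  unfolding gcpf_def using cone_cong[of n f w g v] by simp

lemma loc_cong: "(\<And>x. x \<in> cantor n \<Longrightarrow> f (w \<frown> x) = g (v \<frown> x)) \<Longrightarrow> loc n f w = loc n g v"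
  unfolding loc_def using gcpf_cong[of n f w g v] by (auto simp: restrict_def)

lemma coneI: "x \<in> cantor n \<Longrightarrow> f (w \<frown> x) \<in> cone n f w"
  by (auto simp: cone_def)

lemma is_gcp_gcpf: "splits n f w \<Longrightarrow> is_gcp (gcpf n f w) (cone n f w)"
  unfolding gcpf_def splits_def
proof -
  assume "\<exists>x\<in>cantor n. \<exists>y\<in>cantor n. f (w \<frown> x) \<noteq> f (w \<frown> y)"
  then obtain v where "is_gcp v (cone n f w)" using ex_is_gcp coneI by metis
  then show "is_gcp (gcp (cone n f w)) (cone n f w)" using gcp_eqI by metis
qed

lemma take_gcp: "is_gcp v (cone n f w) \<Longrightarrow> x \<in> cantor n \<Longrightarrow> take_word (length v) (f (w \<frown> x)) = v"
  by (auto simp: is_gcp_def common_prefix_def cone_def)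

lemma loc_eq: "splits n f w \<Longrightarrow> x \<in> cantor n \<Longrightarrow> f (w \<frown> x) = gcpf n f w \<frown> loc n f w x"
  using take_word_eqD[OF take_gcp[OF is_gcp_gcpf]] by (simp add: loc_def)

lemma loc_extensional [simp]: "loc n f w \<in> extensional (cantor n)"
  by (simp add: loc_def)

text \<open>Local maps do not see a prefix written beforehand. The cocycle rule, the treatment of
  composites and the transplanting of cores all reduce to this invariance.\<close>

lemma gcpf_prepend:
  assumes "splits n g v" "\<And>x. x \<in> cantor n \<Longrightarrow> f (w \<frown> x) = a \<frown> g (v \<frown> x)"
  shows "gcpf n f w = a @ gcpf n g v" "loc n f w = loc n g v"
proof -
  have "cone n f w = (\<frown>) a ` cone n g v"
    using assms(2) by (force simp: image_def cone_def)
  moreover have "cone n g v \<noteq> {}" using assms(1) by (auto simp: splits_def cone_def)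
  ultimately have "is_gcp (a @ gcpf n g v) (cone n f w)"
    using is_gcp_append is_gcp_gcpf[OF assms(1)] by metis
  then show 1: "gcpf n f w = a @ gcpf n g v" unfolding gcpf_def by (rule gcp_eqI)
  show "loc n f w = loc n g v"
    unfolding loc_def 1
    by (auto simp: restrict_def assms(2) fun_eq_iff)
qed

lemma splits_prepend: "(\<And>x. x \<in> cantor n \<Longrightarrow> f (w \<frown> x) = a \<frown> g (v \<frown> x)) \<Longrightarrow> splits n f w = splits n g v"
  by (simp add: splits_def)

text \<open>The cocycle rule of a transducer: on the cone of \<open>w\<close> the map
  \<open>f\<close> is its local map behind a fixed prefix, so \<open>gcpf_prepend\<close> applies.
  It turns local maps into states with transitions \<open>loc n g [i]\<close> and outputs
  \<open>gcpf n g [i]\<close>.\<close>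

lemma
  assumes "splits n f w" "splits n f (w @ u)" "u \<in> lists (letters n)"
  shows gcpf_append: "gcpf n f (w @ u) = gcpf n f w @ gcpf n (loc n f w) u"
    and loc_append: "loc n f (w @ u) = loc n (loc n f w) u"
    and splits_loc: "splits n (loc n f w) u"
proof -
  have *: "f ((w @ u) \<frown> x) = gcpf n f w \<frown> loc n f w (u \<frown> x)" if "x \<in> cantor n" for x
    using loc_eq[OF assms(1), of "u \<frown> x"] that assms(3) by simp
  then show s: "splits n (loc n f w) u"
    using assms(2) splits_prepend[of n f "w @ u" _ "loc n f w" u] by blast
  show "gcpf n f (w @ u) = gcpf n f w @ gcpf n (loc n f w) u"
       "loc n f (w @ u) = loc n (loc n f w) u"
    using gcpf_prepend[OF s *] by blast+
qed

section \<open>Synchronizing maps and their cores\<close>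

definition ucont :: "nat \<Rightarrow> letter set \<Rightarrow> (iword \<Rightarrow> iword) \<Rightarrow> bool" where
  "ucont n D f \<longleftrightarrow> (\<forall>l. \<exists>m. \<forall>x\<in>inf_words n D. \<forall>y\<in>inf_words n D.
     take_word m x = take_word m y \<longrightarrow> take_word l (f x) = take_word l (f y))"

text \<open>Synchronization as a property of the map: the end \<open>u\<close> of an input forces
  the state. The start must be nonempty because over \<open>dots r\<close> the initial state cannot
  read \<open>u\<close>.\<close>

definition syncs :: "nat \<Rightarrow> letter set \<Rightarrow> (iword \<Rightarrow> iword) \<Rightarrow> nat \<Rightarrow> bool" where
  "syncs n D f k \<longleftrightarrow> (\<forall>w\<in>nefin n D. \<forall>w'\<in>nefin n D. \<forall>u\<in>lists (letters n).
     k \<le> length u \<longrightarrow> loc n f (w @ u) = loc n f (w' @ u))"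

text \<open>Separate alphabets \<open>D\<close> and \<open>E\<close> of first letters let
  homeomorphisms and their local maps be treated together.\<close>

definition sync_map :: "nat \<Rightarrow> letter set \<Rightarrow> letter set \<Rightarrow> (iword \<Rightarrow> iword) \<Rightarrow> bool" where
  "sync_map n D E f \<longleftrightarrow> f ` inf_words n D \<subseteq> inf_words n E \<and> inj_on f (inf_words n D)
     \<and> ucont n D f \<and> (\<exists>k. syncs n D f k)"

text \<open>The recurrent local maps. This form mentions no level of synchronization;
  \<open>core_maps_eq\<close> recovers the states forced by words of length
  \<open>m\<close>.\<close>

definition core_maps :: "nat \<Rightarrow> letter set \<Rightarrow> (iword \<Rightarrow> iword) \<Rightarrow> (iword \<Rightarrow> iword) set" where
  "core_maps n D f = {g. \<forall>m. \<exists>w\<in>nefin n D. m \<le> length w \<and> loc n f w = g}"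

lemma syncsD:
  "syncs n D f k \<Longrightarrow> w \<in> nefin n D \<Longrightarrow> w' \<in> nefin n D \<Longrightarrow> u \<in> lists (letters n) \<Longrightarrow> k \<le> length u
    \<Longrightarrow> loc n f (w @ u) = loc n f (w' @ u)"
  unfolding syncs_def by blast

lemma sync_mapD:
  assumes "sync_map n D E f"
  shows "x \<in> inf_words n D \<Longrightarrow> f x \<in> inf_words n E" "inj_on f (inf_words n D)" "ucont n D f"
    "\<exists>k. syncs n D f k"
  using assms by (auto simp: sync_map_def)

locale alphabet =
  fixes n :: nat
  assumes n2: "2 \<le> n"
begin

abbreviation "C \<equiv> cantor n"
abbreviation "L \<equiv> lists (letters n)"

lemma Lt0 [simp]: "Lt 0 \<in> letters n"
  using n2 by (auto simp: letters_def)

lemma replicate_L [simp]: "replicate k (Lt 0) \<in> L"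
  by (induction k) auto

lemma zeros_C [simp]: "(\<lambda>_. Lt 0) \<in> C"
  by (simp add: cantor_eq)

lemma ones_C: "(\<lambda>_. Lt 1) \<in> C"
  using n2 by (auto simp: cantor_eq letters_def)

lemma splits_inj:
  assumes "inj_on f (inf_words n D)" "\<And>x. x \<in> C \<Longrightarrow> w \<frown> x \<in> inf_words n D"
  shows "splits n f w"
proof -
  have "w \<frown> (\<lambda>_. Lt 0) \<noteq> w \<frown> (\<lambda>_. Lt 1)"
    by (auto dest: fun_cong)
  then have "f (w \<frown> (\<lambda>_. Lt 0)) \<noteq> f (w \<frown> (\<lambda>_. Lt 1))"
    using inj_on_eq_iff[OF assms(1) assms(2)[OF zeros_C] assms(2)[OF ones_C]] by simp
  then show ?thesis unfolding splits_def using ones_C zeros_C by blast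
qed

lemma splits_ne: "inj_on f (inf_words n D) \<Longrightarrow> w \<in> nefin n D \<Longrightarrow> splits n f w"
  by (rule splits_inj) (auto intro: inf_words_appendI)

lemma splits_C: "inj_on f C \<Longrightarrow> w \<in> L \<Longrightarrow> splits n f w"
  by (rule splits_inj[of f "letters n"]) auto

text \<open>On a deep enough cone the first \<open>l\<close> letters of the value are constant,
  hence a common prefix. Every later bound on how much has been written comes from here.\<close>

lemma ucont_gcpf:
  assumes "ucont n D f" "inj_on f (inf_words n D)"
  shows "\<exists>m. \<forall>w\<in>nefin n D. m \<le> length w \<longrightarrow> l \<le> length (gcpf n f w)"
proof -
  obtain m where m: "\<And>x y. x \<in> inf_words n D \<Longrightarrow> y \<in> inf_words n D \<Longrightarrow>
     take_word m x = take_word m y \<Longrightarrow> take_word l (f x) = take_word l (f y)"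
    using assms(1) unfolding ucont_def by metis
  have "l \<le> length (gcpf n f w)" if w: "w \<in> nefin n D" "m \<le> length w" for w
  proof -
    define v where "v = take_word l (f (w \<frown> (\<lambda>_. Lt 0)))"
    have len: "length v = l" by (simp add: v_def)
    have "take_word l (f (w \<frown> y)) = v" if "y \<in> C" for y
      unfolding v_def
      using that w by (intro m) (auto simp: take_word_append_word inf_words_appendI)
    then have "common_prefix v (cone n f w)"
      by (auto simp: common_prefix_def cone_def len)
    then have "prefix v (gcpf n f w)"
      using is_gcp_gcpf[OF splits_ne[OF assms(2) w(1)]] by (simp add: is_gcp_def)
    then show ?thesis using len by (metis prefix_length_le)
  qed
  then show ?thesis by blast
qed

lemma gcpf_fin_words:
  assumes "sync_map n D E f" "w \<in> nefin n D" shows "gcpf n f w \<in> fin_words n E"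
proof -
  have "f (w \<frown> (\<lambda>_. Lt 0)) \<in> inf_words n E"
    using assms sync_mapD(1) inf_words_appendI zeros_C by blast
  moreover have "take_word (length (gcpf n f w)) (f (w \<frown> (\<lambda>_. Lt 0))) = gcpf n f w"
    using take_gcp[OF is_gcp_gcpf[OF splits_ne]] assms sync_mapD(2) zeros_C by blast
  ultimately show ?thesis by (metis take_inf_words)
qed

lemma sync_map_loc_eq:
  "sync_map n D E f \<Longrightarrow> w \<in> nefin n D \<Longrightarrow> x \<in> C \<Longrightarrow> f (w \<frown> x) = gcpf n f w \<frown> loc n f w x"
  using loc_eq splits_ne sync_mapD(2) by blast

lemma
  assumes "sync_map n D E f" "w \<in> nefin n D" "u \<in> L"
  shows sync_map_gcpf_append: "gcpf n f (w @ u) = gcpf n f w @ gcpf n (loc n f w) u"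
    and sync_map_loc_append: "loc n f (w @ u) = loc n (loc n f w) u"
  using gcpf_append loc_append splits_ne[OF sync_mapD(2)[OF assms(1)]] assms(2,3) nefin_append
  by blast+

text \<open>The first letter of the value, the only one that may be dotted, lies in the prefix
  already written.\<close>

lemma loc_range:
  assumes "sync_map n D E f" "w \<in> nefin n D" "gcpf n f w \<noteq> []" "x \<in> C"
  shows "loc n f w x \<in> C"
proof -
  have "f (w \<frown> x) \<in> inf_words n E"
    using assms sync_mapD(1) inf_words_appendI by blast
  then show ?thesis
    using sync_map_loc_eq[OF assms(1,2,4)] assms(3) by (simp add: inf_words_append)
qed

lemma sync_map_loc:
  assumes f: "sync_map n D E f" and w: "w \<in> nefin n D" "gcpf n f w \<noteq> []"
  shows "sync_map n (letters n) (letters n) (loc n f w)"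
  unfolding sync_map_def
proof (intro conjI)
  let ?q = "loc n f w"
  show "?q ` inf_words n (letters n) \<subseteq> inf_words n (letters n)"
    using loc_range[OF f w] by auto
  show "inj_on ?q (inf_words n (letters n))"
  proof (rule inj_onI)
    fix x y assume xy: "x \<in> inf_words n (letters n)" "y \<in> inf_words n (letters n)" "?q x = ?q y"
    then have eq: "f (w \<frown> x) = f (w \<frown> y)" using sync_map_loc_eq[OF f w(1)] by simp
    have "w \<frown> x = w \<frown> y"
      using inj_on_eq_iff[OF sync_mapD(2)[OF f], of "w \<frown> x" "w \<frown> y"] eq xy
        inf_words_appendI[OF w(1)] by simp
    then show "x = y" by simp
  qed
  show "ucont n (letters n) ?q"
    unfolding ucont_def
  proof
    fix l
    let ?g = "gcpf n f w"
    obtain m where m: "\<And>x y. x \<in> inf_words n D \<Longrightarrow> y \<in> inf_words n D \<Longrightarrow>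
       take_word m x = take_word m y \<Longrightarrow> take_word (length ?g + l) (f x) = take_word (length ?g + l) (f y)"
      using sync_mapD(3)[OF f] unfolding ucont_def by metis
    have "take_word l (?q x) = take_word l (?q y)"
      if "x \<in> C" "y \<in> C" "take_word m x = take_word m y" for x y
    proof -
      have "take_word m (w \<frown> x) = take_word m (w \<frown> y)"
        using take_word_mono[OF that(3)] by (simp add: take_word_append_word)
      then have "take_word (length ?g + l) (f (w \<frown> x)) = take_word (length ?g + l) (f (w \<frown> y))"
        using m that w(1) inf_words_appendI by blast
      then show ?thesis
        using sync_map_loc_eq[OF f w(1)] that by (simp add: take_word_append_word)
    qed
    then show "\<exists>m. \<forall>x\<in>inf_words n (letters n). \<forall>y\<in>inf_words n (letters n).
       take_word m x = take_word m y \<longrightarrow> take_word l (?q x) = take_word l (?q y)"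
      unfolding inf_words_letters by blast
  qed
  obtain k where k: "syncs n D f k" using sync_mapD(4)[OF f] by blast
  have "syncs n (letters n) ?q k"
    unfolding syncs_def
  proof (intro ballI impI)
    fix v v' u assume v: "v \<in> nefin n (letters n)" "v' \<in> nefin n (letters n)" "u \<in> L" "k \<le> length u"
    have eq: "loc n ?q (z @ u) = loc n f ((w @ z) @ u)" if "z \<in> nefin n (letters n)" for z
      using sync_map_loc_append[OF f w(1), of "z @ u"] that v(3) by simp
    show "loc n ?q (v @ u) = loc n ?q (v' @ u)"
      unfolding eq[OF v(1)] eq[OF v(2)]
      using v by (intro syncsD[OF k] nefin_append[OF w(1)]) auto
  qed
  then show "\<exists>k. syncs n (letters n) ?q k" by blast
qed

text \<open>A long word is cut before its last \<open>m\<close> letters and synchronization replaces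
  the front by \<open>w\<close>. Conversely, zeros inserted after \<open>w\<close> make the word as
  long as desired without changing the local map.\<close>

lemma core_maps_eq:
  assumes "syncs n D f k" "w \<in> nefin n D" "k \<le> m"
  shows "core_maps n D f = (\<lambda>u. loc n f (w @ u)) ` words_of_length n m"
proof (intro equalityI subsetI)
  fix g assume "g \<in> core_maps n D f"
  then obtain z where z: "z \<in> nefin n D" "Suc m \<le> length z" "loc n f z = g"
    unfolding core_maps_def by blast
  define v where "v = take (length z - m) z"
  define u where "u = drop (length z - m) z"
  have zvu: "z = v @ u" by (simp add: v_def u_def)
  have "v \<noteq> []" using z(2) by (auto simp: v_def)
  then have vu: "v \<in> nefin n D" "u \<in> L"
    using z(1) append_fin_words[of v u n D] by (auto simp: zvu nefin_iff)
  have u: "length u = m" using z(2) by (simp add: u_def)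
  then have "g = loc n f (w @ u)"
    using syncsD[OF assms(1) vu(1) assms(2) vu(2)] assms(3) z(3) zvu by simp
  then show "g \<in> (\<lambda>u. loc n f (w @ u)) ` words_of_length n m"
    using vu u by (auto simp: words_of_length_def)
next
  fix g assume "g \<in> (\<lambda>u. loc n f (w @ u)) ` words_of_length n m"
  then obtain u where u: "u \<in> L" "length u = m" "g = loc n f (w @ u)"
    by (auto simp: words_of_length_def)
  have "\<exists>z\<in>nefin n D. j \<le> length z \<and> loc n f z = g" for j
  proof (intro bexI conjI)
    have w': "w @ replicate j (Lt 0) \<in> nefin n D" using assms(2) by (rule nefin_append) simp
    then show "(w @ replicate j (Lt 0)) @ u \<in> nefin n D" using u(1) by (rule nefin_append)
    show "loc n f ((w @ replicate j (Lt 0)) @ u) = g"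
      using syncsD[OF assms(1) w' assms(2) u(1)] u(2,3) assms(3) by simp
    show "j \<le> length ((w @ replicate j (Lt 0)) @ u)" by simp
  qed
  then show "g \<in> core_maps n D f" by (simp add: core_maps_def)
qed

text \<open>Serves to identify cores of maps on different spaces, which is why the starts
  \<open>w\<close> and \<open>v\<close> may lie over different alphabets.\<close>

lemma core_maps_eqI:
  assumes "\<exists>k. syncs n D f k" "\<exists>k. syncs n E g k" "w \<in> nefin n D" "v \<in> nefin n E"
    and "\<And>u. u \<in> L \<Longrightarrow> m \<le> length u \<Longrightarrow> loc n f (w @ u) = loc n g (v @ u)"
  shows "core_maps n D f = core_maps n E g"
proof -
  obtain k k' where k: "syncs n D f k" "syncs n E g k'" using assms(1,2) by blast
  let ?m = "max m (max k k')"
  have "core_maps n D f = (\<lambda>u. loc n f (w @ u)) ` words_of_length n ?m"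
    by (rule core_maps_eq[OF k(1) assms(3)]) simp
  also have "\<dots> = (\<lambda>u. loc n g (v @ u)) ` words_of_length n ?m"
    using assms(5) by (intro image_cong) (auto simp: words_of_length_def)
  also have "\<dots> = core_maps n E g"
    by (rule core_maps_eq[OF k(2) assms(4), symmetric]) simp
  finally show ?thesis .
qed

lemma core_mapsE:
  assumes f: "sync_map n D E f" and q: "q \<in> core_maps n D f"
  obtains w where "w \<in> nefin n D" "m \<le> length w" "l \<le> length (gcpf n f w)" "q = loc n f w"
proof -
  obtain k where "\<forall>w\<in>nefin n D. k \<le> length w \<longrightarrow> l \<le> length (gcpf n f w)"
    using ucont_gcpf[OF sync_mapD(3,2)[OF f]] by blast
  moreover obtain w where "w \<in> nefin n D" "max m k \<le> length w" "loc n f w = q"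
    using q unfolding core_maps_def by blast
  ultimately show ?thesis using that[of w] by simp
qed

lemma sync_map_core:
  assumes "sync_map n D E f" "q \<in> core_maps n D f"
  shows "sync_map n (letters n) (letters n) q"
proof -
  obtain w where "w \<in> nefin n D" "1 \<le> length (gcpf n f w)" "q = loc n f w"
    using core_mapsE[OF assms] by metis
  then show ?thesis using sync_map_loc[OF assms(1), of w] by fastforce
qed

lemma finite_core_maps:
  assumes "sync_map n D E f" shows "finite (core_maps n D f)"
proof (cases "\<exists>w. w \<in> nefin n D")
  case True
  then show ?thesis using core_maps_eq sync_mapD(4)[OF assms]
    by (metis finite_imageI finite_words_of_length order_refl)
next
  case False then have "core_maps n D f = {}" unfolding core_maps_def by auto
  then show ?thesis by simp
qed

lemma core_maps_nonempty:
  assumes "sync_map n D E f" "d \<in> D" shows "core_maps n D f \<noteq> {}"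
proof -
  obtain k where "syncs n D f k" using sync_mapD(4)[OF assms(1)] by blast
  then have "core_maps n D f = (\<lambda>u. loc n f ([d] @ u)) ` words_of_length n k"
    by (rule core_maps_eq) (use assms in auto)
  moreover have "replicate k (Lt 0) \<in> words_of_length n k" by (simp add: words_of_length_def del: in_lists_conv_set set_replicate_conv_if)
  ultimately show ?thesis by blast
qed


section \<open>Composition\<close>

text \<open>The composite of the two local maps may have a common prefix of its own; the outer
  \<open>loc n _ []\<close> deletes it.\<close>

lemma loc_comp:
  assumes f: "sync_map n D E f" and g: "sync_map n E F g"
    and w: "w \<in> nefin n D" "gcpf n f w \<noteq> []"
  shows "loc n (g \<circ> f) w = loc n (loc n g (gcpf n f w) \<circ> loc n f w) []"
proof -
  let ?a = "gcpf n f w"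
  have a: "?a \<in> nefin n E" using gcpf_fin_words[OF f w(1)] w(2) by (simp add: nefin_iff)
  have eq: "(g \<circ> f) (w \<frown> x) = gcpf n g ?a \<frown> (loc n g ?a \<circ> loc n f w) ([] \<frown> x)" if "x \<in> C" for x
    using that by (simp add: sync_map_loc_eq[OF f w(1)] sync_map_loc_eq[OF g a] loc_range[OF f w])
  have "inj_on (g \<circ> f) (inf_words n D)"
    using sync_mapD(1,2)[OF f] sync_mapD(2)[OF g]
    by (intro comp_inj_on) (auto intro: inj_on_subset)
  then have "splits n (g \<circ> f) w" by (rule splits_ne[OF _ w(1)])
  then have "splits n (loc n g ?a \<circ> loc n f w) []"
    using splits_prepend[of n "g \<circ> f" w] eq by blast
  then show ?thesis using gcpf_prepend(2) eq by blast
qed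

text \<open>For the composite it is not enough that the state of \<open>f\<close> is forced: the
  last letters that \<open>f\<close> passes on to \<open>g\<close> must also be independent of the
  start, and numerous enough to force the state of \<open>g\<close>.\<close>

lemma sync_map_comp:
  assumes f: "sync_map n D E f" and g: "sync_map n E F g"
  shows "sync_map n D F (g \<circ> f)"
  unfolding sync_map_def
proof (intro conjI)
  show "(g \<circ> f) ` inf_words n D \<subseteq> inf_words n F"
    using sync_mapD(1)[OF f] sync_mapD(1)[OF g] by auto
  show "inj_on (g \<circ> f) (inf_words n D)"
    using sync_mapD(1,2)[OF f] sync_mapD(2)[OF g]
    by (intro comp_inj_on) (auto intro: inj_on_subset)
  show "ucont n D (g \<circ> f)"
    unfolding ucont_def
  proof
    fix l
    obtain m where m: "\<forall>x\<in>inf_words n E. \<forall>y\<in>inf_words n E.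
       take_word m x = take_word m y \<longrightarrow> take_word l (g x) = take_word l (g y)"
      using sync_mapD(3)[OF g] unfolding ucont_def by blast
    obtain k where "\<forall>x\<in>inf_words n D. \<forall>y\<in>inf_words n D.
       take_word k x = take_word k y \<longrightarrow> take_word m (f x) = take_word m (f y)"
      using sync_mapD(3)[OF f] unfolding ucont_def by blast
    then show "\<exists>k. \<forall>x\<in>inf_words n D. \<forall>y\<in>inf_words n D.
       take_word k x = take_word k y \<longrightarrow> take_word l ((g \<circ> f) x) = take_word l ((g \<circ> f) y)"
      using m sync_mapD(1)[OF f] by (metis comp_apply)
  qed
  show "\<exists>k. syncs n D (g \<circ> f) k"
  proof (cases "D = {}")
    case True
    then have "nefin n D = {}" by (auto elim: nefinE)
    then show ?thesis by (auto simp: syncs_def)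
  next
    case False
    then obtain d where d: "d \<in> D" by blast
    obtain k1 where k1: "syncs n D f k1" using sync_mapD(4)[OF f] by blast
    obtain k2 where k2: "syncs n E g k2" using sync_mapD(4)[OF g] by blast
    obtain m1 where m1: "\<And>w. w \<in> nefin n D \<Longrightarrow> m1 \<le> length w \<Longrightarrow> 1 \<le> length (gcpf n f w)"
      using ucont_gcpf[OF sync_mapD(3,2)[OF f]] by meson
    define k where "k = max k1 m1"
    \<comment> \<open>\<open>B\<close> bounds what \<open>f\<close> writes up to the end of
      \<open>u1\<close>, so that a total output of \<open>B + k2\<close> letters leaves at least
      \<open>k2\<close> letters written during \<open>u2\<close>.\<close>
    define B where "B = Max ((\<lambda>u. length (gcpf n f ([d] @ u))) ` words_of_length n k)"
    obtain m where m: "\<And>w. w \<in> nefin n D \<Longrightarrow> m \<le> length w \<Longrightarrow> B + k2 \<le> length (gcpf n f w)"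
      using ucont_gcpf[OF sync_mapD(3,2)[OF f]] by meson
    have "syncs n D (g \<circ> f) (k + m)"
      unfolding syncs_def
    proof (intro ballI impI)
      fix w w' u assume w: "w \<in> nefin n D" "w' \<in> nefin n D" and u: "u \<in> L" "k + m \<le> length u"
      define u1 where "u1 = take k u"
      define u2 where "u2 = drop k u"
      have uu: "u = u1 @ u2" by (simp add: u1_def u2_def)
      have uL: "u1 \<in> L" "u2 \<in> L" using u(1) by (auto simp: uu)
      have l: "length u1 = k" "m \<le> length u2" using u(2) by (auto simp: u1_def u2_def)
      have d1: "[d] \<in> nefin n D" using d by simp
      \<comment> \<open>The state of \<open>f\<close> forced by \<open>u1\<close>. What is written
        during \<open>u2\<close> depends on \<open>c\<close> alone, so its length may be measured
        from the start \<open>[d]\<close>.\<close>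
      define c where "c = loc n f ([d] @ u1)"
      have A: "loc n f (z @ u1) = c" "gcpf n f (z @ u1) \<noteq> []"
        "gcpf n f (z @ u) = gcpf n f (z @ u1) @ gcpf n c u2" "loc n f (z @ u) = loc n c u2"
        if z: "z \<in> nefin n D" for z
      proof -
        have zu: "z @ u1 \<in> nefin n D" using z uL(1) by (rule nefin_append)
        show 1: "loc n f (z @ u1) = c"
          unfolding c_def using l(1) by (intro syncsD[OF k1 z d1 uL(1)]) (simp add: k_def)
        show "gcpf n f (z @ u1) \<noteq> []"
          using m1[OF zu] l(1) by (fastforce simp: k_def)
        show "gcpf n f (z @ u) = gcpf n f (z @ u1) @ gcpf n c u2" "loc n f (z @ u) = loc n c u2"
          using sync_map_gcpf_append[OF f zu uL(2)] sync_map_loc_append[OF f zu uL(2)] 1 uu by auto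
      qed
      have "length (gcpf n f ([d] @ u1)) \<le> B"
        unfolding B_def using uL(1) l(1) by (intro Max_ge finite_imageI finite_words_of_length imageI) (simp add: words_of_length_def)
      moreover have "B + k2 \<le> length (gcpf n f ([d] @ u))"
        using m[OF nefin_append[OF d1 u(1)]] l by (simp add: uu)
      ultimately have len: "k2 \<le> length (gcpf n c u2)"
        using A(3)[OF d1] by simp
      have fw: "gcpf n f (z @ u1) \<in> nefin n E" "gcpf n f (z @ u) \<noteq> []" "z @ u \<in> nefin n D"
        if z: "z \<in> nefin n D" for z
        using gcpf_fin_words[OF f nefin_append[OF z uL(1)]] A[OF z] nefin_append[OF z u(1)] by (auto simp: nefin_iff)
      have cL: "gcpf n c u2 \<in> L"
        using gcpf_fin_words[OF f fw(3)[OF w(1)]] A(3)[OF w(1)] A(2)[OF w(1)]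
        by (simp add: append_fin_words)
      have "loc n g (gcpf n f (w @ u)) = loc n g (gcpf n f (w' @ u))"
        unfolding A(3)[OF w(1)] A(3)[OF w(2)]
        by (rule syncsD[OF k2 fw(1)[OF w(1)] fw(1)[OF w(2)] cL len])
      then show "loc n (g \<circ> f) (w @ u) = loc n (g \<circ> f) (w' @ u)"
        using loc_comp[OF f g fw(3)[OF w(1)] fw(2)[OF w(1)]]
          loc_comp[OF f g fw(3)[OF w(2)] fw(2)[OF w(2)]] A(4) w by simp
    qed
    then show ?thesis by blast
  qed
qed

text \<open>After long inputs the outputs of \<open>p\<close> synchronize \<open>g\<close>, so it
  does not matter that \<open>q\<close> was reached by a word unrelated to the run of
  \<open>f\<close>. This is the independence of the product of cores from the chosen states.\<close>

lemma core_maps_comp: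
  assumes f: "sync_map n D E f" and g: "sync_map n E F g"
    and p: "p \<in> core_maps n D f" and q: "q \<in> core_maps n E g"
  shows "core_maps n (letters n) (q \<circ> p) = core_maps n D (g \<circ> f)"
proof -
  note sp = sync_map_core[OF f p] and sq = sync_map_core[OF g q]
  obtain w where w: "w \<in> nefin n D" "1 \<le> length (gcpf n f w)" "p = loc n f w"
    using core_mapsE[OF f p] by metis
  obtain c where c: "c \<in> nefin n E" "q = loc n g c"
    using core_mapsE[OF g q] by metis
  obtain k where k: "syncs n E g k" using sync_mapD(4)[OF g] by blast
  \<comment> \<open>\<open>Suc k\<close> rather than \<open>k\<close>: the output must also be
    nonempty for \<open>loc_comp\<close>.\<close>
  obtain m where m: "\<And>u. u \<in> nefin n (letters n) \<Longrightarrow> m \<le> length u \<Longrightarrow> Suc k \<le> length (gcpf n p u)"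
    using ucont_gcpf[OF sync_mapD(3,2)[OF sp]] by meson
  have a: "gcpf n f w \<in> nefin n E" using gcpf_fin_words[OF f w(1)] w(2) by (auto simp: nefin_iff)
  show ?thesis
  \<comment> \<open>The letter \<open>Lt 0\<close>, inserted on both sides, makes the start for the
    composite of \<open>p\<close> and \<open>q\<close> nonempty.\<close>
  proof (rule core_maps_eqI[where w = "[Lt 0]" and v = "w @ [Lt 0]" and m = m])
    show "\<exists>k. syncs n (letters n) (q \<circ> p) k" "\<exists>k. syncs n D (g \<circ> f) k"
      using sync_map_comp[OF sp sq] sync_map_comp[OF f g] sync_mapD(4) by blast+
    show "[Lt 0] \<in> nefin n (letters n)" "w @ [Lt 0] \<in> nefin n D"
      using nefin_append[OF w(1), of "[Lt 0]"] by simp_all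
    fix u assume "u \<in> L" "m \<le> length u"
    define u' where "u' = [Lt 0] @ u"
    have u': "u' \<in> nefin n (letters n)" "u' \<in> L" "m \<le> length u'"
      using \<open>u \<in> L\<close> \<open>m \<le> length u\<close> by (auto simp: u'_def)
    let ?v = "gcpf n p u'"
    have v: "Suc k \<le> length ?v" "?v \<in> L" using m[OF u'(1,3)] gcpf_fin_words[OF sp u'(1)] by auto
    have wu: "w @ u' \<in> nefin n D" using w(1) u'(2) by (rule nefin_append)
    have av: "gcpf n f (w @ u') = gcpf n f w @ ?v" "loc n f (w @ u') = loc n p u'"
      using sync_map_gcpf_append[OF f w(1) u'(2)] sync_map_loc_append[OF f w(1) u'(2)] w(3) by auto
    have "?v \<noteq> []" using v(1) by auto
    have "loc n g (gcpf n f w @ ?v) = loc n g (c @ ?v)"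
      by (rule syncsD[OF k a c(1) v(2)]) (use v in simp)
    also have "\<dots> = loc n q ?v" using sync_map_loc_append[OF g c(1) v(2)] c(2) by simp
    finally have "loc n g (gcpf n f (w @ u')) = loc n q ?v" using av by simp
    then have "loc n (g \<circ> f) (w @ u') = loc n (loc n q ?v \<circ> loc n p u') []"
      using loc_comp[OF f g wu] av \<open>?v \<noteq> []\<close> by simp
    also have "\<dots> = loc n (q \<circ> p) u'"
      using loc_comp[OF sp sq u'(1)] \<open>?v \<noteq> []\<close> by simp
    finally show "loc n (q \<circ> p) ([Lt 0] @ u) = loc n (g \<circ> f) ((w @ [Lt 0]) @ u)"
      by (simp add: u'_def)
  qed
qed

end

section \<open>Minimal transducers and local maps\<close>

text \<open>The common part of both kinds of transducers. After one step only plain letters can be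
  read, so for words \<open>I\<close> restricts the first letter alone.\<close>

definition machine :: "nat \<Rightarrow> ('q \<Rightarrow> letter set) \<Rightarrow> 'q transducer \<Rightarrow> bool" where
  "machine n I T \<longleftrightarrow>
     (\<forall>q\<in>states T. \<forall>i\<in>I q. step T i q \<in> states T \<and> I (step T i q) = letters n)
   \<and> (\<forall>q\<in>states T. \<forall>x\<in>inf_words n (I q). infinite_output T q x)"

lemma step_word_append [simp]: "step_word T (v @ w) q = step_word T w (step_word T v q)"
  by (induction v arbitrary: q) auto

lemma out_word_append [simp]: "out_word T (v @ w) q = out_word T v q @ out_word T w (step_word T v q)"
  by (induction v arbitrary: q) auto

lemma out_word_take_prefix:
  assumes "m \<le> m'"
  shows "prefix (out_word T (take_word m x) q) (out_word T (take_word m' x) q)"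
proof -
  have "take_word m' x = take_word m x @ take_word (m' - m) (drop_word m x)"
    using assms take_word_add[of m "m' - m" x] by simp
  then show ?thesis by simp
qed

text \<open>Outputs only grow, so it suffices to compare them after at least \<open>N\<close>
  letters; inputs too short to have passed a given prefix need no treatment.\<close>

lemma state_map_unique:
  assumes "infinite_output T q x"
    and "\<And>m. N \<le> m \<Longrightarrow> take_word (length (out_word T (take_word m x) q)) y = out_word T (take_word m x) q"
  shows "state_map T q x = y"
proof
  fix k
  let ?o = "\<lambda>m. out_word T (take_word m x) q"
  define M where "M = (LEAST m. k < length (?o m))"
  have M: "k < length (?o M)"
    unfolding M_def using assms(1) by (metis (mono_tags, lifting) LeastI infinite_output_def)
  define M' where "M' = max M N"
  have "prefix (?o M) (?o M')" by (rule out_word_take_prefix) (simp add: M'_def)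
  then obtain z where z: "?o M' = ?o M @ z" by (auto simp: prefix_def)
  have "state_map T q x k = ?o M ! k" by (simp add: state_map_def M_def)
  also have "\<dots> = ?o M' ! k" using M z by (simp add: nth_append)
  also have "\<dots> = take_word (length (?o M')) y ! k" using assms(2)[of M'] by (simp add: M'_def)
  also have "\<dots> = y k" using M z by simp
  finally show "state_map T q x k = y k" .
qed

lemma state_map_prefix:
  assumes "infinite_output T q x"
  shows "take_word (length (out_word T (take_word m x) q)) (state_map T q x) = out_word T (take_word m x) q"
proof (rule nth_equalityI)
  fix k assume k: "k < length (take_word (length (out_word T (take_word m x) q)) (state_map T q x))"
  let ?o = "\<lambda>m. out_word T (take_word m x) q"
  define M where "M = (LEAST m. k < length (?o m))"
  have "k < length (?o m)" using k by simp
  then have M: "M \<le> m" "k < length (?o M)"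
    unfolding M_def by (auto intro: Least_le LeastI)
  obtain z where z: "?o m = ?o M @ z"
    using out_word_take_prefix[OF M(1), of T x q] unfolding prefix_def by blast
  have "state_map T q x k = ?o M ! k" by (simp add: state_map_def M_def)
  also have "\<dots> = ?o m ! k" using M z by (simp add: nth_append)
  finally show "take_word (length (?o m)) (state_map T q x) ! k = ?o m ! k" using k by simp
qed simp

lemma state_map_append:
  assumes "infinite_output T q (w \<frown> x)" "infinite_output T (step_word T w q) x"
  shows "state_map T q (w \<frown> x) = out_word T w q \<frown> state_map T (step_word T w q) x"
proof (rule state_map_unique[OF assms(1), where N = "length w"])
  fix m assume m: "length w \<le> m"
  then have "take_word m (w \<frown> x) = w @ take_word (m - length w) x"
    by (simp add: take_word_append_word)
  then show "take_word (length (out_word T (take_word m (w \<frown> x)) q))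
      (out_word T w q \<frown> state_map T (step_word T w q) x) = out_word T (take_word m (w \<frown> x)) q"
    by (simp add: take_word_append_word state_map_prefix[OF assms(2)])
qed

lemma machine_step_word:
  assumes "machine n I T" "q \<in> states T" "w \<in> fin_words n (I q)"
  shows "step_word T w q \<in> states T" "w \<noteq> [] \<Longrightarrow> I (step_word T w q) = letters n"
proof -
  have "w \<in> fin_words n (I q) \<longrightarrow> step_word T w q \<in> states T \<and> (w \<noteq> [] \<longrightarrow> I (step_word T w q) = letters n)"
  proof (induction w rule: rev_induct)
    case Nil show ?case using assms(2) by simp
  next
    case (snoc i w)
    show ?case
    proof
      assume wi: "w @ [i] \<in> fin_words n (I q)"
      show "step_word T (w @ [i]) q \<in> states T
          \<and> (w @ [i] \<noteq> [] \<longrightarrow> I (step_word T (w @ [i]) q) = letters n)"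
      proof (cases "w = []")
        case True
        then show ?thesis using wi assms(1,2) by (simp add: machine_def)
      next
        case False
        then have "w \<in> fin_words n (I q)" "i \<in> letters n"
          using wi by (simp_all add: append_fin_words)
        then show ?thesis using snoc False assms(1) by (simp add: machine_def)
      qed
    qed
  qed
  then show "step_word T w q \<in> states T" "w \<noteq> [] \<Longrightarrow> I (step_word T w q) = letters n"
    using assms(3) by auto
qed

lemma machine_state_map_append:
  assumes "machine n I T" "q \<in> states T" "w \<in> nefin n (I q)" "x \<in> cantor n"
  shows "state_map T q (w \<frown> x) = out_word T w q \<frown> state_map T (step_word T w q) x"
proof (rule state_map_append)
  have w: "w \<in> fin_words n (I q)" "w \<noteq> []" using assms(3) by (auto simp: nefin_iff)
  show "infinite_output T q (w \<frown> x)"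
    using assms inf_words_appendI[OF assms(3,4)] by (simp add: machine_def)
  have "x \<in> inf_words n (I (step_word T w q))"
    using machine_step_word(2)[OF assms(1,2) w] assms(4) by simp
  then show "infinite_output T (step_word T w q) x"
    using machine_step_word(1)[OF assms(1,2) w(1)] assms(1) by (simp add: machine_def)
qed

text \<open>All namings by natural numbers of the transducer whose states are the maps in
  \<open>K\<close>. This describes the class of a core without reference to a chosen minimal
  transducer.\<close>

definition core_class :: "nat \<Rightarrow> (iword \<Rightarrow> iword) set \<Rightarrow> transducer_class" where
  "core_class n K = {U. plain_transducer n U \<and> (\<exists>\<phi>. bij_betw \<phi> (states U) K
     \<and> (\<forall>q\<in>states U. \<forall>i\<in>letters n. \<phi> (step U i q) = loc n (\<phi> q) [i] \<and> outp U i q = gcpf n (\<phi> q) [i]))}"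

locale minimal_machine = alphabet +
  fixes I :: "nat \<Rightarrow> letter set" and T :: "nat transducer" and q0 :: nat and f :: "iword \<Rightarrow> iword"
  assumes mach: "machine n I T" and q0: "q0 \<in> states T" and minim: "minimal n I T q0"
    and rep: "\<And>x. x \<in> inf_words n (I q0) \<Longrightarrow> state_map T q0 x = f x"
begin

abbreviation "D \<equiv> I q0"

abbreviation sm :: "nat \<Rightarrow> iword \<Rightarrow> iword" where
  "sm q \<equiv> restrict (state_map T q) C"

lemma is_gcp_outp:
  assumes "q \<in> states T" "i \<in> I q"
  shows "is_gcp (outp T i q) (cone n (state_map T q) [i])"
proof -
  have "is_gcp (outp T i q) {state_map T q ([i] \<frown> x) |x. x \<in> C}"
    using minim assms by (simp add: minimal_def)
  then show ?thesis by (simp add: cone_def)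
qed

text \<open>Minimality speaks of single letters. The property extends to words letter by letter,
  since a greatest common prefix is compatible with prepending a word.\<close>

lemma is_gcp_out_word:
  assumes "w \<in> nefin n D" shows "is_gcp (out_word T w q0) (cone n f w)"
proof -
  have "w \<in> nefin n D \<longrightarrow> is_gcp (out_word T w q0) (cone n f w)"
  proof (induction w rule: rev_induct)
    case (snoc i w)
    show ?case
    proof
      assume wi: "w @ [i] \<in> nefin n D"
      show "is_gcp (out_word T (w @ [i]) q0) (cone n f (w @ [i]))"
      proof (cases "w = []")
        case True
        have "cone n (state_map T q0) [i] = cone n f [i]"
          by (rule cone_cong) (use wi True rep inf_words_appendI[of "[i]"] in simp)
        then show ?thesis using is_gcp_outp[OF q0, of i] wi True by simp
      next
        case False
        then have w: "w \<in> nefin n D" "w \<in> fin_words n D" "i \<in> letters n"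
          using wi append_fin_words[of w "[i]" n D] by (auto simp: nefin_iff)
        let ?q = "step_word T w q0"
        have q: "?q \<in> states T" "I ?q = letters n"
          using machine_step_word[OF mach q0 w(2)] False by auto
        have "f ((w @ [i]) \<frown> x) = out_word T w q0 \<frown> state_map T ?q ([i] \<frown> x)" if "x \<in> C" for x
          using machine_state_map_append[OF mach q0 w(1), of "[i] \<frown> x"] that w(3)
            rep[OF inf_words_appendI[OF w(1), of "[i] \<frown> x"]] by simp
        then have "cone n f (w @ [i]) = (\<frown>) (out_word T w q0) ` cone n (state_map T ?q) [i]"
          unfolding cone_def by (force simp: image_def)
        moreover have "cone n (state_map T ?q) [i] \<noteq> {}"
          using zeros_C unfolding cone_def by blast
        moreover have "is_gcp (outp T i ?q) (cone n (state_map T ?q) [i])"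
          by (rule is_gcp_outp[OF q(1)]) (use q w in simp)
        ultimately show ?thesis using is_gcp_append by simp
      qed
    qed
  qed simp
  then show ?thesis using assms by blast
qed

lemma rep_append: "w \<in> nefin n D \<Longrightarrow> x \<in> C \<Longrightarrow> f (w \<frown> x) = out_word T w q0 \<frown> state_map T (step_word T w q0) x"
  using machine_state_map_append[OF mach q0, of w x] rep[OF inf_words_appendI, of w x] by simp

lemma gcpf_out_word: "w \<in> nefin n D \<Longrightarrow> gcpf n f w = out_word T w q0"
  unfolding gcpf_def by (rule gcp_eqI[OF is_gcp_out_word])

lemma loc_state_map:
  assumes "w \<in> nefin n D" shows "loc n f w = sm (step_word T w q0)"
  unfolding loc_def gcpf_out_word[OF assms]
  by (rule restrict_ext) (simp add: rep_append[OF assms])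

lemma loc_sm:
  assumes "q \<in> states T" "I q = letters n" "i \<in> letters n"
  shows "gcpf n (sm q) [i] = outp T i q" "loc n (sm q) [i] = sm (step T i q)"
proof -
  have "cone n (sm q) [i] = cone n (state_map T q) [i]"
    by (rule cone_cong) (use assms in simp)
  then show 1: "gcpf n (sm q) [i] = outp T i q"
    using is_gcp_outp[OF assms(1), of i] assms(2,3) gcp_eqI by (simp add: gcpf_def)
  show "loc n (sm q) [i] = sm (step T i q)"
    unfolding loc_def 1
    by (rule restrict_ext) (use assms machine_state_map_append[OF mach assms(1), of "[i]"] in simp)
qed

lemma step_word_D:
  assumes "w \<in> nefin n D"
  shows "step_word T w q0 \<in> states T" "I (step_word T w q0) = letters n"
  using machine_step_word[OF mach q0] assms by (auto simp: nefin_iff)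

text \<open>Minimality separates two states by their readable letters or by their maps; with the
  letters fixed, the maps remain.\<close>

lemma sm_inj:
  assumes "p \<in> states T" "q \<in> states T" "I p = letters n" "I q = letters n" "sm p = sm q"
  shows "p = q"
proof (rule ccontr)
  assume "p \<noteq> q"
  then obtain x where "x \<in> C" "state_map T p x \<noteq> state_map T q x"
    using minim assms unfolding minimal_def by (metis inf_words_letters)
  then show False using fun_cong[OF assms(5), of x] by simp
qed

lemma reachable: "q \<in> states T \<Longrightarrow> \<exists>w\<in>fin_words n D. step_word T w q0 = q"
  using minim by (simp add: minimal_def)

text \<open>One letter is spent in the backward direction: it takes every state, the initial one
  included, to a state reached by a nonempty word, where \<open>syncs\<close> applies. Hence the
  level \<open>Suc k\<close> there.\<close>

lemma synchronizing_iff: "synchronizing n I T \<longleftrightarrow> (\<exists>k. syncs n D f k)"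
proof
  assume "synchronizing n I T"
  then obtain k where k: "sync_at n I T k" by (auto simp: synchronizing_def)
  have "syncs n D f k"
    unfolding syncs_def
  proof (intro ballI impI)
    fix w w' u assume w: "w \<in> nefin n D" "w' \<in> nefin n D" "u \<in> L" "k \<le> length u"
    define u1 where "u1 = take (length u - k) u"
    define u2 where "u2 = drop (length u - k) u"
    have uu: "u = u1 @ u2" "u1 \<in> L" "u2 \<in> L"
      using w(3) append_take_drop_id[of "length u - k" u] unfolding u1_def u2_def
      by (simp, metis append_in_lists_conv, metis append_in_lists_conv)
    have l: "length u2 = k" using w(4) by (simp add: u2_def)
    have z: "z @ u1 \<in> nefin n D" if "z \<in> nefin n D" for z using that uu(2) by (rule nefin_append)
    have "step_word T u2 (step_word T (w @ u1) q0) = step_word T u2 (step_word T (w' @ u1) q0)"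
      using k step_word_D[OF z[OF w(1)]] step_word_D[OF z[OF w(2)]] l uu(3)
      unfolding sync_at_def by (metis fin_words_letters)
    then have "step_word T (w @ u) q0 = step_word T (w' @ u) q0" by (simp add: uu(1))
    then show "loc n f (w @ u) = loc n f (w' @ u)"
      using loc_state_map nefin_append w(1-3) by metis
  qed
  then show "\<exists>k. syncs n D f k" by blast
next
  assume "\<exists>k. syncs n D f k"
  then obtain k where k: "syncs n D f k" by blast
  have "sync_at n I T (Suc k)"
    unfolding sync_at_def
  proof (intro allI impI)
    fix v p q assume len: "length v = Suc k" and pq: "p \<in> states T" "q \<in> states T"
      and v: "v \<in> fin_words n (I p)" "v \<in> fin_words n (I q)"
    obtain i u where iu: "v = i # u" using len by (cases v) auto
    have A: "\<exists>z. z \<in> nefin n D \<and> step_word T z q0 = step T i s"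
      if s: "s \<in> states T" "v \<in> fin_words n (I s)" for s
    proof -
      obtain w where w: "w \<in> fin_words n D" "step_word T w q0 = s" using reachable[OF s(1)] by blast
      have "w @ [i] \<in> nefin n D"
      proof (cases "w = []")
        case True then show ?thesis using w s(2) iu by simp
      next
        case False
        then have w': "w \<in> nefin n D" using w by (simp add: nefin_iff)
        then have "I s = letters n" using step_word_D(2) w(2) by blast
        then show ?thesis using s(2) iu w' nefin_append[of w n D "[i]"] by simp
      qed
      moreover have "step_word T (w @ [i]) q0 = step T i s" using w by simp
      ultimately show ?thesis by blast
    qed
    obtain z1 z2 where z: "z1 \<in> nefin n D" "step_word T z1 q0 = step T i p"
        "z2 \<in> nefin n D" "step_word T z2 q0 = step T i q"
      using A pq v by metis
    have u: "u \<in> L" "k \<le> length u" using v(1) iu len by simp_all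
    have zu: "z1 @ u \<in> nefin n D" "z2 @ u \<in> nefin n D" using z u nefin_append by blast+
    have "loc n f (z1 @ u) = loc n f (z2 @ u)" by (rule syncsD[OF k z(1,3) u])
    then have "sm (step_word T (z1 @ u) q0) = sm (step_word T (z2 @ u) q0)"
      using loc_state_map zu by simp
    then have "step_word T (z1 @ u) q0 = step_word T (z2 @ u) q0"
      using sm_inj step_word_D zu by blast
    then show "step_word T v p = step_word T v q" using z iu by simp
  qed
  then show "synchronizing n I T" by (auto simp: synchronizing_def)
qed

lemma ex_long_word:
  assumes "d \<in> D" shows "\<exists>z\<in>nefin n D. m \<le> length z"
  by (rule bexI[of _ "d # replicate m (Lt 0)"]) (use assms in simp_all)

text \<open>A forced state is reached again after any start, however long. Conversely a long word
  ends in a word of the synchronizing length.\<close>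

lemma states_core:
  assumes "synchronizing n I T" "d \<in> D"
  shows "states (core n I T) = {c. \<forall>m. \<exists>w\<in>nefin n D. m \<le> length w \<and> step_word T w q0 = c}"
    (is "_ = ?R")
proof (intro equalityI subsetI)
  fix c assume "c \<in> states (core n I T)"
  then obtain w q k where c: "c = step_word T w q" "sync_at n I T k" "w \<in> words_of_length n k"
      "q \<in> states T" "w \<in> fin_words n (I q)"
    by (auto simp: core_def)
  have "\<exists>w\<in>nefin n D. m \<le> length w \<and> step_word T w q0 = c" for m
  proof -
    obtain z where z: "z \<in> nefin n D" "m \<le> length z" using ex_long_word[OF assms(2)] by blast
    have wL: "w \<in> L" "length w = k" using c(3) by (auto simp: words_of_length_def)
    have "step_word T w (step_word T z q0) = step_word T w q"
      using c(2,4,5) wL step_word_D[OF z(1)] unfolding sync_at_def by (metis fin_words_letters)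
    then show ?thesis
      using nefin_append[OF z(1) wL(1)] z(2) c(1) by (intro bexI[of _ "z @ w"]) auto
  qed
  then show "c \<in> ?R" by blast
next
  fix c assume c: "c \<in> ?R"
  obtain k where k: "sync_at n I T k" using assms(1) by (auto simp: synchronizing_def)
  obtain w where w: "w \<in> nefin n D" "Suc k \<le> length w" "step_word T w q0 = c" using c by blast
  define v where "v = take (length w - k) w"
  define u where "u = drop (length w - k) w"
  have vu: "w = v @ u" "length u = k" "v \<noteq> []" using w(2) by (auto simp: v_def u_def)
  then have "v \<in> nefin n D" "u \<in> L"
    using w(1) append_fin_words[of v u n D] by (auto simp: nefin_iff)
  then have "u \<in> words_of_length n k" "step_word T v q0 \<in> states T"
      "u \<in> fin_words n (I (step_word T v q0))" "c = step_word T u (step_word T v q0)"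
    using vu w(3) step_word_D[of v] by (auto simp: words_of_length_def)
  then show "c \<in> states (core n I T)" using k unfolding core_def by (simp, blast)
qed

lemma step_outp_core [simp]: "step (core n I T) = step T" "outp (core n I T) = outp T"
  by (simp_all add: core_def)

text \<open>The isomorphism is \<open>sm\<close>, which sends each core state to its map; renamings
  of states are composed with it in both directions.\<close>

lemma iso_class_core:
  assumes sync: "synchronizing n I T" and d: "d \<in> D"
  shows "iso_class n (core n I T) = core_class n (core_maps n D f)"
proof -
  let ?K = "core_maps n D f" and ?S = "states (core n I T)"
  note S = states_core[OF sync d]
  have inS: "c \<in> states T" "I c = letters n" if c: "c \<in> ?S" for c
  proof -
    obtain w where "w \<in> nefin n D" "step_word T w q0 = c" using c unfolding S by blast
    then show "c \<in> states T" "I c = letters n" using step_word_D by auto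
  qed
  have stepS: "step T i c \<in> ?S" if c: "c \<in> ?S" and i: "i \<in> letters n" for c i
  proof -
    have "\<exists>w\<in>nefin n D. m \<le> length w \<and> step_word T w q0 = step T i c" for m
    proof -
      obtain w where w: "w \<in> nefin n D" "m \<le> length w" "step_word T w q0 = c"
        using c unfolding S by blast
      then show ?thesis
        using nefin_append[OF w(1), of "[i]"] i by (intro bexI[of _ "w @ [i]"]) auto
    qed
    then show ?thesis unfolding S by blast
  qed
  have bij: "bij_betw sm ?S ?K"
  proof (rule bij_betw_imageI)
    show "inj_on sm ?S" using sm_inj inS by (intro inj_onI) blast
    show "sm ` ?S = ?K"
    proof (intro equalityI subsetI)
      fix g assume "g \<in> sm ` ?S"
      then obtain c where c: "c \<in> ?S" "g = sm c" by blast
      have "\<exists>w\<in>nefin n D. m \<le> length w \<and> loc n f w = g" for m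
        using c loc_state_map unfolding S by blast
      then show "g \<in> ?K" by (simp add: core_maps_def)
    next
      fix g assume g: "g \<in> ?K"
      then obtain w0 where w0: "w0 \<in> nefin n D" "loc n f w0 = g"
        unfolding core_maps_def by blast
      let ?c = "step_word T w0 q0"
      have "\<exists>w\<in>nefin n D. m \<le> length w \<and> step_word T w q0 = ?c" for m
      proof -
        obtain w where w: "w \<in> nefin n D" "m \<le> length w" "loc n f w = g"
          using g unfolding core_maps_def by blast
        have "sm (step_word T w q0) = sm ?c" using loc_state_map w w0 by simp
        then have "step_word T w q0 = ?c" using sm_inj step_word_D w(1) w0(1) by blast
        then show ?thesis using w by blast
      qed
      then have "?c \<in> ?S" unfolding S by blast
      then show "g \<in> sm ` ?S" using loc_state_map[OF w0(1)] w0(2) by blast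
    qed
  qed
  have sml: "sm (step T i c) = loc n (sm c) [i]" "outp T i c = gcpf n (sm c) [i]"
    if "c \<in> ?S" "i \<in> letters n" for c i
    using loc_sm[OF inS[OF that(1)] that(2)] by simp_all
  show ?thesis
  proof (intro equalityI subsetI)
    fix U assume "U \<in> iso_class n (core n I T)"
    then obtain h where U: "plain_transducer n U" and h: "bij_betw h ?S (states U)"
      and hs: "\<And>c i. c \<in> ?S \<Longrightarrow> i \<in> letters n \<Longrightarrow> step U i (h c) = h (step T i c) \<and> outp U i (h c) = outp T i c"
      unfolding iso_class_def transducer_iso_def by auto
    define \<phi> where "\<phi> = sm \<circ> inv_into ?S h"
    have "bij_betw \<phi> (states U) ?K"
      unfolding \<phi>_def by (rule bij_betw_trans[OF bij_betw_inv_into[OF h] bij])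
    moreover have \<phi>h: "\<phi> (h c) = sm c" if "c \<in> ?S" for c
      unfolding \<phi>_def using bij_betw_inv_into_left[OF h that] by simp
    have "\<phi> (step U i q) = loc n (\<phi> q) [i] \<and> outp U i q = gcpf n (\<phi> q) [i]"
      if q: "q \<in> states U" and i: "i \<in> letters n" for q i
    proof -
      obtain c where c: "c \<in> ?S" "q = h c" using h q by (auto simp: bij_betw_def)
      then show ?thesis using hs[OF c(1) i] \<phi>h[OF c(1)] \<phi>h[OF stepS[OF c(1) i]]
          sml[OF c(1) i] by simp
    qed
    ultimately show "U \<in> core_class n ?K" using U unfolding core_class_def by blast
  next
    fix U assume "U \<in> core_class n ?K"
    then obtain \<psi> where U: "plain_transducer n U" and \<psi>: "bij_betw \<psi> (states U) ?K"
      and \<psi>s: "\<And>q i. q \<in> states U \<Longrightarrow> i \<in> letters n \<Longrightarrow>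
         \<psi> (step U i q) = loc n (\<psi> q) [i] \<and> outp U i q = gcpf n (\<psi> q) [i]"
      unfolding core_class_def by blast
    define h where "h = inv_into (states U) \<psi> \<circ> sm"
    have hb: "bij_betw h ?S (states U)"
      unfolding h_def by (rule bij_betw_trans[OF bij bij_betw_inv_into[OF \<psi>]])
    have \<psi>h: "\<psi> (h c) = sm c" if "c \<in> ?S" for c
    proof -
      have "sm c \<in> ?K" using bij that by (auto simp: bij_betw_def)
      then show ?thesis unfolding h_def using bij_betw_inv_into_right[OF \<psi>] by simp
    qed
    have "step U i (h c) = h (step T i c) \<and> outp U i (h c) = outp T i c"
      if c: "c \<in> ?S" and i: "i \<in> letters n" for c i
    proof -
      have hc: "h c \<in> states U" using hb c by (auto simp: bij_betw_def)
      have "\<psi> (step U i (h c)) = \<psi> (h (step T i c))"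
        using \<psi>s[OF hc i] \<psi>h[OF c] \<psi>h[OF stepS[OF c i]] sml[OF c i] by simp
      moreover have "step U i (h c) \<in> states U" using U hc i by (simp add: plain_transducer_def)
      moreover have "h (step T i c) \<in> states U" using hb stepS[OF c i] by (auto simp: bij_betw_def)
      ultimately have "step U i (h c) = h (step T i c)"
        using \<psi> by (auto simp: bij_betw_def inj_on_def)
      then show ?thesis using \<psi>s[OF hc i] \<psi>h[OF c] sml[OF c i] by simp
    qed
    then have "transducer_iso n (core n I T) U"
      unfolding transducer_iso_def using hb by auto
    then show "U \<in> iso_class n (core n I T)" using U by (simp add: iso_class_def)
  qed
qed

end

section \<open>Both kinds of transducers as machines\<close>

lemma plain_machine: "plain_transducer n T \<Longrightarrow> machine n (plain_input n) T"
  by (auto simp: plain_transducer_def machine_def plain_input_def)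

lemma infinite_output_append:
  assumes "infinite_output T (step_word T w q) x" shows "infinite_output T q (w \<frown> x)"
  unfolding infinite_output_def
proof
  fix k
  obtain m where "k < length (out_word T (take_word m x) (step_word T w q))"
    using assms unfolding infinite_output_def by blast
  then have "k < length (out_word T (take_word (length w + m) (w \<frown> x)) q)"
    by (simp add: take_word_append_word)
  then show "\<exists>m. k < length (out_word T (take_word m (w \<frown> x)) q)" by blast
qed

text \<open>Infinite output is postulated only for states of \<open>S\<close>. A run cannot stay in
  \<open>R\<close>: by the pigeonhole principle it would repeat a state there and thus follow a
  cycle.\<close>

lemma dot_machine:
  fixes T :: "'q transducer"
  assumes "dot_transducer n r T q0"
  shows "machine n (dot_input n r q0) T" "q0 \<in> states T"
proof -
  let ?I = "dot_input n r q0"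
  obtain R S where RS: "states T = R \<union> S" "R \<inter> S = {}" "finite R" "q0 \<in> R"
   and st: "\<forall>q\<in>states T. \<forall>i\<in>?I q. step T i q \<in> states T - {q0}"
   and S: "\<forall>q\<in>S. \<forall>i\<in>letters n. step T i q \<in> S \<and> outp T i q \<in> lists (letters n)"
     "\<forall>q\<in>S. \<forall>x\<in>cantor n. infinite_output T q x"
   and cyc: "\<forall>q\<in>R. \<forall>w\<in>fin_words n (?I q). w \<noteq> [] \<longrightarrow> step_word T w q \<noteq> q"
    using assms unfolding dot_transducer_def by (elim exE conjE) (rule that; assumption)
  show "q0 \<in> states T" using RS by blast
  have 1: "\<forall>q\<in>states T. \<forall>i\<in>?I q. step T i q \<in> states T \<and> ?I (step T i q) = letters n"
    using st by (auto simp: dot_input_def)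
  have sw: "step_word T w q \<in> states T \<and> (w \<noteq> [] \<longrightarrow> ?I (step_word T w q) = letters n)"
    if "q \<in> states T" "w \<in> fin_words n (?I q)" for q w
    using that
  proof (induction w arbitrary: q)
    case (Cons i w)
    have i: "step T i q \<in> states T" "?I (step T i q) = letters n"
      using 1 Cons.prems by auto
    have "step_word T w (step T i q) \<in> states T \<and> (w \<noteq> [] \<longrightarrow> ?I (step_word T w (step T i q)) = letters n)"
      by (rule Cons.IH) (use i Cons.prems in auto)
    then show ?case using i by (cases "w = []") auto
  qed simp
  have "infinite_output T q x" if q: "q \<in> states T" and x: "x \<in> inf_words n (?I q)" for q x
  proof -
    have "\<exists>m>0. step_word T (take_word m x) q \<in> S"
    proof (rule ccontr)
      assume "\<not> ?thesis"
      then have inR: "step_word T (take_word m x) q \<in> R" if "m > 0" for m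
        using that sw[OF q take_inf_words[OF x]] RS(1) by blast
      let ?s = "\<lambda>m. step_word T (take_word m x) q"
      have "\<not> inj_on ?s {1..card R + 1}"
      proof
        assume "inj_on ?s {1..card R + 1}"
        then have "card {1..card R + 1} \<le> card R"
          by (rule card_inj_on_le) (use inR RS(3) in auto)
        then show False by simp
      qed
      then obtain a' b' where ab': "0 < a'" "0 < b'" "a' \<noteq> b'" "?s a' = ?s b'"
        unfolding inj_on_def by (auto simp: Suc_le_eq)
      define a where "a = min a' b'"
      define b where "b = max a' b'"
      have ab: "0 < a" "a < b" "?s a = ?s b" using ab' by (auto simp: a_def b_def min_def max_def)
      define w where "w = take_word (b - a) (drop_word a x)"
      have "take_word b x = take_word a x @ w"
        using ab(2) take_word_add[of a "b - a" x] by (simp add: w_def)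
      then have "step_word T w (?s a) = ?s a" using ab(3) by simp
      moreover have "w \<noteq> []" using ab(2) unfolding w_def by (metis length_0_conv take_word_length zero_less_diff less_numeral_extra(3))
      moreover have "w \<in> fin_words n (?I (?s a))"
      proof -
        have "take_word a x \<noteq> []" using ab(1) by (metis length_0_conv take_word_length less_numeral_extra(3))
        then have "?I (?s a) = letters n" using sw[OF q take_inf_words[OF x]] by blast
        then show ?thesis unfolding w_def using drop_inf_words[OF x ab(1)] take_cantor by simp
      qed
      ultimately show False using cyc inR[OF ab(1)] by blast
    qed
    then obtain m where m: "m > 0" "step_word T (take_word m x) q \<in> S" by blast
    then have "infinite_output T (step_word T (take_word m x) q) (drop_word m x)"
      using S(2) drop_inf_words[OF x m(1)] by blast
    then show ?thesis using infinite_output_append by (metis take_drop_word)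
  qed
  then show "machine n ?I T" using 1 unfolding machine_def by blast
qed

lemma (in alphabet) minimal_dot_machine:
  assumes "minimal_dot_transducer_of n r h T q0"
  shows "minimal_machine n (dot_input n r q0) T q0 h"
  using assms dot_machine unfolding minimal_dot_transducer_of_def
  by unfold_locales (auto simp: dot_input_def cantor_dot_def)

lemma (in alphabet) minimal_plain_machine:
  assumes "minimal_plain_transducer_of n h T q0"
  shows "minimal_machine n (plain_input n) T q0 h"
  using assms plain_machine unfolding minimal_plain_transducer_of_def
  by unfold_locales (auto simp: plain_input_def)

section \<open>Existence of minimal transducers\<close>

text \<open>The states are the map itself and its local maps, coded as natural numbers.\<close>

locale local_maps_machine = alphabet +
  fixes D E :: "letter set" and f :: "iword \<Rightarrow> iword" and e :: "(iword \<Rightarrow> iword) \<Rightarrow> nat"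
    and f0 :: "iword \<Rightarrow> iword" and St :: "(iword \<Rightarrow> iword) set" and T :: "nat transducer"
    and I :: "nat \<Rightarrow> letter set"
  assumes f: "sync_map n D E f"
    and f0_def: "f0 = restrict f (inf_words n D)"
    and St_def: "St = insert f0 (loc n f ` nefin n D)"
    and inj_e: "inj_on e St"
    and T_def: "T = \<lparr>states = e ` St, step = (\<lambda>i m. e (loc n (inv_into St e m) [i])),
        outp = (\<lambda>i m. gcpf n (inv_into St e m) [i])\<rparr>"
    and I0: "I (e f0) = D"
    and I1: "\<And>w. w \<in> nefin n D \<Longrightarrow> I (e (loc n f w)) = letters n"
begin

lemma states_T: "states T = e ` St"
  and step_e: "g \<in> St \<Longrightarrow> step T i (e g) = e (loc n g [i])"
  and outp_e: "g \<in> St \<Longrightarrow> outp T i (e g) = gcpf n g [i]"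
  by (simp_all add: T_def inv_into_f_f[OF inj_e])

lemma f0_St [simp]: "f0 \<in> St" and loc_St [simp]: "w \<in> nefin n D \<Longrightarrow> loc n f w \<in> St"
  by (simp_all add: St_def)

lemma loc_f0: "w \<in> nefin n D \<Longrightarrow> loc n f0 w = loc n f w" "w \<in> nefin n D \<Longrightarrow> gcpf n f0 w = gcpf n f w"
  unfolding f0_def by (rule loc_cong gcpf_cong; simp add: inf_words_appendI)+

lemma words_T:
  assumes "w \<in> nefin n D"
  shows "step_word T w (e f0) = e (loc n f w)" "out_word T w (e f0) = gcpf n f w"
proof -
  have "w \<in> nefin n D \<longrightarrow> step_word T w (e f0) = e (loc n f w) \<and> out_word T w (e f0) = gcpf n f w"
  proof (induction w rule: rev_induct)
    case (snoc i w)
    show ?case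
    proof (cases "w = []")
      case True then show ?thesis by (simp add: step_e outp_e loc_f0 del: Cons_nefin)
    next
      case False
      show ?thesis
      proof
        assume "w @ [i] \<in> nefin n D"
        then have w: "w \<in> nefin n D" "[i] \<in> L"
          using False append_fin_words[of w "[i]" n D] by (auto simp: nefin_iff)
        then show "step_word T (w @ [i]) (e f0) = e (loc n f (w @ [i])) \<and>
            out_word T (w @ [i]) (e f0) = gcpf n f (w @ [i])"
          using snoc sync_map_loc_append[OF f w] sync_map_gcpf_append[OF f w]
          by (simp add: step_e outp_e)
      qed
    qed
  qed simp
  then show "step_word T w (e f0) = e (loc n f w)" "out_word T w (e f0) = gcpf n f w"
    using assms by auto
qed

lemma words_T_loc:
  assumes w: "w \<in> nefin n D" and u: "u \<in> L"
  shows "step_word T u (e (loc n f w)) = e (loc n f (w @ u))"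
    "gcpf n f w @ out_word T u (e (loc n f w)) = gcpf n f (w @ u)"
  using words_T[OF w] words_T[OF nefin_append[OF w u]] by simp_all

lemma infinite_output_f0:
  assumes "x \<in> inf_words n D" shows "infinite_output T (e f0) x"
  unfolding infinite_output_def
proof
  fix k
  obtain m where m: "\<And>w. w \<in> nefin n D \<Longrightarrow> m \<le> length w \<Longrightarrow> Suc k \<le> length (gcpf n f w)"
    using ucont_gcpf[OF sync_mapD(3,2)[OF f], of "Suc k"] by blast
  have w: "take_word (Suc m) x \<in> nefin n D" using take_inf_words_ne[OF assms] by simp
  show "\<exists>m. k < length (out_word T (take_word m x) (e f0))"
    using m[OF w] words_T(2)[OF w] by (intro exI[of _ "Suc m"]) simp
qed

lemma infinite_output_loc:
  assumes w: "w \<in> nefin n D" and x: "x \<in> C" shows "infinite_output T (e (loc n f w)) x"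
  unfolding infinite_output_def
proof
  fix k
  obtain m where m: "\<And>v. v \<in> nefin n D \<Longrightarrow> m \<le> length v \<Longrightarrow> Suc (length (gcpf n f w) + k) \<le> length (gcpf n f v)"
    using ucont_gcpf[OF sync_mapD(3,2)[OF f]] by blast
  have u: "take_word m x \<in> L" using take_cantor[OF x] .
  have "Suc (length (gcpf n f w) + k) \<le> length (gcpf n f (w @ take_word m x))"
    by (rule m[OF nefin_append[OF w u]]) simp
  also have "\<dots> = length (gcpf n f w) + length (out_word T (take_word m x) (e (loc n f w)))"
    using words_T_loc(2)[OF w u] by (metis length_append)
  finally show "\<exists>m. k < length (out_word T (take_word m x) (e (loc n f w)))"
    by (intro exI[of _ m]) simp
qed

lemma machine_T: "machine n I T"
  unfolding machine_def
proof (intro conjI ballI)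
  fix q i assume "q \<in> states T" "i \<in> I q"
  then consider "q = e f0" | w where "w \<in> nefin n D" "q = e (loc n f w)"
    by (auto simp: states_T St_def)
  then have "\<exists>v\<in>nefin n D. step T i q = e (loc n f v)"
  proof cases
    case 1
    then have "[i] \<in> nefin n D" using \<open>i \<in> I q\<close> I0 by simp
    then show ?thesis using 1 loc_f0 step_e[OF f0_St] by metis
  next
    case (2 w)
    then have "[i] \<in> L" using \<open>i \<in> I q\<close> I1 by simp
    then show ?thesis
      using 2 nefin_append sync_map_loc_append[OF f 2(1)] step_e[OF loc_St] by metis
  qed
  then obtain v where v: "v \<in> nefin n D" "step T i q = e (loc n f v)" by blast
  show "step T i q \<in> states T" using v by (simp add: states_T)
  show "I (step T i q) = letters n" using v I1 by simp
next
  fix q x assume "q \<in> states T" "x \<in> inf_words n (I q)"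
  then show "infinite_output T q x"
    using infinite_output_f0 infinite_output_loc I0 I1 by (auto simp: states_T St_def)
qed

lemma state_map_f0: "x \<in> inf_words n D \<Longrightarrow> state_map T (e f0) x = f x"
proof (rule state_map_unique[OF infinite_output_f0, where N = 1])
  fix m :: nat assume x: "x \<in> inf_words n D" and m: "1 \<le> m"
  then have w: "take_word m x \<in> nefin n D" using take_inf_words_ne[OF x] by simp
  have "take_word (length (gcpf n f (take_word m x))) (f (take_word m x \<frown> drop_word m x)) = gcpf n f (take_word m x)"
    by (rule take_gcp[OF is_gcp_gcpf[OF splits_ne[OF sync_mapD(2)[OF f] w]]])
      (use drop_inf_words[OF x] m in simp)
  then show "take_word (length (out_word T (take_word m x) (e f0))) (f x) = out_word T (take_word m x) (e f0)"
    using words_T(2)[OF w] by simp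
qed

lemma state_map_loc:
  assumes "w \<in> nefin n D" "x \<in> C" shows "state_map T (e (loc n f w)) x = loc n f w x"
proof -
  have "f (w \<frown> x) = out_word T w (e f0) \<frown> state_map T (step_word T w (e f0)) x"
    using machine_state_map_append[OF machine_T, of "e f0" w x] assms I0
      state_map_f0[OF inf_words_appendI[OF assms]] by (simp add: states_T)
  then show ?thesis
    using words_T[OF assms(1)] sync_map_loc_eq[OF f assms] by simp
qed

lemma minimal_T: "minimal n I T (e f0)"
  unfolding minimal_def
proof (intro conjI ballI impI)
  fix q assume "q \<in> states T"
  then consider "q = e f0" | w where "w \<in> nefin n D" "q = e (loc n f w)"
    by (auto simp: states_T St_def)
  then show "\<exists>w\<in>fin_words n (I (e f0)). step_word T w (e f0) = q"
  proof cases
    case 1 then show ?thesis by (intro bexI[of _ "[]"]) auto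
  next
    case (2 w)
    then show ?thesis using words_T(1)[of w] I0 by (intro bexI[of _ w]) (auto simp: nefin_iff)
  qed
next
  \<comment> \<open>Each coded function is extensional on the inputs that its state can read, so
    equal state maps force equal codes.\<close>
  have ext: "g \<in> extensional (inf_words n (I (e g))) \<and> (\<forall>x\<in>inf_words n (I (e g)). state_map T (e g) x = g x)"
    if g: "g \<in> St" for g
  proof -
    consider "g = f0" | w where "w \<in> nefin n D" "g = loc n f w"
      using g by (auto simp: St_def)
    then show ?thesis
    proof cases
      case 1
      then show ?thesis using state_map_f0 I0 by (simp add: f0_def)
    next
      case (2 w)
      then show ?thesis using state_map_loc I1 by simp
    qed
  qed
  fix q p assume "q \<in> states T" "p \<in> states T" and ne: "q \<noteq> p"
  then obtain g h where g: "g \<in> St" "q = e g" and h: "h \<in> St" "p = e h" by (auto simp: states_T)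
  show "inf_words n (I q) \<noteq> inf_words n (I p) \<or> (\<exists>x\<in>inf_words n (I q). state_map T q x \<noteq> state_map T p x)"
  proof (rule ccontr)
    assume "\<not> ?thesis"
    then have dom: "inf_words n (I q) = inf_words n (I p)"
      and eq: "\<And>x. x \<in> inf_words n (I q) \<Longrightarrow> state_map T q x = state_map T p x" by auto
    have "g = h"
    proof (rule extensionalityI)
      show "g \<in> extensional (inf_words n (I q))" "h \<in> extensional (inf_words n (I q))"
        using ext[OF g(1)] ext[OF h(1)] g h dom by auto
      fix x assume "x \<in> inf_words n (I q)"
      then show "g x = h x" using ext[OF g(1)] ext[OF h(1)] g h dom eq by metis
    qed
    then show False using ne g h by simp
  qed
next
  fix q i assume "q \<in> states T" and i: "i \<in> I q"
  then consider "q = e f0" | w where "w \<in> nefin n D" "q = e (loc n f w)"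
    by (auto simp: states_T St_def)
  then have "is_gcp (outp T i q) (cone n (state_map T q) [i])"
  proof cases
    case 1
    then have iD: "[i] \<in> nefin n D" using i I0 by simp
    have "cone n (state_map T q) [i] = cone n f [i]"
      by (rule cone_cong) (use 1 iD state_map_f0 inf_words_appendI in blast)
    then show ?thesis
      using 1 outp_e[OF f0_St] loc_f0(2)[OF iD] is_gcp_gcpf[OF splits_ne[OF sync_mapD(2)[OF f] iD]] by simp
  next
    case (2 w)
    then have iL: "[i] \<in> L" using i I1 by simp
    have "cone n (state_map T q) [i] = cone n (loc n f w) [i]"
      by (rule cone_cong) (use 2 iL state_map_loc in simp)
    moreover have "splits n (loc n f w) [i]"
      using splits_loc[OF _ _ iL] splits_ne[OF sync_mapD(2)[OF f]] nefin_append[OF 2(1) iL] 2(1) by blast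
    ultimately show ?thesis
      using 2 outp_e[OF loc_St] is_gcp_gcpf by simp
  qed
  then show "is_gcp (outp T i q) {state_map T q ([i] \<frown> x) |x. x \<in> C}" by (simp add: cone_def)
qed

lemma plain_T:
  assumes "D = letters n" "E = letters n" "I = plain_input n"
  shows "minimal_plain_transducer_of n f T (e f0)"
  unfolding minimal_plain_transducer_of_def plain_transducer_def
proof (intro conjI ballI)
  fix q i assume q: "q \<in> states T" and i: "i \<in> letters n"
  show "step T i q \<in> states T" using machine_T q i assms(3) by (auto simp: machine_def plain_input_def)
  have iD: "[i] \<in> nefin n (letters n)" using i by simp
  consider "q = e f0" | w where "w \<in> nefin n D" "q = e (loc n f w)"
    using q by (auto simp: states_T St_def)
  then show "outp T i q \<in> L"
  proof cases
    case 1 then show ?thesis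
      using outp_e[OF f0_St] loc_f0(2) iD gcpf_fin_words[OF f] assms by (metis fin_words_letters)
  next
    case (2 w)
    have "gcpf n f (w @ [i]) \<in> L"
      using gcpf_fin_words[OF f nefin_append[OF 2(1)], of "[i]"] i assms by simp
    then show ?thesis
      using 2 outp_e[OF loc_St] sync_map_gcpf_append[OF f 2(1), of "[i]"] i by simp
  qed
next
  fix q x assume "q \<in> states T" "x \<in> C"
  then show "infinite_output T q x" using machine_T assms by (auto simp: machine_def plain_input_def)
next
  show "e f0 \<in> states T" by (simp add: states_T)
  show "minimal n (plain_input n) T (e f0)" using minimal_T assms by simp
  fix x assume "x \<in> C" then show "state_map T (e f0) x = f x" using state_map_f0 assms by simp
qed

end

section \<open>Finite minimal transducers of synchronizing maps\<close>

context alphabet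
begin

text \<open>Of a long word only the first letter and the last \<open>k\<close> letters are kept: the
  former makes the word readable over \<open>D\<close>, the latter force the local map.\<close>

lemma finite_local_maps:
  assumes f: "sync_map n D E f" and D: "finite D"
  shows "finite (loc n f ` nefin n D)"
proof -
  obtain k where k: "syncs n D f k" using sync_mapD(4)[OF f] by blast
  have "loc n f ` nefin n D \<subseteq> loc n f ` {w \<in> fin_words n D. length w \<le> Suc k}"
  proof
    fix g assume "g \<in> loc n f ` nefin n D"
    then obtain w where w: "w \<in> nefin n D" "g = loc n f w" by blast
    then obtain d v where dv: "w = d # v" "d \<in> D" "v \<in> L" using nefinE[of w n D] by blast
    show "g \<in> loc n f ` {w \<in> fin_words n D. length w \<le> Suc k}"
    proof (cases "length v \<le> k")
      case True then show ?thesis using w dv by auto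
    next
      case False
      define v1 where "v1 = take (length v - k) v"
      define u where "u = drop (length v - k) v"
      have vu: "v = v1 @ u" "length u = k" using False by (auto simp: v1_def u_def)
      have "loc n f ((d # v1) @ u) = loc n f ([d] @ u)"
        by (rule syncsD[OF k]) (use dv vu in auto)
      then show ?thesis using w dv vu by (intro image_eqI[of _ _ "d # u"]) auto
    qed
  qed
  then show ?thesis using finite_fin_words_le[OF D] finite_subset by blast
qed

lemma ex_code:
  assumes "finite S" obtains e :: "(iword \<Rightarrow> iword) \<Rightarrow> nat" where "inj_on e S"
  using finite_imp_inj_to_nat_seg[OF assms] that by blast

lemma ex_minimal_plain:
  assumes f: "sync_map n (letters n) (letters n) f"
  shows "\<exists>(T :: nat transducer) q0. minimal_plain_transducer_of n f T q0"
proof -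
  let ?f0 = "restrict f (inf_words n (letters n))"
  let ?St = "insert ?f0 (loc n f ` nefin n (letters n))"
  have "finite ?St" using finite_local_maps[OF f] by simp
  then obtain e :: "(iword \<Rightarrow> iword) \<Rightarrow> nat" where e: "inj_on e ?St" by (rule ex_code)
  interpret local_maps_machine n "letters n" "letters n" f e ?f0 ?St
    "\<lparr>states = e ` ?St, step = (\<lambda>i m. e (loc n (inv_into ?St e m) [i])),
      outp = (\<lambda>i m. gcpf n (inv_into ?St e m) [i])\<rparr>" "plain_input n"
    by unfold_locales (use f e in \<open>simp_all add: plain_input_def\<close>)
  show ?thesis using plain_T by blast
qed

lemma extensional_C_not_dots:
  assumes "x \<in> cantor_dot n r" shows "x \<notin> C"
  using assms dots_letters_disjoint[of r n] by (auto simp: cantor_dot_def inf_words_def cantor_eq)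

text \<open>The sets \<open>R\<close> and \<open>S\<close> separate the states before and after the
  first output. That something has been written must be shown to be a property of the state, not of
  the word leading to it.\<close>

lemma ex_minimal_dot:
  assumes f: "sync_map n (dots r) (dots r) f" and r: "1 \<le> r"
  shows "\<exists>(T :: nat transducer) q0. minimal_dot_transducer_of n r f T q0 \<and> finite (states T)"
proof -
  let ?D = "dots r"
  let ?f0 = "restrict f (inf_words n ?D)"
  let ?St = "insert ?f0 (loc n f ` nefin n ?D)"
  have fin: "finite ?St" using finite_local_maps[OF f] by simp
  then obtain e :: "(iword \<Rightarrow> iword) \<Rightarrow> nat" where e: "inj_on e ?St" by (rule ex_code)
  let ?T = "\<lparr>states = e ` ?St, step = (\<lambda>i m. e (loc n (inv_into ?St e m) [i])),
      outp = (\<lambda>i m. gcpf n (inv_into ?St e m) [i])\<rparr>"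
  have d0: "Dot 0 \<in> dots r" using r by (auto simp: dots_def)
  \<comment> \<open>A local map takes the same undefined value at all dotted words, whereas
    \<open>f\<close> is injective on them; so the initial state is distinct from all others.\<close>
  have f0_ne: "loc n f w \<noteq> ?f0" for w
  proof
    assume eq: "loc n f w = ?f0"
    let ?x = "[Dot 0] \<frown> (\<lambda>_. Lt 0)" and ?y = "[Dot 0] \<frown> (\<lambda>_. Lt 1)"
    have xy: "?x \<in> inf_words n ?D" "?y \<in> inf_words n ?D" using inf_words_appendI d0 ones_C by auto
    have "?x \<notin> C" "?y \<notin> C" by (auto simp: letters_def)
    then have "f ?x = f ?y" using fun_cong[OF eq, of ?x] fun_cong[OF eq, of ?y] xy by (simp add: loc_def)
    then have "?x = ?y" using inj_on_eq_iff[OF sync_mapD(2)[OF f] xy] by blast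
    then have "(\<lambda>_::nat. Lt 0) = (\<lambda>_. Lt 1)" by simp
    then show False by (auto dest: fun_cong)
  qed
  have e_ne: "e (loc n f w) \<noteq> e ?f0" if "w \<in> nefin n ?D" for w
    using inj_onD[OF e, of "loc n f w" ?f0] f0_ne[of w] that by blast
  interpret local_maps_machine n ?D ?D f e ?f0 ?St ?T "dot_input n r (e ?f0)"
    by unfold_locales (use f e e_ne in \<open>simp_all add: dot_input_def\<close>)
  have gcpf_eq: "gcpf n f v = [] \<longleftrightarrow> gcpf n f w = []"
    if "e (loc n f w) = e (loc n f v)" and w: "w \<in> nefin n ?D" and v: "v \<in> nefin n ?D" for w v
  proof -
    have eq: "loc n f w = loc n f v"
      using inj_onD[OF e, of "loc n f w" "loc n f v"] that(1) w v by blast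
    \<comment> \<open>The local map itself shows whether a prefix has been written: its value at the
      zero word still begins with a dot exactly when nothing has been written.\<close>
    have char: "gcpf n f w = [] \<longleftrightarrow> loc n f w (\<lambda>_. Lt 0) \<notin> C" if w: "w \<in> nefin n ?D" for w
    proof
      assume "gcpf n f w = []"
      then have "f (w \<frown> (\<lambda>_. Lt 0)) = loc n f w (\<lambda>_. Lt 0)"
        using sync_map_loc_eq[OF f w zeros_C] by simp
      moreover have "f (w \<frown> (\<lambda>_. Lt 0)) \<in> cantor_dot n r"
        using sync_mapD(1)[OF f] inf_words_appendI[OF w zeros_C] by (simp add: cantor_dot_def)
      ultimately show "loc n f w (\<lambda>_. Lt 0) \<notin> C" using extensional_C_not_dots by simp
    next
      assume "loc n f w (\<lambda>_. Lt 0) \<notin> C"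
      then show "gcpf n f w = []" using loc_range[OF f w _ zeros_C] by blast
    qed
    show ?thesis using char[OF w] char[OF v] eq by simp
  qed
  define R where "R = e ` insert ?f0 (loc n f ` {w \<in> nefin n ?D. gcpf n f w = []})"
  define S where "S = e ` loc n f ` {w \<in> nefin n ?D. gcpf n f w \<noteq> []}"
  have inR: "e (loc n f w) \<in> R \<longleftrightarrow> gcpf n f w = []" if w: "w \<in> nefin n ?D" for w
  proof
    assume "e (loc n f w) \<in> R"
    then obtain v where "v \<in> nefin n ?D" "gcpf n f v = []" "e (loc n f w) = e (loc n f v)"
      using e_ne[OF w] unfolding R_def by blast
    then show "gcpf n f w = []" using gcpf_eq[of w v] w by blast
  next
    assume "gcpf n f w = []" then show "e (loc n f w) \<in> R" unfolding R_def using w by blast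
  qed
  have inS: "e (loc n f w) \<in> S \<longleftrightarrow> gcpf n f w \<noteq> []" if w: "w \<in> nefin n ?D" for w
  proof
    assume "e (loc n f w) \<in> S"
    then obtain v where "v \<in> nefin n ?D" "gcpf n f v \<noteq> []" "e (loc n f w) = e (loc n f v)"
      unfolding S_def by blast
    then show "gcpf n f w \<noteq> []" using gcpf_eq[of w v] w by blast
  next
    assume "gcpf n f w \<noteq> []" then show "e (loc n f w) \<in> S" unfolding S_def using w by blast
  qed
  have succ: "\<exists>v. v \<in> nefin n ?D \<and> step ?T i q = e (loc n f v)
      \<and> (q = e ?f0 \<and> outp ?T i q = gcpf n f v
       \<or> (\<exists>w\<in>nefin n ?D. q = e (loc n f w) \<and> gcpf n f v = gcpf n f w @ outp ?T i q))"
    if q: "q \<in> e ` ?St" and i: "i \<in> dot_input n r (e ?f0) q" for q i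
  proof -
    consider "q = e ?f0" | w where "w \<in> nefin n ?D" "q = e (loc n f w)" using q by auto
    then show ?thesis
    proof cases
      case 1
      then have "[i] \<in> nefin n ?D" using i by (simp add: dot_input_def)
      then show ?thesis
        using 1 step_e[OF f0_St, of i] outp_e[OF f0_St, of i] loc_f0[of "[i]"] by (intro exI[of _ "[i]"]) auto
    next
      case (2 w)
      then have iL: "[i] \<in> L" using i e_ne by (auto simp: dot_input_def)
      show ?thesis
        using 2 nefin_append[OF 2(1) iL] step_e[OF loc_St[OF 2(1)], of i] outp_e[OF loc_St[OF 2(1)], of i]
          sync_map_loc_append[OF f 2(1) iL] sync_map_gcpf_append[OF f 2(1) iL]
        by (intro exI[of _ "w @ [i]"]) auto
    qed
  qed
  have dw: "gcpf n f w \<in> dot_words n r" if "w \<in> nefin n ?D" "gcpf n f w \<noteq> []" for w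
    using gcpf_fin_words[OF f that(1)] that(2) by (simp add: dot_words_def)
  have "dot_transducer n r ?T (e ?f0)"
    unfolding dot_transducer_def
  proof (rule exI[of _ R], rule exI[of _ S], intro conjI)
    show "states ?T = R \<union> S" unfolding R_def S_def by auto
    have "q \<notin> S" if "q \<in> R" for q
    proof
      assume "q \<in> S"
      then obtain w where w: "w \<in> nefin n ?D" "q = e (loc n f w)" unfolding S_def by blast
      then show False using inR[OF w(1)] inS[OF w(1)] that \<open>q \<in> S\<close> by blast
    qed
    then show "R \<inter> S = {}" by blast
    show "finite R" unfolding R_def
      by (rule finite_subset[OF _ finite_imageI[OF fin, of e]]) auto
    show "e ?f0 \<in> R" by (simp add: R_def)
    show "\<forall>q\<in>states ?T. \<forall>i\<in>dot_input n r (e ?f0) q. step ?T i q \<in> states ?T - {e ?f0}"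
    proof (intro ballI)
      fix q i assume "q \<in> states ?T" "i \<in> dot_input n r (e ?f0) q"
      then obtain v where "v \<in> nefin n ?D" "step ?T i q = e (loc n f v)"
        using succ[of q i] states_T by auto
      then show "step ?T i q \<in> states ?T - {e ?f0}" using e_ne by auto
    qed
    have RSt: "R \<subseteq> e ` ?St" "S \<subseteq> e ` ?St" unfolding R_def S_def by auto
    show "\<forall>q\<in>R. \<forall>i\<in>dot_input n r (e ?f0) q. (step ?T i q \<in> R \<longrightarrow> outp ?T i q = []) \<and>
        (step ?T i q \<in> S \<longrightarrow> outp ?T i q \<in> dot_words n r)"
    proof (intro ballI)
      fix q i assume q: "q \<in> R" and i: "i \<in> dot_input n r (e ?f0) q"
      have "q \<in> e ` ?St" using q RSt by blast
      then obtain v where v: "v \<in> nefin n ?D" "step ?T i q = e (loc n f v)"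
        and o: "q = e ?f0 \<and> outp ?T i q = gcpf n f v
       \<or> (\<exists>w\<in>nefin n ?D. q = e (loc n f w) \<and> gcpf n f v = gcpf n f w @ outp ?T i q)"
        using succ[OF _ i] by blast
      have "outp ?T i q = gcpf n f v" using o inR q by auto
      then show "(step ?T i q \<in> R \<longrightarrow> outp ?T i q = []) \<and> (step ?T i q \<in> S \<longrightarrow> outp ?T i q \<in> dot_words n r)"
        using inR[OF v(1)] inS[OF v(1)] v(2) dw[OF v(1)] by simp
    qed
    have Sform: "\<exists>w\<in>nefin n ?D. q = e (loc n f w) \<and> gcpf n f w \<noteq> []" if "q \<in> S" for q
      using that unfolding S_def by auto
    show "\<forall>q\<in>S. \<forall>i\<in>letters n. step ?T i q \<in> S \<and> outp ?T i q \<in> L"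
    proof (intro ballI)
      fix q i assume q: "q \<in> S" and i: "i \<in> letters n"
      obtain w where w: "w \<in> nefin n ?D" "q = e (loc n f w)" "gcpf n f w \<noteq> []"
        using Sform[OF q] by blast
      have iL: "[i] \<in> L" using i by simp
      have wi: "w @ [i] \<in> nefin n ?D" by (rule nefin_append[OF w(1) iL])
      have g: "gcpf n f (w @ [i]) = gcpf n f w @ outp ?T i q"
        using outp_e[OF loc_St[OF w(1)]] sync_map_gcpf_append[OF f w(1) iL] w(2) by simp
      have "step ?T i q = e (loc n f (w @ [i]))"
        using step_e[OF loc_St[OF w(1)]] sync_map_loc_append[OF f w(1) iL] w(2) by simp
      moreover have "gcpf n f (w @ [i]) \<noteq> []" using g w(3) by simp
      moreover have "outp ?T i q \<in> L"
        using gcpf_fin_words[OF f wi] w(3) unfolding g by (simp add: append_fin_words)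
      ultimately show "step ?T i q \<in> S \<and> outp ?T i q \<in> L" using inS[OF wi] by simp
    qed
    show "\<forall>q\<in>S. \<forall>x\<in>C. infinite_output ?T q x"
      using Sform infinite_output_loc by blast
    show "\<forall>q\<in>R. \<forall>w\<in>fin_words n (dot_input n r (e ?f0) q). w \<noteq> [] \<longrightarrow> step_word ?T w q \<noteq> q"
    proof (intro ballI impI notI)
      fix q w assume q: "q \<in> R" and w: "w \<in> fin_words n (dot_input n r (e ?f0) q)" "w \<noteq> []"
        and cyc: "step_word ?T w q = q"
      consider "q = e ?f0" | v where "v \<in> nefin n ?D" "gcpf n f v = []" "q = e (loc n f v)"
        using q unfolding R_def by auto
      then show False
      proof cases
        case 1
        then have "w \<in> nefin n ?D" using w by (simp add: dot_input_def nefin_iff)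
        then show False using words_T(1)[of w] cyc 1 e_ne by metis
      next
        case (2 v)
        then have wL: "w \<in> L" using w e_ne[OF 2(1)] by (auto simp: dot_input_def)
        \<comment> \<open>Running around the cycle \<open>m\<close> times would give a long word
          with empty output, against \<open>ucont_gcpf\<close>.\<close>
        have it: "concat (replicate j w) \<in> L \<and> e (loc n f (v @ concat (replicate j w))) = q" for j
        proof (induction j)
          case 0 then show ?case using 2 by simp
        next
          case (Suc j)
          let ?v = "v @ concat (replicate j w)"
          have "?v \<in> nefin n ?D" using Suc nefin_append[OF 2(1)] by blast
          then have "e (loc n f (?v @ w)) = step_word ?T w (e (loc n f ?v))"
            using words_T_loc(1) wL by metis
          then have "e (loc n f (?v @ w)) = q" using Suc cyc by simp
          moreover have "concat (replicate j w) @ w = concat (replicate (Suc j) w)"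
            by (induction j) auto
          ultimately show ?case using Suc wL by (metis append.assoc append_in_lists_conv)
        qed
        obtain m where m: "\<And>w. w \<in> nefin n ?D \<Longrightarrow> m \<le> length w \<Longrightarrow> 1 \<le> length (gcpf n f w)"
          using ucont_gcpf[OF sync_mapD(3,2)[OF f]] by meson
        let ?v = "v @ concat (replicate m w)"
        have v': "?v \<in> nefin n ?D" using it nefin_append[OF 2(1)] by blast
        have "length (concat (replicate m w)) = m * length w" by (induction m) auto
        moreover have "length w \<ge> 1" using w(2) by (cases w) auto
        moreover have "m * 1 \<le> m * length w" by (rule mult_le_mono) (use calculation in auto)
        ultimately have "m \<le> length ?v" by (simp only: length_append)
        then have "gcpf n f ?v \<noteq> []" using m[OF v'] by auto
        moreover have "e (loc n f ?v) = e (loc n f v)" using it 2 by simp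
        ultimately show False using gcpf_eq[OF _ v' 2(1)] 2(2) by simp
      qed
    qed
  qed
  then have "minimal_dot_transducer_of n r f ?T (e ?f0)"
    unfolding minimal_dot_transducer_of_def using minimal_T state_map_f0 by (simp add: cantor_dot_def)
  moreover have "finite (states ?T)" using fin by simp
  ultimately show ?thesis by blast
qed

end

section \<open>The groups as images of homeomorphism groups\<close>

lemma topspace_cantor_dot [simp]: "topspace (cantor_dot_topology n r) = cantor_dot n r"
  by (simp add: cantor_dot_topology_def)

text \<open>A basic open set of the product restricts finitely many coordinates and may be shrunk to
  one fixing an initial segment.\<close>

lemma openin_cantor_dot:
  "openin (cantor_dot_topology n r) A \<longleftrightarrow> A \<subseteq> cantor_dot n r
     \<and> (\<forall>x\<in>A. \<exists>m. \<forall>y\<in>cantor_dot n r. take_word m y = take_word m x \<longrightarrow> y \<in> A)"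
  (is "?l \<longleftrightarrow> ?r")
proof
  let ?P = "product_topology (\<lambda>_::nat. discrete_topology (UNIV :: letter set)) UNIV"
  {
    assume ?l
    then obtain T where T: "openin ?P T" "A = T \<inter> cantor_dot n r"
      unfolding cantor_dot_topology_def openin_subtopology by blast
    have "\<exists>m. \<forall>y\<in>cantor_dot n r. take_word m y = take_word m x \<longrightarrow> y \<in> A" if x: "x \<in> A" for x
    proof -
      have "x \<in> T" using x T(2) by blast
      then obtain U where U: "finite {i. U i \<noteq> UNIV}" "x \<in> Pi\<^sub>E UNIV U" "Pi\<^sub>E UNIV U \<subseteq> T"
        using T(1) unfolding openin_product_topology_alt by force
      define m where "m = Suc (Max (insert 0 {i. U i \<noteq> UNIV}))"
      have "y \<in> A" if y: "y \<in> cantor_dot n r" "take_word m y = take_word m x" for y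
      proof -
        have "y i \<in> U i" for i
        proof (cases "U i = UNIV")
          case False
          then have "i \<le> Max (insert 0 {i. U i \<noteq> UNIV})" using U(1) by (intro Max_ge) auto
          then have "i < m" by (simp add: m_def)
          then have "y i = x i" using y(2) by (simp add: take_word_eq_iff)
          then show ?thesis using U(2) by auto
        qed simp
        then have "y \<in> T" using U(3) by (auto simp: PiE_UNIV_domain)
        then show ?thesis using T(2) y(1) by blast
      qed
      then show ?thesis by blast
    qed
    then show ?r using T(2) by blast
  }
  assume r: ?r
  define T where "T = {y. \<exists>x\<in>A. \<exists>m. (\<forall>z\<in>cantor_dot n r. take_word m z = take_word m x \<longrightarrow> z \<in> A)
      \<and> take_word m y = take_word m x}"
  have "openin ?P T"
    unfolding openin_product_topology_alt
  proof
    fix y assume "y \<in> T"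
    then obtain x m where xm: "x \<in> A" "\<forall>z\<in>cantor_dot n r. take_word m z = take_word m x \<longrightarrow> z \<in> A"
      "take_word m y = take_word m x" unfolding T_def by blast
    define U where "U i = (if i < m then {y i} else UNIV)" for i
    have "{i. U i \<noteq> UNIV} \<subseteq> {..<m}" by (auto simp: U_def split: if_splits)
    then have "finite {i. U i \<noteq> UNIV}" by (rule finite_subset) simp
    moreover have "y \<in> Pi\<^sub>E UNIV U" by (auto simp: PiE_UNIV_domain U_def)
    moreover have "Pi\<^sub>E UNIV U \<subseteq> T"
    proof
      fix z assume z: "z \<in> Pi\<^sub>E UNIV U"
      have "z i = y i" if "i < m" for i
      proof -
        have "z i \<in> U i" using z by (auto simp: PiE_UNIV_domain)
        then show ?thesis using that by (simp add: U_def)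
      qed
      then have "take_word m z = take_word m y" by (simp add: take_word_eq_iff)
      then show "z \<in> T" using xm unfolding T_def by auto
    qed
    ultimately show "\<exists>U. finite {i \<in> UNIV. U i \<noteq> topspace (discrete_topology UNIV)} \<and>
       (\<forall>i\<in>UNIV. openin (discrete_topology UNIV) (U i)) \<and> y \<in> Pi\<^sub>E UNIV U \<and> Pi\<^sub>E UNIV U \<subseteq> T"
      by (intro exI[of _ U]) simp
  qed
  moreover have "A = T \<inter> cantor_dot n r"
  proof (intro equalityI subsetI)
    fix x assume x: "x \<in> A"
    then obtain m where "\<forall>z\<in>cantor_dot n r. take_word m z = take_word m x \<longrightarrow> z \<in> A" using r by blast
    then show "x \<in> T \<inter> cantor_dot n r" using x r unfolding T_def by blast
  next
    fix x assume "x \<in> T \<inter> cantor_dot n r"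
    then show "x \<in> A" unfolding T_def by blast
  qed
  ultimately show ?l unfolding cantor_dot_topology_def openin_subtopology by blast
qed

lemma compact_cantor_dot: "compact_space (cantor_dot_topology n r)"
proof -
  have "cantor_dot n r = Pi\<^sub>E UNIV (\<lambda>k. if k = 0 then dots r else letters n)"
    (is "_ = Pi\<^sub>E UNIV ?A")
  proof -
    have "(\<forall>k. x k \<in> ?A k) \<longleftrightarrow> x 0 \<in> ?A 0 \<and> (\<forall>k. x (Suc k) \<in> ?A (Suc k))" for x
      by (rule iffI, blast, rule allI, case_tac k) auto
    then show ?thesis
      unfolding cantor_dot_def inf_words_def PiE_UNIV_domain Pi_def by auto
  qed
  moreover have "compactin (product_topology (\<lambda>_::nat. discrete_topology (UNIV :: letter set)) UNIV)
      (Pi\<^sub>E UNIV (\<lambda>k. if k = 0 then dots r else letters n))"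
    unfolding compactin_PiE compactin_discrete_topology by (intro disjI2 ballI) simp
  ultimately show ?thesis unfolding cantor_dot_topology_def by (simp add: compactin_subspace)
qed

text \<open>The Heine-Cantor argument: compactness provides one depth for all points.\<close>

lemma continuous_cantor_dot:
  "continuous_map (cantor_dot_topology n r) (cantor_dot_topology n r) h
     \<longleftrightarrow> h ` cantor_dot n r \<subseteq> cantor_dot n r \<and> ucont n (dots r) h" (is "?l \<longleftrightarrow> ?r")
proof
  let ?X = "cantor_dot_topology n r" and ?C = "cantor_dot n r"
  assume l: ?l
  then have im: "h x \<in> ?C" if "x \<in> ?C" for x using that by (auto simp: continuous_map_def)
  have "\<exists>m. \<forall>x\<in>?C. \<forall>y\<in>?C. take_word m x = take_word m y \<longrightarrow> take_word l (h x) = take_word l (h y)" for l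
  proof -
    have "\<exists>m. \<forall>y\<in>?C. take_word m y = take_word m x \<longrightarrow> take_word l (h y) = take_word l (h x)" if x: "x \<in> ?C" for x
    proof -
      let ?V = "{z \<in> ?C. take_word l z = take_word l (h x)}"
      have "openin ?X ?V" unfolding openin_cantor_dot by (auto intro!: exI[of _ l])
      then have "openin ?X {y \<in> ?C. h y \<in> ?V}" using l unfolding continuous_map_def topspace_cantor_dot by blast
      then show ?thesis using x im unfolding openin_cantor_dot by auto
    qed
    then have "\<forall>x\<in>?C. \<exists>m. \<forall>y\<in>?C. take_word m y = take_word m x \<longrightarrow> take_word l (h y) = take_word l (h x)"
      by blast
    from bchoice[OF this] obtain m where m: "\<forall>x\<in>?C. \<forall>y\<in>?C. take_word (m x) y = take_word (m x) x
        \<longrightarrow> take_word l (h y) = take_word l (h x)" by blast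
    define U where "U x = {y \<in> ?C. take_word (m x) y = take_word (m x) x}" for x
    have "openin ?X (U x)" for x unfolding U_def openin_cantor_dot by (auto intro!: exI[of _ "m x"])
    moreover have "?C \<subseteq> \<Union> (U ` ?C)" by (auto simp: U_def)
    ultimately obtain F where F: "finite F" "F \<subseteq> U ` ?C" "?C \<subseteq> \<Union> F"
      using compact_cantor_dot[of n r] unfolding compact_space_alt
      by (metis (no_types, lifting) image_iff topspace_cantor_dot)
    obtain G where G: "finite G" "G \<subseteq> ?C" "F = U ` G" using finite_subset_image[OF F(1,2)] by blast
    have "take_word l (h x) = take_word l (h y)"
      if x: "x \<in> ?C" and y: "y \<in> ?C" and xy: "take_word (Max (m ` G)) x = take_word (Max (m ` G)) y" for x y
    proof -
      obtain z where z: "z \<in> G" "x \<in> U z" using x F(3) G(3) by blast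
      have "m z \<le> Max (m ` G)" using G(1) z(1) by simp
      then have "take_word (m z) x = take_word (m z) y" using xy take_word_mono by blast
      then have "take_word (m z) y = take_word (m z) z" "take_word (m z) x = take_word (m z) z"
        using z(2) by (simp_all add: U_def)
      then have "take_word l (h y) = take_word l (h z)" "take_word l (h x) = take_word l (h z)"
        using m z(1) G(2) x y by blast+
      then show ?thesis by simp
    qed
    then show ?thesis by blast
  qed
  then show ?r using im unfolding ucont_def cantor_dot_def by blast
next
  let ?X = "cantor_dot_topology n r" and ?C = "cantor_dot n r"
  assume r: ?r
  have "openin ?X {x \<in> ?C. h x \<in> U}" if U: "openin ?X U" for U
    unfolding openin_cantor_dot
  proof (intro conjI ballI)
    fix x assume x: "x \<in> {x \<in> ?C. h x \<in> U}"
    then obtain l where l: "\<forall>y\<in>?C. take_word l y = take_word l (h x) \<longrightarrow> y \<in> U"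
      using U unfolding openin_cantor_dot by blast
    obtain m where "\<forall>x\<in>?C. \<forall>y\<in>?C. take_word m x = take_word m y \<longrightarrow> take_word l (h x) = take_word l (h y)"
      using r unfolding ucont_def cantor_dot_def by blast
    then show "\<exists>m. \<forall>y\<in>?C. take_word m y = take_word m x \<longrightarrow> y \<in> {x \<in> ?C. h x \<in> U}"
      using l r x by (intro exI[of _ m]) blast
  qed blast
  then show ?l using r unfolding continuous_map_def by auto
qed

lemma ucont_cong: "(\<And>x. x \<in> inf_words n D \<Longrightarrow> f x = g x) \<Longrightarrow> ucont n D f = ucont n D g"
  by (simp add: ucont_def)

lemma loc_cong_D:
  "(\<And>x. x \<in> inf_words n D \<Longrightarrow> f x = g x) \<Longrightarrow> w \<in> nefin n D \<Longrightarrow> loc n f w = loc n g w"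
  by (rule loc_cong) (simp add: inf_words_appendI)

lemma syncs_cong:
  assumes "\<And>x. x \<in> inf_words n D \<Longrightarrow> f x = g x" shows "syncs n D f k = syncs n D g k"
proof -
  have "loc n f (w @ u) = loc n g (w @ u)" if "w \<in> nefin n D" "u \<in> lists (letters n)" for w u
    by (rule loc_cong_D[OF assms nefin_append[OF that]])
  then show ?thesis unfolding syncs_def by simp
qed

lemma sync_map_cong:
  assumes "\<And>x. x \<in> inf_words n D \<Longrightarrow> f x = g x" shows "sync_map n D E f = sync_map n D E g"
proof -
  have "syncs n D f = syncs n D g" using syncs_cong[of n D f g] assms by blast
  then show ?thesis
    unfolding sync_map_def using assms ucont_cong[of n D f g] inj_on_cong[of "inf_words n D" f g]
    by (simp add: image_subset_iff)
qed

lemma core_maps_cong: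
  assumes "\<And>x. x \<in> inf_words n D \<Longrightarrow> f x = g x" shows "core_maps n D f = core_maps n D g"
  unfolding core_maps_def using loc_cong_D[of n D f g] assms by auto

section \<open>Homeomorphisms as synchronizing bijections\<close>

context alphabet
begin

lemma finite_synchronizing_iff:
  assumes "h ` cantor_dot n r \<subseteq> cantor_dot n r" "inj_on h (cantor_dot n r)" "ucont n (dots r) h" "1 \<le> r"
  shows "finite_synchronizing n r h \<longleftrightarrow> sync_map n (dots r) (dots r) h"
proof
  assume "finite_synchronizing n r h"
  then obtain T :: "nat transducer" and q0
    where T: "minimal_dot_transducer_of n r h T q0" "synchronizing n (dot_input n r q0) T"
    unfolding finite_synchronizing_def by blast
  interpret minimal_machine n "dot_input n r q0" T q0 h by (rule minimal_dot_machine[OF T(1)])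
  have "\<exists>k. syncs n (dots r) h k" using synchronizing_iff T(2) by (simp add: dot_input_def)
  then show "sync_map n (dots r) (dots r) h" using assms by (simp add: sync_map_def cantor_dot_def)
next
  assume f: "sync_map n (dots r) (dots r) h"
  then obtain T :: "nat transducer" and q0
    where T: "minimal_dot_transducer_of n r h T q0" "finite (states T)"
    using ex_minimal_dot assms(4) by blast
  interpret minimal_machine n "dot_input n r q0" T q0 h by (rule minimal_dot_machine[OF T(1)])
  have "synchronizing n (dot_input n r q0) T"
    using synchronizing_iff sync_mapD(4)[OF f] by (simp add: dot_input_def)
  then show "finite_synchronizing n r h" unfolding finite_synchronizing_def using T by blast
qed

abbreviation binv :: "nat \<Rightarrow> (iword \<Rightarrow> iword) \<Rightarrow> iword \<Rightarrow> iword" where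
  "binv r h \<equiv> restrict (inv_into (cantor_dot n r) h) (cantor_dot n r)"

lemma bij_binv: "bij_betw h (cantor_dot n r) (cantor_dot n r) \<Longrightarrow> bij_betw (binv r h) (cantor_dot n r) (cantor_dot n r)"
  using bij_betw_cong[of "cantor_dot n r" "binv r h" "inv_into (cantor_dot n r) h"] bij_betw_inv_into by auto

text \<open>Continuity is part of \<open>sync_map\<close>, so the topology can be forgotten from
  here on.\<close>

lemma B_nr_iff:
  assumes r: "1 \<le> r"
  shows "h \<in> B_nr n r \<longleftrightarrow> h \<in> extensional (cantor_dot n r) \<and> bij_betw h (cantor_dot n r) (cantor_dot n r)
    \<and> sync_map n (dots r) (dots r) h \<and> sync_map n (dots r) (dots r) (binv r h)"
proof -
  let ?X = "cantor_dot_topology n r" and ?C = "cantor_dot n r"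
  have *: "finite_synchronizing n r g \<longleftrightarrow> sync_map n (dots r) (dots r) g"
    if "continuous_map ?X ?X g" "bij_betw g ?C ?C" for g
    using that r by (intro finite_synchronizing_iff) (auto simp: continuous_cantor_dot bij_betw_def)
  have hom: "homeomorphic_map ?X ?X h \<longleftrightarrow> bij_betw h ?C ?C \<and> continuous_map ?X ?X h \<and> continuous_map ?X ?X (binv r h)"
  proof
    assume h: "homeomorphic_map ?X ?X h"
    then obtain g where g: "homeomorphic_maps ?X ?X h g" unfolding homeomorphic_map_maps by blast
    have bij: "bij_betw h ?C ?C"
      using h by (simp add: bij_betw_def homeomorphic_eq_everything_map)
    have "g x = binv r h x" if "x \<in> ?C" for x
    proof -
      have "g x \<in> ?C" "h (g x) = x" using g that by (auto simp: homeomorphic_maps_def continuous_map_def)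
      then show ?thesis using that bij by (simp add: bij_betw_def inv_into_f_eq)
    qed
    then have "continuous_map ?X ?X (binv r h)"
      using g continuous_map_eq[of ?X ?X g "binv r h"] by (simp add: homeomorphic_maps_def)
    then show "bij_betw h ?C ?C \<and> continuous_map ?X ?X h \<and> continuous_map ?X ?X (binv r h)"
      using bij h homeomorphic_imp_continuous_map by blast
  next
    assume a: "bij_betw h ?C ?C \<and> continuous_map ?X ?X h \<and> continuous_map ?X ?X (binv r h)"
    then have "homeomorphic_maps ?X ?X h (binv r h)"
      unfolding homeomorphic_maps_def
      using bij_betw_apply[of h ?C ?C] by (auto simp: bij_betw_inv_into_left bij_betw_inv_into_right)
    then show "homeomorphic_map ?X ?X h" unfolding homeomorphic_map_maps by blast
  qed
  have sc: "sync_map n (dots r) (dots r) g \<Longrightarrow> continuous_map ?X ?X g" for g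
    unfolding continuous_cantor_dot sync_map_def cantor_dot_def by blast
  show ?thesis
    unfolding B_nr_def mem_Collect_eq hom using * sc bij_binv by blast
qed

lemma Cores_eq:
  assumes "H \<subseteq> B_nr n r" "1 \<le> r"
  shows "Cores n r H = (\<lambda>h. core_class n (core_maps n (dots r) h)) ` H"
proof -
  have d: "Dot 0 \<in> dots r" using assms(2) by (auto simp: dots_def)
  have *: "iso_class n (core n (dot_input n r q0) T) = core_class n (core_maps n (dots r) h)"
    if h: "h \<in> H" and T: "minimal_dot_transducer_of n r h T q0" for T :: "nat transducer" and q0 h
  proof -
    interpret minimal_machine n "dot_input n r q0" T q0 h by (rule minimal_dot_machine[OF T])
    have "sync_map n (dots r) (dots r) h" using B_nr_iff assms h by blast
    then have "synchronizing n (dot_input n r q0) T"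
      using synchronizing_iff sync_mapD(4) by (simp add: dot_input_def)
    then show ?thesis using iso_class_core d by (simp add: dot_input_def)
  qed
  have ex: "\<exists>(T :: nat transducer) q0. minimal_dot_transducer_of n r h T q0" if "h \<in> H" for h
    using that ex_minimal_dot B_nr_iff assms by blast
  show ?thesis
  proof (intro equalityI subsetI)
    fix c assume "c \<in> Cores n r H"
    then show "c \<in> (\<lambda>h. core_class n (core_maps n (dots r) h)) ` H"
      unfolding Cores_def using * by blast
  next
    fix c assume "c \<in> (\<lambda>h. core_class n (core_maps n (dots r) h)) ` H"
    then obtain h where h: "h \<in> H" "c = core_class n (core_maps n (dots r) h)" by blast
    obtain T :: "nat transducer" and q0 where "minimal_dot_transducer_of n r h T q0" using ex[OF h(1)] by blast
    then show "c \<in> Cores n r H" unfolding Cores_def using *[OF h(1)] h by blast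
  qed
qed

text \<open>What a set of maps needs in order to be the state set of a core: closure under
  transitions and no output left over at the start. These properties allow \<open>K\<close> to be
  recovered from \<open>core_class n K\<close>.\<close>

definition core_set :: "(iword \<Rightarrow> iword) set \<Rightarrow> bool" where
  "core_set K \<longleftrightarrow> finite K \<and> K \<noteq> {} \<and> (\<forall>q\<in>K. sync_map n (letters n) (letters n) q
     \<and> q \<in> extensional C \<and> gcpf n q [] = [] \<and> (\<forall>i\<in>letters n. loc n q [i] \<in> K))"

lemma core_set_core_maps:
  assumes f: "sync_map n D E f" and d: "d \<in> D"
  shows "core_set (core_maps n D f)"
  unfolding core_set_def
proof (intro conjI ballI)
  show "finite (core_maps n D f)" "core_maps n D f \<noteq> {}"
    using finite_core_maps[OF f] core_maps_nonempty[OF f d] by auto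
  fix q assume q: "q \<in> core_maps n D f"
  show "sync_map n (letters n) (letters n) q" by (rule sync_map_core[OF f q])
  obtain w where w: "w \<in> nefin n D" "q = loc n f w" using core_mapsE[OF f q] by metis
  show "q \<in> extensional C" using w by simp
  show "gcpf n q [] = []" using sync_map_gcpf_append[OF f w(1), of "[]"] w(2) by simp
  fix i assume i: "i \<in> letters n"
  have "\<exists>w\<in>nefin n D. m \<le> length w \<and> loc n f w = loc n q [i]" for m
  proof -
    obtain w where w: "w \<in> nefin n D" "m \<le> length w" "q = loc n f w" using core_mapsE[OF f q] by metis
    then show ?thesis
      using nefin_append[OF w(1), of "[i]"] sync_map_loc_append[OF f w(1), of "[i]"] i
      by (intro bexI[of _ "w @ [i]"]) auto
  qed
  then show "loc n q [i] \<in> core_maps n D f" by (simp add: core_maps_def)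
qed

lemma core_class_words:
  assumes K: "core_set K" and U: "bij_betw \<phi> (states U) K"
    "\<And>q i. q \<in> states U \<Longrightarrow> i \<in> letters n \<Longrightarrow> step U i q \<in> states U"
    "\<And>q i. q \<in> states U \<Longrightarrow> i \<in> letters n \<Longrightarrow> \<phi> (step U i q) = loc n (\<phi> q) [i] \<and> outp U i q = gcpf n (\<phi> q) [i]"
    and q: "q \<in> states U" and w: "w \<in> L"
  shows "out_word U w q = gcpf n (\<phi> q) w"
  using q w
proof (induction w arbitrary: q)
  case Nil
  then have "\<phi> q \<in> K" using U(1) by (auto simp: bij_betw_def)
  then show ?case using K by (simp add: core_set_def)
next
  case (Cons i w)
  have "\<phi> q \<in> K" using U(1) Cons.prems(1) by (auto simp: bij_betw_def)
  then have s: "sync_map n (letters n) (letters n) (\<phi> q)" using K by (simp add: core_set_def)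
  have "out_word U w (step U i q) = gcpf n (loc n (\<phi> q) [i]) w"
    using Cons U by simp
  then show ?case
    using U(3)[OF Cons.prems(1), of i] sync_map_gcpf_append[OF s, of "[i]" w] Cons.prems(2) by simp
qed

lemma core_class_state_map:
  assumes K: "core_set K" and U: "plain_transducer n U" "bij_betw \<phi> (states U) K"
    "\<And>q i. q \<in> states U \<Longrightarrow> i \<in> letters n \<Longrightarrow> \<phi> (step U i q) = loc n (\<phi> q) [i] \<and> outp U i q = gcpf n (\<phi> q) [i]"
    and q: "q \<in> states U" and x: "x \<in> C"
  shows "state_map U q x = \<phi> q x"
proof (rule state_map_unique[where N = 0])
  show "infinite_output U q x" using U(1) q x by (simp add: plain_transducer_def)
  fix m
  have L: "take_word m x \<in> L" using take_cantor[OF x] .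
  have o: "out_word U (take_word m x) q = gcpf n (\<phi> q) (take_word m x)"
    by (rule core_class_words[OF K U(2) _ U(3) q L]) (use U(1) in \<open>auto simp: plain_transducer_def\<close>)
  have "\<phi> q \<in> K" using U(2) q by (auto simp: bij_betw_def)
  then have "inj_on (\<phi> q) C" using K sync_mapD(2)[of n "letters n" _ "\<phi> q"] by (auto simp: core_set_def)
  then have "is_gcp (gcpf n (\<phi> q) (take_word m x)) (cone n (\<phi> q) (take_word m x))"
    using is_gcp_gcpf splits_C L by blast
  from take_gcp[OF this drop_cantor[OF x, of m]]
  show "take_word (length (out_word U (take_word m x) q)) (\<phi> q x) = out_word U (take_word m x) q"
    by (simp add: o)
qed

lemma core_class_nonempty:
  assumes K: "core_set K" shows "core_class n K \<noteq> {}"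
proof -
  have "finite K" using K by (simp add: core_set_def)
  then obtain e :: "(iword \<Rightarrow> iword) \<Rightarrow> nat" where e: "inj_on e K" by (rule ex_code)
  define \<phi> where "\<phi> = inv_into K e"
  define U :: "nat transducer" where
    "U = \<lparr>states = e ` K, step = (\<lambda>i m. e (loc n (\<phi> m) [i])), outp = (\<lambda>i m. gcpf n (\<phi> m) [i])\<rparr>"
  have \<phi>e: "\<phi> (e q) = q" if "q \<in> K" for q using that e by (simp add: \<phi>_def)
  have bij: "bij_betw \<phi> (states U) K"
    unfolding \<phi>_def U_def using bij_betw_inv_into[of e K "e ` K"] e by (simp add: bij_betw_def)
  have st: "step U i q \<in> states U" if "q \<in> states U" "i \<in> letters n" for i q
    using that K \<phi>e by (auto simp: U_def core_set_def)
  have st': "\<phi> (step U i q) = loc n (\<phi> q) [i] \<and> outp U i q = gcpf n (\<phi> q) [i]"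
    if "q \<in> states U" "i \<in> letters n" for i q
    using that K \<phi>e by (auto simp: U_def core_set_def)
  have \<phi>K: "sync_map n (letters n) (letters n) (\<phi> q)" if "q \<in> states U" for q
    using bij that K by (auto simp: bij_betw_def core_set_def)
  have "plain_transducer n U"
    unfolding plain_transducer_def
  proof (intro conjI ballI)
    fix q i assume q: "q \<in> states U" and i: "i \<in> letters n"
    show "step U i q \<in> states U" by (rule st[OF q i])
    show "outp U i q \<in> L" using st'[OF q i] gcpf_fin_words[OF \<phi>K[OF q], of "[i]"] i by simp
  next
    fix q x assume q: "q \<in> states U" and x: "x \<in> C"
    show "infinite_output U q x"
      unfolding infinite_output_def
    proof
      fix k
      obtain m where m: "\<And>w. w \<in> nefin n (letters n) \<Longrightarrow> m \<le> length w \<Longrightarrow> Suc k \<le> length (gcpf n (\<phi> q) w)"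
        using ucont_gcpf[OF sync_mapD(3,2)[OF \<phi>K[OF q]], of "Suc k"] by blast
      have w: "take_word (Suc m) x \<in> nefin n (letters n)" using take_inf_words_ne[of x n "letters n"] x by simp
      have "out_word U (take_word (Suc m) x) q = gcpf n (\<phi> q) (take_word (Suc m) x)"
        by (rule core_class_words[OF K bij st st' q]) (use w in auto)
      then have "k < length (out_word U (take_word (Suc m) x) q)" using m[OF w] by simp
      then show "\<exists>m. k < length (out_word U (take_word m x) q)" by blast
    qed
  qed
  then have "U \<in> core_class n K" unfolding core_class_def using bij st' by blast
  then show ?thesis by blast
qed

lemma core_classE:
  assumes "core_set K" "U \<in> core_class n K"
  shows "K = (\<lambda>q. restrict (state_map U q) C) ` states U"
proof -
  obtain \<phi> where U: "plain_transducer n U" "bij_betw \<phi> (states U) K"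
    "\<And>q i. q \<in> states U \<Longrightarrow> i \<in> letters n \<Longrightarrow> \<phi> (step U i q) = loc n (\<phi> q) [i] \<and> outp U i q = gcpf n (\<phi> q) [i]"
    using assms(2) unfolding core_class_def by blast
  have "restrict (state_map U q) C = \<phi> q" if q: "q \<in> states U" for q
  proof -
    have "\<phi> q \<in> K" using U(2) q by (auto simp: bij_betw_def)
    then have "\<phi> q \<in> extensional C" using assms(1) by (simp add: core_set_def)
    then show ?thesis using core_class_state_map[OF assms(1) U q]
      by (intro extensionalityI[of _ C]) auto
  qed
  then show ?thesis using U(2) by (simp add: bij_betw_def)
qed

text \<open>The state maps of any member of the class give back the core maps, and a member exists
  by \<open>core_class_nonempty\<close>.\<close>

lemma core_class_inj:
  assumes "core_set K" "core_set K'" "core_class n K = core_class n K'" shows "K = K'"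
  using core_classE assms core_class_nonempty by (metis equals0I)

text \<open>By \<open>core_maps_comp\<close> all choices give the same class, so the union defining
  the product runs over at most one set. That it runs over one at all requires an actual pair of
  states and a minimal transducer of their composite.\<close>

lemma core_mult_core_class:
  assumes f: "sync_map n D E f" and g: "sync_map n E F g" and d: "d \<in> D" "d' \<in> E"
  shows "core_mult n (core_class n (core_maps n D f)) (core_class n (core_maps n E g))
    = core_class n (core_maps n D (g \<circ> f))"
proof -
  let ?K = "core_maps n D f" and ?K' = "core_maps n E g"
  note cK = core_set_core_maps[OF f d(1)] and cK' = core_set_core_maps[OF g d(2)]
  have *: "iso_class n (core n (plain_input n) M) = core_class n (core_maps n D (g \<circ> f))"
    if T: "T1 \<in> core_class n ?K" "T2 \<in> core_class n ?K'" "q1 \<in> states T1" "q2 \<in> states T2"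
      and M: "minimal_plain_transducer_of n (state_map T2 q2 \<circ> state_map T1 q1) M p0"
    for M :: "nat transducer" and p0 T1 T2 q1 q2
  proof -
    let ?p = "restrict (state_map T1 q1) C" and ?q = "restrict (state_map T2 q2) C"
    have p: "?p \<in> ?K" using core_classE[OF cK T(1)] T(3) by blast
    have q: "?q \<in> ?K'" using core_classE[OF cK' T(2)] T(4) by blast
    note sp = sync_map_core[OF f p] and sq = sync_map_core[OF g q]
    have s: "sync_map n (letters n) (letters n) (?q \<circ> ?p)" by (rule sync_map_comp[OF sp sq])
    have "state_map T1 q1 x \<in> C" if "x \<in> C" for x using sync_mapD(1)[OF sp, of x] that by simp
    then have "minimal_plain_transducer_of n (?q \<circ> ?p) M p0"
      using M by (simp add: minimal_plain_transducer_of_def)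
    then interpret minimal_machine n "plain_input n" M p0 "?q \<circ> ?p" by (rule minimal_plain_machine)
    have "synchronizing n (plain_input n) M"
      using synchronizing_iff sync_mapD(4)[OF s] by (simp add: plain_input_def)
    then have "iso_class n (core n (plain_input n) M) = core_class n (core_maps n (letters n) (?q \<circ> ?p))"
      using iso_class_core[of "Lt 0"] by (simp add: plain_input_def)
    then show ?thesis using core_maps_comp[OF f g p q] by simp
  qed
  obtain T1 T2 where T: "T1 \<in> core_class n ?K" "T2 \<in> core_class n ?K'"
    using core_class_nonempty[OF cK] core_class_nonempty[OF cK'] by blast
  have ne: "states T1 \<noteq> {}" "states T2 \<noteq> {}"
    using core_classE[OF cK T(1)] core_classE[OF cK' T(2)] cK cK' by (auto simp: core_set_def)
  then obtain q1 q2 where q: "q1 \<in> states T1" "q2 \<in> states T2" by blast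
  let ?p = "restrict (state_map T1 q1) C" and ?q = "restrict (state_map T2 q2) C"
  have p': "?p \<in> ?K" using core_classE[OF cK T(1)] q by blast
  have q': "?q \<in> ?K'" using core_classE[OF cK' T(2)] q by blast
  note sp = sync_map_core[OF f p'] and sq = sync_map_core[OF g q']
  obtain M :: "nat transducer" and p0 where M: "minimal_plain_transducer_of n (?q \<circ> ?p) M p0"
    using ex_minimal_plain[OF sync_map_comp[OF sp sq]] by blast
  have "state_map T1 q1 x \<in> C" if "x \<in> C" for x using sync_mapD(1)[OF sp, of x] that by simp
  then have M': "minimal_plain_transducer_of n (state_map T2 q2 \<circ> state_map T1 q1) M p0"
    using M by (simp add: minimal_plain_transducer_of_def)
  have "{iso_class n (core n (plain_input n) M) | M p0 T1 T2 q1 q2.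
     T1 \<in> core_class n ?K \<and> T2 \<in> core_class n ?K' \<and> q1 \<in> states T1 \<and> q2 \<in> states T2
   \<and> minimal_plain_transducer_of n (state_map T2 q2 \<circ> state_map T1 q1) M p0}
    = {core_class n (core_maps n D (g \<circ> f))}" (is "?Z = _")
  proof (intro equalityI subsetI)
    fix c assume "c \<in> ?Z" then show "c \<in> {core_class n (core_maps n D (g \<circ> f))}" using * by blast
  next
    fix c assume "c \<in> {core_class n (core_maps n D (g \<circ> f))}"
    then have "c = iso_class n (core n (plain_input n) M)" using *[OF T q M'] by simp
    then show "c \<in> ?Z" using T q M' by blast
  qed
  then have "\<Union> ?Z = core_class n (core_maps n D (g \<circ> f))" by simp
  then show ?thesis unfolding core_mult_def .
qed

section \<open>Identity, inverses and composition\<close>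

abbreviation bid :: "nat \<Rightarrow> iword \<Rightarrow> iword" where
  "bid r \<equiv> restrict id (cantor_dot n r)"

abbreviation core_of :: "nat \<Rightarrow> (iword \<Rightarrow> iword) \<Rightarrow> transducer_class" where
  "core_of r h \<equiv> core_class n (core_maps n (dots r) h)"

lemma gcpf_id_Nil: "gcpf n id [] = []"
  unfolding gcpf_def
proof (rule gcp_eqI, unfold is_gcp_def, intro conjI allI impI)
  show "common_prefix [] (cone n id [])" by (simp add: common_prefix_def)
  fix v assume v: "common_prefix v (cone n id [])"
  have "(\<lambda>_. Lt 0) \<in> cone n id []" "(\<lambda>_. Lt 1) \<in> cone n id []"
    unfolding cone_def using ones_C zeros_C by force+
  then have "take_word (length v) (\<lambda>_. Lt 0) = take_word (length v) (\<lambda>_. Lt 1)"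
    using v by (simp add: common_prefix_def)
  then have "v = []" by (auto simp: take_word_eq_iff)
  then show "prefix v []" by simp
qed

lemma splits_id: "splits n id []"
  by (rule splits_inj[of id "letters n"]) auto

lemma loc_id: "gcpf n id w = w" "loc n id w = loc n id []"
  using gcpf_prepend[OF splits_id, of id w w] gcpf_id_Nil by simp_all

lemma syncs_id: "syncs n D id 0"
  using loc_id(2) unfolding syncs_def by metis

lemma sync_map_id: "sync_map n D D id"
  unfolding sync_map_def ucont_def using syncs_id by auto

lemma core_maps_id: "d \<in> D \<Longrightarrow> core_maps n D id = {loc n id []}"
proof -
  assume "d \<in> D"
  moreover have "words_of_length n 0 = {[]}" by (auto simp: words_of_length_def)
  ultimately show ?thesis using core_maps_eq[OF syncs_id, of "[d]" D 0] loc_id(2)[of "[d]"] by simp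
qed

text \<open>The identity writes each letter as soon as it is read, so a single state
  suffices.\<close>

lemma core_class_id: "core_class n {loc n id []} = core_one n"
proof -
  let ?g = "loc n id []"
  have g: "?g x = x" if "x \<in> C" for x using that by (simp add: loc_def gcpf_id_Nil)
  have *: "loc n ?g [i] = ?g" "gcpf n ?g [i] = [i]" if "i \<in> letters n" for i
  proof -
    have "loc n ?g [i] = loc n id [i]" "gcpf n ?g [i] = gcpf n id [i]"
      by (rule loc_cong gcpf_cong; use g that in simp)+
    then show "loc n ?g [i] = ?g" "gcpf n ?g [i] = [i]" using loc_id[of "[i]"] by simp_all
  qed
  show ?thesis
  proof (intro equalityI subsetI)
    fix U assume "U \<in> core_class n {?g}"
    then obtain \<phi> where U: "plain_transducer n U" "bij_betw \<phi> (states U) {?g}"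
      "\<And>q i. q \<in> states U \<Longrightarrow> i \<in> letters n \<Longrightarrow> outp U i q = gcpf n (\<phi> q) [i]"
      unfolding core_class_def by blast
    then obtain q where q: "states U = {q}" "\<phi> q = ?g"
      by (metis bij_betw_def bij_betw_empty2 card_1_singletonE bij_betw_same_card card.empty card_insert_if
          empty_iff finite.emptyI image_insert image_empty singleton_insert_inj_eq One_nat_def)
    have "bij_betw (\<lambda>_. q) {0::nat} (states U)" using q by (simp add: bij_betw_def)
    moreover have "step U i q = q \<and> outp U i q = [i]" if i: "i \<in> letters n" for i
    proof -
      have "step U i q \<in> states U" using U(1) q i by (simp add: plain_transducer_def)
      then show ?thesis using q U(3)[of q i] i * by simp
    qed
    ultimately show "U \<in> core_one n"
      unfolding core_one_def iso_class_def transducer_iso_def using U(1) by auto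
  next
    fix U assume "U \<in> core_one n"
    then obtain h where U: "plain_transducer n U" "bij_betw h {0::nat} (states U)"
      "\<And>i. i \<in> letters n \<Longrightarrow> step U i (h 0) = h 0 \<and> outp U i (h 0) = [i]"
      unfolding core_one_def iso_class_def transducer_iso_def by auto
    have S: "states U = {h 0}" using U(2) by (simp add: bij_betw_def)
    have "bij_betw (\<lambda>_. ?g) (states U) {?g}" by (simp add: S bij_betw_def)
    then show "U \<in> core_class n {?g}"
      unfolding core_class_def using U(1,3) S * by (intro CollectI conjI exI[of _ "\<lambda>_. ?g"]) auto
  qed
qed

lemma core_of_id: "1 \<le> r \<Longrightarrow> core_of r (bid r) = core_one n"
  using core_maps_cong[of n "dots r" "bid r" id] core_maps_id[of "Dot 0" "dots r"] core_class_id
  by (auto simp: cantor_dot_def dots_def)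

lemma B_id: "1 \<le> r \<Longrightarrow> bid r \<in> B_nr n r"
proof -
  assume r: "1 \<le> r"
  have bij: "bij_betw (bid r) (cantor_dot n r) (cantor_dot n r)"
    by (auto simp: bij_betw_def inj_on_def)
  have inv: "binv r (bid r) x = x" if "x \<in> cantor_dot n r" for x
    using bij_betw_inv_into_left[OF bij that] that by simp
  have s: "sync_map n (dots r) (dots r) g" if "\<And>x. x \<in> cantor_dot n r \<Longrightarrow> g x = x" for g
    using sync_map_cong[of n "dots r" g id] sync_map_id that by (simp add: cantor_dot_def)
  show ?thesis unfolding B_nr_iff[OF r] using bij s[of "bid r"] s[of "binv r (bid r)", OF inv] by simp
qed

lemma B_inv:
  assumes r: "1 \<le> r" and h: "h \<in> B_nr n r"
  shows "binv r h \<in> B_nr n r"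
    "compose (cantor_dot n r) h (binv r h) = bid r" "compose (cantor_dot n r) (binv r h) h = bid r"
proof -
  have h': "h \<in> extensional (cantor_dot n r)" "bij_betw h (cantor_dot n r) (cantor_dot n r)"
    "sync_map n (dots r) (dots r) h" "sync_map n (dots r) (dots r) (binv r h)"
    using h unfolding B_nr_iff[OF r] by auto
  show "compose (cantor_dot n r) h (binv r h) = bid r" "compose (cantor_dot n r) (binv r h) h = bid r"
    using h'(2) bij_betw_apply[OF h'(2)]
    by (auto simp: compose_def restrict_def fun_eq_iff bij_betw_inv_into_left bij_betw_inv_into_right)
  have "binv r (binv r h) x = h x" if x: "x \<in> cantor_dot n r" for x
  proof -
    have "h x \<in> cantor_dot n r" using bij_betw_apply[OF h'(2) x] .
    moreover have "binv r h (h x) = x" using bij_betw_inv_into_left[OF h'(2) x] calculation by simp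
    ultimately show ?thesis
      using x bij_betw_inv_into_left[OF bij_binv[OF h'(2)], of "h x"] by simp
  qed
  then have "sync_map n (dots r) (dots r) (binv r (binv r h))"
    using sync_map_cong[of n "dots r" "binv r (binv r h)" h] h'(3) by (simp add: cantor_dot_def)
  then show "binv r h \<in> B_nr n r"
    unfolding B_nr_iff[OF r] using h' bij_binv by simp
qed

lemma B_comp:
  assumes r: "1 \<le> r" and h: "h \<in> B_nr n r" and g: "g \<in> B_nr n r"
  shows "compose (cantor_dot n r) g h \<in> B_nr n r"
proof -
  let ?C = "cantor_dot n r"
  have h': "bij_betw h ?C ?C" "sync_map n (dots r) (dots r) h" "sync_map n (dots r) (dots r) (binv r h)"
    using h unfolding B_nr_iff[OF r] by auto
  have g': "bij_betw g ?C ?C" "sync_map n (dots r) (dots r) g" "sync_map n (dots r) (dots r) (binv r g)"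
    using g unfolding B_nr_iff[OF r] by auto
  have bij: "bij_betw (compose ?C g h) ?C ?C" by (rule bij_betw_compose[OF h'(1) g'(1)])
  have "binv r (compose ?C g h) x = (binv r h \<circ> binv r g) x" if x: "x \<in> ?C" for x
  proof -
    define y where "y = binv r g x"
    define z where "z = binv r h y"
    have y: "y \<in> ?C" "g y = x" using x g'(1) bij_betw_apply[OF bij_binv[OF g'(1)] x]
      unfolding y_def by (auto simp: bij_betw_inv_into_right)
    have z: "z \<in> ?C" "h z = y" using y h'(1) bij_betw_apply[OF bij_binv[OF h'(1)] y(1)]
      unfolding z_def by (auto simp: bij_betw_inv_into_right)
    have "compose ?C g h z = x" using y z by (simp add: compose_def)
    then have "inv_into ?C (compose ?C g h) x = z" using bij_betw_inv_into_left[OF bij z(1)] by simp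
    then show ?thesis using x by (simp add: z_def y_def)
  qed
  then have "sync_map n (dots r) (dots r) (binv r (compose ?C g h))"
    using sync_map_cong[of n "dots r" "binv r (compose ?C g h)" "binv r h \<circ> binv r g"]
      sync_map_comp[OF g'(3) h'(3)] by (simp add: cantor_dot_def)
  moreover have "sync_map n (dots r) (dots r) (compose ?C g h)"
    using sync_map_cong[of n "dots r" "compose ?C g h" "g \<circ> h"] sync_map_comp[OF h'(2) g'(2)]
    by (simp add: cantor_dot_def compose_def)
  ultimately show ?thesis unfolding B_nr_iff[OF r] using bij by simp
qed

text \<open>The left factor acts first, hence the reversed arguments of
  \<open>compose\<close>.\<close>

lemma core_of_comp:
  assumes r: "1 \<le> r" and h: "h \<in> B_nr n r" and g: "g \<in> B_nr n r"
  shows "core_mult n (core_of r h) (core_of r g) = core_of r (compose (cantor_dot n r) g h)"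
proof -
  have d: "Dot 0 \<in> dots r" using r by (auto simp: dots_def)
  have "core_mult n (core_of r h) (core_of r g) = core_of r (g \<circ> h)"
    by (rule core_mult_core_class[where F = "dots r", OF _ _ d d]) (use h g in \<open>simp_all add: B_nr_iff[OF r]\<close>)
  also have "\<dots> = core_of r (compose (cantor_dot n r) g h)"
    using core_maps_cong[of n "dots r" "g \<circ> h" "compose (cantor_dot n r) g h"]
    by (simp add: compose_def cantor_dot_def)
  finally show ?thesis .
qed

text \<open>A subgroup of the group of homeomorphisms; it lets \<open>subgroup_Cores\<close> treat
  \<open>B_nr\<close> and \<open>TB_nr\<close> at once.\<close>

definition closed_family :: "nat \<Rightarrow> (iword \<Rightarrow> iword) set \<Rightarrow> bool" where
  "closed_family r G \<longleftrightarrow> G \<subseteq> B_nr n r \<and> bid r \<in> G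
     \<and> (\<forall>h\<in>G. \<forall>g\<in>G. compose (cantor_dot n r) g h \<in> G) \<and> (\<forall>h\<in>G. binv r h \<in> G)"

lemma closed_family_B: "1 \<le> r \<Longrightarrow> closed_family r (B_nr n r)"
  unfolding closed_family_def using B_id B_comp B_inv(1) by blast

lemma closed_family_TB:
  assumes r: "1 \<le> r" shows "closed_family r (TB_nr n r)"
proof -
  let ?C = "cantor_dot n r"
  have im: "h x \<in> ?C" if "h \<in> B_nr n r" "x \<in> ?C" for h x
    using that B_nr_iff[OF r] bij_betw_apply by metis
  show ?thesis
    unfolding closed_family_def
  proof (intro conjI ballI)
    show "TB_nr n r \<subseteq> B_nr n r" by (auto simp: TB_nr_def)
    show "bid r \<in> TB_nr n r" using B_id[OF r] by (simp add: TB_nr_def)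
    fix h assume h: "h \<in> TB_nr n r"
    then have hB: "h \<in> B_nr n r"
      and hc: "\<And>x y. x \<in> ?C \<Longrightarrow> y \<in> ?C \<Longrightarrow> circ_equiv n r x y \<longleftrightarrow> circ_equiv n r (h x) (h y)"
      by (auto simp: TB_nr_def)
    have hi: "h (binv r h x) = x" if "x \<in> ?C" for x
      using fun_cong[OF B_inv(2)[OF r hB], of x] that by (simp add: compose_def)
    show "binv r h \<in> TB_nr n r"
      unfolding TB_nr_def
    proof (intro CollectI conjI ballI)
      show "binv r h \<in> B_nr n r" by (rule B_inv(1)[OF r hB])
      fix x y assume xy: "x \<in> ?C" "y \<in> ?C"
      have "binv r h x \<in> ?C" "binv r h y \<in> ?C" using im[OF B_inv(1)[OF r hB]] xy by blast+
      from hc[OF this] show "circ_equiv n r x y \<longleftrightarrow> circ_equiv n r (binv r h x) (binv r h y)"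
        using hi[OF xy(1)] hi[OF xy(2)] by simp
    qed
    fix g assume g: "g \<in> TB_nr n r"
    then have gB: "g \<in> B_nr n r"
      and gc: "\<And>x y. x \<in> ?C \<Longrightarrow> y \<in> ?C \<Longrightarrow> circ_equiv n r x y \<longleftrightarrow> circ_equiv n r (g x) (g y)"
      by (auto simp: TB_nr_def)
    show "compose ?C g h \<in> TB_nr n r"
      unfolding TB_nr_def
    proof (intro CollectI conjI ballI)
      show "compose ?C g h \<in> B_nr n r" by (rule B_comp[OF r hB gB])
      fix x y assume xy: "x \<in> ?C" "y \<in> ?C"
      show "circ_equiv n r x y \<longleftrightarrow> circ_equiv n r (compose ?C g h x) (compose ?C g h y)"
        using hc[OF xy] gc[OF im[OF hB xy(1)] im[OF hB xy(2)]] xy by (simp add: compose_eq)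
    qed
  qed
qed

lemma core_of_unit:
  assumes r: "1 \<le> r" and h: "h \<in> B_nr n r"
  shows "core_mult n (core_one n) (core_of r h) = core_of r h"
proof -
  have "h \<in> extensional (cantor_dot n r)" using h B_nr_iff[OF r] by blast
  then have "compose (cantor_dot n r) h (bid r) = h"
    by (auto simp: compose_def extensional_def restrict_def)
  then show ?thesis using core_of_comp[OF r B_id[OF r] h] core_of_id[OF r] by simp
qed

lemma core_of_inv:
  assumes r: "1 \<le> r" and h: "h \<in> B_nr n r"
  shows "core_mult n (core_of r (binv r h)) (core_of r h) = core_one n"
  using core_of_comp[OF r B_inv(1)[OF r h] h] B_inv(2)[OF r h] core_of_id[OF r] by simp

lemma core_of_assoc:
  assumes r: "1 \<le> r" and h: "h \<in> B_nr n r" "g \<in> B_nr n r" "k \<in> B_nr n r"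
  shows "core_mult n (core_mult n (core_of r h) (core_of r g)) (core_of r k)
    = core_mult n (core_of r h) (core_mult n (core_of r g) (core_of r k))"
proof -
  let ?C = "cantor_dot n r"
  have "h x \<in> ?C" if "x \<in> ?C" for x using h(1) that B_nr_iff[OF r] bij_betw_apply by metis
  then have "compose ?C k (compose ?C g h) = compose ?C (compose ?C k g) h"
    by (auto simp: compose_def restrict_def)
  then show ?thesis
    using core_of_comp[OF r] B_comp[OF r] h by metis
qed

text \<open>The carrier is a union of images of different groups. Products across its members are
  under control once the union is the image of the single group for \<open>n - 1\<close>;
  \<open>carrier_O_group\<close> establishes this later.\<close>

lemma group_O_group:
  assumes "(\<Union>r\<in>{1..n - 1}. O_nr n r) = O_nr n (n - 1)"
  shows "group (O_group n)"
proof (rule groupI)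
  have r: "1 \<le> n - 1" using n2 by simp
  have car: "carrier (O_group n) = core_of (n - 1) ` B_nr n (n - 1)"
    using assms Cores_eq[OF subset_refl r] by (simp add: O_group_def O_nr_def)
  have [simp]: "monoid.mult (O_group n) = core_mult n" "monoid.one (O_group n) = core_one n"
    by (simp_all add: O_group_def)
  show "\<one>\<^bsub>O_group n\<^esub> \<in> carrier (O_group n)"
    unfolding car using core_of_id[OF r] B_id[OF r] by (metis \<open>monoid.one (O_group n) = core_one n\<close> image_eqI)
  fix x assume "x \<in> carrier (O_group n)"
  then obtain h where h: "h \<in> B_nr n (n - 1)" "x = core_of (n - 1) h" unfolding car by blast
  show "\<one>\<^bsub>O_group n\<^esub> \<otimes>\<^bsub>O_group n\<^esub> x = x" using core_of_unit[OF r h(1)] h(2) by simp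
  show "\<exists>y\<in>carrier (O_group n). y \<otimes>\<^bsub>O_group n\<^esub> x = \<one>\<^bsub>O_group n\<^esub>"
    unfolding car using core_of_inv[OF r h(1)] B_inv(1)[OF r h(1)] h(2) by auto
  fix y assume "y \<in> carrier (O_group n)"
  then obtain g where g: "g \<in> B_nr n (n - 1)" "y = core_of (n - 1) g" unfolding car by blast
  show "x \<otimes>\<^bsub>O_group n\<^esub> y \<in> carrier (O_group n)"
    unfolding car using core_of_comp[OF r h(1) g(1)] B_comp[OF r h(1) g(1)] h(2) g(2) by auto
  fix z assume "z \<in> carrier (O_group n)"
  then obtain k where k: "k \<in> B_nr n (n - 1)" "z = core_of (n - 1) k" unfolding car by blast
  show "x \<otimes>\<^bsub>O_group n\<^esub> y \<otimes>\<^bsub>O_group n\<^esub> z = x \<otimes>\<^bsub>O_group n\<^esub> (y \<otimes>\<^bsub>O_group n\<^esub> z)"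
    using core_of_assoc[OF r h(1) g(1) k(1)] h(2) g(2) k(2) by simp
qed

lemma subgroup_Cores:
  assumes G: "group (O_group n)" and r: "1 \<le> r" and H: "closed_family r H"
    and sub: "Cores n r H \<subseteq> carrier (O_group n)"
  shows "subgroup (Cores n r H) (O_group n)"
proof -
  have HB: "H \<subseteq> B_nr n r" using H by (simp add: closed_family_def)
  have c: "Cores n r H = core_of r ` H" by (rule Cores_eq[OF HB r])
  have [simp]: "monoid.mult (O_group n) = core_mult n" "monoid.one (O_group n) = core_one n"
    by (simp_all add: O_group_def)
  show ?thesis
  proof (rule group.subgroupI[OF G sub])
    show "Cores n r H \<noteq> {}" using H unfolding c closed_family_def by blast
    fix a assume "a \<in> Cores n r H"
    then obtain h where h: "h \<in> H" "a = core_of r h" unfolding c by blast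
    have hB: "h \<in> B_nr n r" using h HB by blast
    have i: "binv r h \<in> H" using H h by (simp add: closed_family_def)
    have "core_of r (binv r h) \<in> Cores n r H" unfolding c using i by blast
    moreover have "inv\<^bsub>O_group n\<^esub> a = core_of r (binv r h)"
      by (rule group.inv_equality[OF G])
        (use core_of_inv[OF r hB] h sub \<open>a \<in> Cores n r H\<close> calculation in auto)
    ultimately show "inv\<^bsub>O_group n\<^esub> a \<in> Cores n r H" by simp
    fix b assume "b \<in> Cores n r H"
    then obtain g where g: "g \<in> H" "b = core_of r g" unfolding c by blast
    have "compose (cantor_dot n r) g h \<in> H" using H h g by (simp add: closed_family_def)
    then show "a \<otimes>\<^bsub>O_group n\<^esub> b \<in> Cores n r H"
      unfolding c using core_of_comp[OF r hB] g h HB by auto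
  qed
qed

section \<open>The signature of a core\<close>

text \<open>A clopen set, together with a depth at which it is a union of cones.\<close>

definition clop :: "letter set \<Rightarrow> nat \<Rightarrow> iword set \<Rightarrow> bool" where
  "clop D p A \<longleftrightarrow> A \<subseteq> inf_words n D
     \<and> (\<forall>x\<in>A. \<forall>y\<in>inf_words n D. take_word p x = take_word p y \<longrightarrow> y \<in> A)"

text \<open>At a depth provided by \<open>clop\<close> this is the number of cones; its residue
  modulo n - 1 is then an invariant of the set.\<close>

definition cnt :: "nat \<Rightarrow> iword set \<Rightarrow> nat" where
  "cnt p A = card (take_word p ` A)"

lemma clop_mono: "clop D p A \<Longrightarrow> p \<le> p' \<Longrightarrow> clop D p' A"
  unfolding clop_def using take_word_mono by blast

lemma finite_take: "finite D \<Longrightarrow> A \<subseteq> inf_words n D \<Longrightarrow> finite (take_word p ` A)"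
  by (rule finite_subset[OF _ finite_fin_words_length[of D n p]]) (auto simp: take_inf_words)

text \<open>Each cone splits into \<open>n\<close> cones one level deeper. Depth 0 is excluded over
  dotted letters, where the first position takes as many values as there are dots.\<close>

lemma cnt_add:
  assumes A: "clop D p A" and p: "1 \<le> p \<or> D = letters n"
  shows "cnt (p + j) A = cnt p A * n ^ j"
proof -
  have "take_word (p + j) ` A = (\<lambda>(w, u). w @ u) ` (take_word p ` A \<times> words_of_length n j)"
  proof (intro equalityI subsetI)
    fix v assume "v \<in> take_word (p + j) ` A"
    then obtain x where x: "x \<in> A" "v = take_word p x @ take_word j (drop_word p x)"
      by (auto simp: take_word_add)
    have "x \<in> inf_words n D" using x A by (auto simp: clop_def)
    then have "drop_word p x \<in> C" using p drop_inf_words[of x n D p] drop_cantor[of x n p] by auto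
    then have "take_word j (drop_word p x) \<in> words_of_length n j"
      using take_cantor[of "drop_word p x" n j] by (simp add: words_of_length_def)
    then show "v \<in> (\<lambda>(w, u). w @ u) ` (take_word p ` A \<times> words_of_length n j)" using x by auto
  next
    fix v assume "v \<in> (\<lambda>(w, u). w @ u) ` (take_word p ` A \<times> words_of_length n j)"
    then obtain x u where x: "x \<in> A" "u \<in> L" "length u = j" "v = take_word p x @ u"
      by (auto simp: words_of_length_def)
    let ?y = "take_word p x \<frown> u \<frown> (\<lambda>_. Lt 0)"
    have xD: "x \<in> inf_words n D" using x A by (auto simp: clop_def)
    have "?y \<in> inf_words n D"
    proof (cases "p = 0")
      case True
      then show ?thesis using p x(2) by simp
    next
      case False
      then show ?thesis using take_inf_words_ne[OF xD, of p] x(2) by (intro inf_words_appendI) auto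
    qed
    moreover have "take_word p x = take_word p ?y" by (simp add: take_word_append_word)
    ultimately have "?y \<in> A" using A x(1) unfolding clop_def by blast
    moreover have "take_word (p + j) ?y = v" using x by (simp add: take_word_append_word)
    ultimately show "v \<in> take_word (p + j) ` A" by force
  qed
  moreover have "inj_on (\<lambda>(w, u). w @ u) (take_word p ` A \<times> words_of_length n j)"
    by (auto simp: inj_on_def)
  ultimately show ?thesis
    unfolding cnt_def by (simp add: card_image card_cartesian_product card_words_of_length)
qed

lemma pow_cong_1: "[n ^ j = 1] (mod (n - 1))"
proof -
  have "[n = 1] (mod (n - 1))" using n2 by (simp add: cong_altdef_nat)
  from cong_pow[OF this, of j] show ?thesis by simp
qed

lemma cnt_cong:
  assumes "clop D p A" "p \<le> p'" "1 \<le> p \<or> D = letters n"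
  shows "[cnt p' A = cnt p A] (mod (n - 1))"
proof -
  have "cnt p' A = cnt p A * n ^ (p' - p)" using cnt_add[OF assms(1,3), of "p' - p"] assms(2) by simp
  then show ?thesis using cong_scalar_left[OF pow_cong_1, of "cnt p A" "p' - p"] by simp
qed

lemma cnt_indep:
  assumes "clop D p A" "clop D p' A" "1 \<le> p \<and> 1 \<le> p' \<or> D = letters n"
  shows "[cnt p' A = cnt p A] (mod (n - 1))"
proof (cases "p \<le> p'")
  case True then show ?thesis using cnt_cong assms by blast
next
  case False then show ?thesis using cnt_cong[of D p' A p] assms cong_sym by auto
qed

text \<open>The condition on \<open>g\<close> covers a nonempty word over \<open>D\<close> as well
  as the empty word over the plain alphabet.\<close>

lemma cnt_prefix:
  assumes A: "clop (letters n) p A" and g: "\<And>x. g \<frown> x \<in> inf_words n D \<longleftrightarrow> x \<in> C"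
  shows "clop D (length g + p) ((\<frown>) g ` A)" "cnt (length g + p) ((\<frown>) g ` A) = cnt p A"
proof -
  have AC: "A \<subseteq> C" using A by (simp add: clop_def)
  show "clop D (length g + p) ((\<frown>) g ` A)"
    unfolding clop_def
  proof (intro conjI ballI impI)
    show "(\<frown>) g ` A \<subseteq> inf_words n D" using AC g by auto
    fix x y assume "x \<in> (\<frown>) g ` A" and y: "y \<in> inf_words n D"
      and eq: "take_word (length g + p) x = take_word (length g + p) y"
    then obtain z where z: "z \<in> A" "x = g \<frown> z" by blast
    have "take_word (length g) y = g"
      using take_word_mono[OF eq, of "length g"] z(2) by simp
    then have yg: "y = g \<frown> drop_word (length g) y" by (rule take_word_eqD)
    then have "drop_word (length g) y \<in> C" using y g by metis
    moreover have "take_word p z = take_word p (drop_word (length g) y)"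
      using eq z(2) by (simp add: take_word_add)
    ultimately have "drop_word (length g) y \<in> A" using A z(1) unfolding clop_def inf_words_letters by blast
    then show "y \<in> (\<frown>) g ` A" using yg by blast
  qed
  have "take_word (length g + p) ` (\<frown>) g ` A = (@) g ` take_word p ` A"
    by (auto simp: image_image take_word_add)
  then show "cnt (length g + p) ((\<frown>) g ` A) = cnt p A"
    unfolding cnt_def by (simp add: card_image inj_on_def)
qed

lemma cnt_UN:
  assumes "finite I" "finite D" "\<And>i. i \<in> I \<Longrightarrow> clop D p (A i)"
    and disj: "\<And>i j. i \<in> I \<Longrightarrow> j \<in> I \<Longrightarrow> i \<noteq> j \<Longrightarrow> A i \<inter> A j = {}"
  shows "cnt p (\<Union>i\<in>I. A i) = (\<Sum>i\<in>I. cnt p (A i))"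
proof -
  have "take_word p ` (\<Union>i\<in>I. A i) = (\<Union>i\<in>I. take_word p ` A i)" by blast
  moreover have "take_word p ` A i \<inter> take_word p ` A j = {}" if ij: "i \<in> I" "j \<in> I" "i \<noteq> j" for i j
  proof (rule ccontr)
    assume "take_word p ` A i \<inter> take_word p ` A j \<noteq> {}"
    then obtain x y where xy: "x \<in> A i" "y \<in> A j" "take_word p x = take_word p y" by auto
    then have "y \<in> A i" using assms(3)[OF ij(1)] assms(3)[OF ij(2)] unfolding clop_def by blast
    then show False using disj[OF ij] xy by blast
  qed
  moreover have "finite (take_word p ` A i)" if "i \<in> I" for i
    using finite_take[OF assms(2)] assms(3)[OF that] by (simp add: clop_def)
  ultimately show ?thesis unfolding cnt_def using assms(1) by (simp add: card_UN_disjoint)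
qed

text \<open>The cones of the code \<open>V\<close> have disjoint images, each the image of a local
  map translated by the prefix already written. Translation keeps the number of cones, and modulo n
  - 1 the depths may differ.\<close>

lemma cnt_decomposition:
  assumes V: "finite V" "\<And>x. x \<in> inf_words n D \<Longrightarrow> \<exists>v\<in>V. take_word (length v) x = v"
      "\<And>x u v. u \<in> V \<Longrightarrow> v \<in> V \<Longrightarrow> take_word (length u) x = u \<Longrightarrow> take_word (length v) x = v \<Longrightarrow> u = v"
    and preV: "\<And>v x. v \<in> V \<Longrightarrow> v \<frown> x \<in> inf_words n D \<longleftrightarrow> x \<in> C"
    and preE: "\<And>v x. v \<in> V \<Longrightarrow> gcpf n f v \<frown> x \<in> inf_words n E \<longleftrightarrow> x \<in> C"
    and f: "\<And>v x. v \<in> V \<Longrightarrow> x \<in> C \<Longrightarrow> f (v \<frown> x) = gcpf n f v \<frown> loc n f v x"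
      "inj_on f (inf_words n D)"
    and p: "\<And>v. v \<in> V \<Longrightarrow> clop (letters n) p (loc n f v ` C)"
    and E: "finite E" "clop E P (f ` inf_words n D)" "1 \<le> P \<or> E = letters n"
  shows "[cnt P (f ` inf_words n D) = (\<Sum>v\<in>V. cnt p (loc n f v ` C))] (mod (n - 1))"
proof -
  define A where "A v = (\<frown>) (gcpf n f v) ` loc n f v ` C" for v
  \<comment> \<open>A depth at which all translated images, and the whole image, are unions of
    cones.\<close>
  define M where "M = P + p + Max (insert 0 ((\<lambda>v. length (gcpf n f v)) ` V))"
  have len: "length (gcpf n f v) + p \<le> M" if "v \<in> V" for v
  proof -
    have "length (gcpf n f v) \<le> Max (insert 0 ((\<lambda>v. length (gcpf n f v)) ` V))"
      using V(1) that by (intro Max_ge) auto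
    then show ?thesis by (simp add: M_def)
  qed
  have Af: "A v = f ` ((\<frown>) v ` C)" if "v \<in> V" for v
    unfolding A_def image_image using f(1)[OF that] by (intro image_cong) auto
  have cl: "clop E (length (gcpf n f v) + p) (A v)" "cnt (length (gcpf n f v) + p) (A v) = cnt p (loc n f v ` C)"
    if "v \<in> V" for v
    unfolding A_def using cnt_prefix[OF p[OF that] preE[OF that]] by blast+
  have "clop E M (A v)" if "v \<in> V" for v using clop_mono[OF cl(1)[OF that] len[OF that]] .
  moreover have "A u \<inter> A v = {}" if uv: "u \<in> V" "v \<in> V" "u \<noteq> v" for u v
  proof (rule ccontr)
    assume "A u \<inter> A v \<noteq> {}"
    then obtain x y where xy: "x \<in> C" "y \<in> C" "f (u \<frown> x) = f (v \<frown> y)"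
      using Af uv by fastforce
    then have "u \<frown> x = v \<frown> y"
      using inj_on_eq_iff[OF f(2), of "u \<frown> x" "v \<frown> y"] preV uv by blast
    then show False using V(3)[OF uv(1,2), of "u \<frown> x"] uv(3) by (metis take_word_append_word_eq)
  qed
  moreover have "(\<Union>v\<in>V. A v) = f ` inf_words n D"
  proof (intro equalityI subsetI)
    fix y assume "y \<in> (\<Union>v\<in>V. A v)" then show "y \<in> f ` inf_words n D" using Af preV by auto
  next
    fix y assume "y \<in> f ` inf_words n D"
    then obtain x where x: "x \<in> inf_words n D" "y = f x" by blast
    obtain v where v: "v \<in> V" "take_word (length v) x = v" using V(2)[OF x(1)] by blast
    then have "x = v \<frown> drop_word (length v) x" by (simp add: take_word_eqD)
    then have "x \<in> (\<frown>) v ` C" using preV[OF v(1)] x(1) by (metis imageI)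
    then show "y \<in> (\<Union>v\<in>V. A v)" using Af[OF v(1)] v(1) x(2) by blast
  qed
  ultimately have "cnt M (f ` inf_words n D) = (\<Sum>v\<in>V. cnt M (A v))"
    using cnt_UN[OF V(1) E(1), of M A] by simp
  moreover have "[cnt M (A v) = cnt p (loc n f v ` C)] (mod (n - 1))" if v: "v \<in> V" for v
  proof -
    \<comment> \<open>With an empty output \<open>inf_words n E\<close> equals \<open>C\<close>;
      testing words with an arbitrary first letter and zeros behind it then shows that
      \<open>E\<close> is the plain alphabet.\<close>
    have "1 \<le> length (gcpf n f v) + p \<or> E = letters n"
    proof (cases "gcpf n f v = []")
      case True
      then have "C = inf_words n E" using preE[OF v] by auto
      then have "x 0 \<in> E \<longleftrightarrow> x 0 \<in> letters n" if "\<And>k. x (Suc k) \<in> letters n" for x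
        using that unfolding cantor_def inf_words_def by blast
      from this[of "\<lambda>k. if k = 0 then _ else Lt 0"] show ?thesis by auto
    next
      case False then show ?thesis by (cases "gcpf n f v") auto
    qed
    then show ?thesis using cnt_cong[OF cl(1)[OF v] len[OF v]] cl(2)[OF v] by simp
  qed
  then have "[(\<Sum>v\<in>V. cnt M (A v)) = (\<Sum>v\<in>V. cnt p (loc n f v ` C))] (mod (n - 1))"
    by (rule cong_sum)
  moreover have "[cnt M (f ` inf_words n D) = cnt P (f ` inf_words n D)] (mod (n - 1))"
    by (rule cnt_cong[OF E(2) _ E(3)]) (simp add: M_def)
  ultimately show ?thesis by (metis cong_sym cong_trans)
qed

text \<open>The number \<open>s\<close> stands for its residue modulo n - 1. The depth may vary with
  \<open>q\<close>, which \<open>sigD\<close> makes harmless.\<close>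

definition sig :: "(iword \<Rightarrow> iword) set \<Rightarrow> nat \<Rightarrow> bool" where
  "sig K s \<longleftrightarrow> (\<forall>q\<in>K. \<exists>p. clop (letters n) p (q ` C) \<and> [cnt p (q ` C) = s] (mod (n - 1)))"

lemma sigD:
  assumes "sig K s" "q \<in> K" "clop (letters n) p (q ` C)"
  shows "[cnt p (q ` C) = s] (mod (n - 1))"
proof -
  obtain p' where "clop (letters n) p' (q ` C)" "[cnt p' (q ` C) = s] (mod (n - 1))"
    using assms(1,2) unfolding sig_def by blast
  then show ?thesis using cnt_indep[OF _ assms(3)] cong_trans by blast
qed

text \<open>Here the inverse enters: a point agreeing with \<open>q x\<close> on enough letters is
  carried, behind the prefix written on \<open>w\<close>, by the inverse of \<open>h\<close> into
  the cone of \<open>w\<close>, and so is a value of \<open>q\<close>. Finiteness of the core gives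
  one depth for all.\<close>

lemma core_maps_clop:
  assumes r: "1 \<le> r" and h: "h \<in> B_nr n r"
  shows "\<exists>p. \<forall>q\<in>core_maps n (dots r) h. clop (letters n) p (q ` C)"
proof -
  let ?C = "cantor_dot n r"
  have h': "bij_betw h ?C ?C" "sync_map n (dots r) (dots r) h" "sync_map n (dots r) (dots r) (binv r h)"
    using h unfolding B_nr_iff[OF r] by auto
  have "\<exists>p. clop (letters n) p (q ` C)" if q: "q \<in> core_maps n (dots r) h" for q
  proof -
    obtain w where w: "w \<in> nefin n (dots r)" "1 \<le> length (gcpf n h w)" "q = loc n h w"
      using core_mapsE[OF h'(2) q] by metis
    have g: "gcpf n h w \<in> nefin n (dots r)" using gcpf_fin_words[OF h'(2) w(1)] w(2) by (auto simp: nefin_iff)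
    have "gcpf n h w \<noteq> []" using w(2) by auto
    then have qC: "q x \<in> C" if "x \<in> C" for x using loc_range[OF h'(2) w(1) _ that] w(3) by simp
    obtain m where m: "\<forall>x\<in>?C. \<forall>y\<in>?C. take_word m x = take_word m y
        \<longrightarrow> take_word (length w) (binv r h x) = take_word (length w) (binv r h y)"
      using sync_mapD(3)[OF h'(3)] unfolding ucont_def cantor_dot_def by blast
    have "clop (letters n) m (q ` C)"
      unfolding clop_def
    proof (intro conjI ballI impI)
      show "q ` C \<subseteq> inf_words n (letters n)" using qC by auto
      fix z y assume "z \<in> q ` C" and y: "y \<in> inf_words n (letters n)" and eq: "take_word m z = take_word m y"
      then obtain x where x: "x \<in> C" "z = q x" by blast
      have yC: "y \<in> C" using y by simp
      let ?a = "gcpf n h w \<frown> q x" and ?b = "gcpf n h w \<frown> y"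
      have ab: "?a \<in> ?C" "?b \<in> ?C" using inf_words_appendI[OF g] qC[OF x(1)] yC by (auto simp: cantor_dot_def)
      have "take_word m ?a = take_word m ?b"
        using take_word_mono[OF eq, of "m - length (gcpf n h w)"] x by (simp add: take_word_append_word)
      then have tk: "take_word (length w) (binv r h ?a) = take_word (length w) (binv r h ?b)" using m ab by blast
      have "?a = h (w \<frown> x)" using sync_map_loc_eq[OF h'(2) w(1) x(1)] w(3) by simp
      then have "binv r h ?a = w \<frown> x"
        using bij_betw_inv_into_left[OF h'(1), of "w \<frown> x"] ab(1) inf_words_appendI[OF w(1) x(1)]
        by (simp add: cantor_dot_def)
      then have "take_word (length w) (binv r h ?b) = w" using tk by simp
      then have wb: "binv r h ?b = w \<frown> drop_word (length w) (binv r h ?b)" by (rule take_word_eqD)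
      let ?v = "drop_word (length w) (binv r h ?b)"
      have "binv r h ?b \<in> ?C" using bij_betw_apply[OF bij_binv[OF h'(1)] ab(2)] .
      then have v: "?v \<in> C" using wb w(1) inf_words_append[of w ?v n "dots r"]
        by (simp add: cantor_dot_def nefin_iff)
      have "h (w \<frown> ?v) = ?b"
        using bij_betw_inv_into_right[OF h'(1) ab(2)] ab(2) wb by simp
      then have "y = q ?v" using sync_map_loc_eq[OF h'(2) w(1) v] w(3) by simp
      then show "y \<in> q ` C" using v by blast
    qed
    then show ?thesis by blast
  qed
  then obtain P where P: "\<And>q. q \<in> core_maps n (dots r) h \<Longrightarrow> clop (letters n) (P q) (q ` C)" by metis
  have fin: "finite (core_maps n (dots r) h)" by (rule finite_core_maps[OF h'(2)])
  show ?thesis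
  proof (intro exI[of _ "Max (P ` core_maps n (dots r) h)"] ballI)
    fix q assume q: "q \<in> core_maps n (dots r) h"
    show "clop (letters n) (Max (P ` core_maps n (dots r) h)) (q ` C)"
      by (rule clop_mono[OF P[OF q]]) (use fin q in simp)
  qed
qed

lemma words_partition:
  "x \<in> C \<Longrightarrow> \<exists>v\<in>words_of_length n k. take_word (length v) x = v"
  "u \<in> words_of_length n k \<Longrightarrow> v \<in> words_of_length n k \<Longrightarrow> take_word (length u) x = u
     \<Longrightarrow> take_word (length v) x = v \<Longrightarrow> u = v"
  by (auto simp: words_of_length_def intro!: bexI[of _ "take_word k x"] take_cantor simp del: in_lists_conv_set)

text \<open>Long words act as resets, from every start and from every core map alike;
  \<open>d # u\<close> is the reference for the map to which \<open>u\<close> resets.\<close>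

lemma core_maps_forced:
  assumes f: "sync_map n D E f" and k: "syncs n D f k" and d: "d \<in> D" and u: "u \<in> L" "k \<le> length u"
  shows "loc n f (d # u) \<in> core_maps n D f"
    "w \<in> nefin n D \<Longrightarrow> loc n f (w @ u) = loc n f (d # u)"
    "q \<in> core_maps n D f \<Longrightarrow> loc n q u = loc n f (d # u)"
proof -
  have d': "[d] \<in> nefin n D" using d by simp
  show "loc n f (d # u) \<in> core_maps n D f"
    using core_maps_eq[OF k d' u(2)] u by (auto simp: words_of_length_def)
  show 1: "loc n f (w @ u) = loc n f (d # u)" if "w \<in> nefin n D" for w
    using syncsD[OF k that d' u] by simp
  show "loc n q u = loc n f (d # u)" if "q \<in> core_maps n D f"
  proof -
    obtain w where w: "w \<in> nefin n D" "q = loc n f w" using core_mapsE[OF f \<open>q \<in> core_maps n D f\<close>] by metis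
    then show ?thesis using sync_map_loc_append[OF f w(1) u(1)] 1[OF w(1)] by simp
  qed
qed

text \<open>Over the inputs of length \<open>k\<close>, the image of a core map decomposes into
  translates of the images of the maps forced by these inputs. They do not depend on the map started
  from, so the sum \<open>s\<close> is the same for all.\<close>

lemma ex_sig:
  assumes r: "1 \<le> r" and h: "h \<in> B_nr n r"
  shows "\<exists>s. sig (core_maps n (dots r) h) s"
proof -
  let ?K = "core_maps n (dots r) h"
  have f: "sync_map n (dots r) (dots r) h" using h unfolding B_nr_iff[OF r] by auto
  have d: "Dot 0 \<in> dots r" using r by (auto simp: dots_def)
  obtain k where k: "syncs n (dots r) h k" using sync_mapD(4)[OF f] by blast
  obtain p where p: "\<And>q. q \<in> ?K \<Longrightarrow> clop (letters n) p (q ` C)" using core_maps_clop[OF r h] by blast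
  define s where "s = (\<Sum>u\<in>words_of_length n k. cnt p (loc n h (Dot 0 # u) ` C))"
  have "[cnt p (q ` C) = s] (mod (n - 1))" if q: "q \<in> ?K" for q
  proof -
    have sq: "sync_map n (letters n) (letters n) q" by (rule sync_map_core[OF f q])
    have qu: "loc n q u = loc n h (Dot 0 # u)" "loc n q u \<in> ?K" if "u \<in> words_of_length n k" for u
      using core_maps_forced(1,3)[OF f k d, of u] that q by (auto simp: words_of_length_def)
    have inj: "inj_on q C" using sync_mapD(2)[OF sq] by simp
    have gL: "gcpf n q u \<in> L" if "u \<in> words_of_length n k" for u
    proof (cases "u = []")
      case True
      have "gcpf n q [] = []" using core_set_core_maps[OF f d] q by (simp add: core_set_def)
      then show ?thesis using True by simp
    next
      case False
      then show ?thesis using gcpf_fin_words[OF sq, of u] that by (simp add: words_of_length_def)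
    qed
    have "[cnt p (q ` inf_words n (letters n)) = (\<Sum>u\<in>words_of_length n k. cnt p (loc n q u ` C))] (mod (n - 1))"
    proof (rule cnt_decomposition[where E = "letters n"])
      show "q (v \<frown> x) = gcpf n q v \<frown> loc n q v x" if "v \<in> words_of_length n k" "x \<in> C" for v x
        using that by (intro loc_eq splits_C inj) (auto simp: words_of_length_def)
      show "finite (words_of_length n k)" by simp
    qed (use words_partition inj gL qu(2) p[OF q] in \<open>auto simp: words_of_length_def p simp del: in_lists_conv_set\<close>)
    then show ?thesis by (simp add: s_def qu(1) cong: sum.cong)
  qed
  then show ?thesis unfolding sig_def using p by blast
qed

text \<open>The whole space is its own image. Counted directly it has \<open>r\<close> cones of
  depth 1; counted through the r n^k cones of depth k + 1 of the domain, each of them contributes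
  \<open>s\<close>.\<close>

lemma sig_fixes_r:
  assumes r: "1 \<le> r" and h: "h \<in> B_nr n r" and s: "sig (core_maps n (dots r) h) s"
  shows "[r * s = r] (mod (n - 1))"
proof -
  let ?K = "core_maps n (dots r) h"
  have f: "sync_map n (dots r) (dots r) h" and bij: "bij_betw h (cantor_dot n r) (cantor_dot n r)"
    using h unfolding B_nr_iff[OF r] by auto
  obtain k1 where k1: "syncs n (dots r) h k1" using sync_mapD(4)[OF f] by blast
  obtain k2 where k2: "\<And>w. w \<in> nefin n (dots r) \<Longrightarrow> k2 \<le> length w \<Longrightarrow> 1 \<le> length (gcpf n h w)"
    using ucont_gcpf[OF sync_mapD(3,2)[OF f]] by meson
  \<comment> \<open>\<open>k1\<close> makes the local maps on the cones of \<open>V\<close> core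
    maps, \<open>k2\<close> makes the outputs there nonempty.\<close>
  define k where "k = max k1 k2"
  define V where "V = (\<lambda>(d, u). d # u) ` (dots r \<times> words_of_length n k)"
  have V: "v \<in> nefin n (dots r)" "length v = Suc k" if "v \<in> V" for v
    using that by (auto simp: V_def words_of_length_def)
  have VI: "v \<in> V" if "v \<in> nefin n (dots r)" "length v = Suc k" for v
    using that by (cases v) (auto simp: V_def words_of_length_def)
  have finV: "finite V" unfolding V_def by simp
  obtain p where p: "\<And>q. q \<in> ?K \<Longrightarrow> clop (letters n) p (q ` C)" using core_maps_clop[OF r h] by blast
  have locK: "loc n h v \<in> ?K" if v: "v \<in> V" for v
  proof -
    obtain d u where "v = d # u" "d \<in> dots r" "u \<in> L" "length u = k"
      using v by (auto simp: V_def words_of_length_def)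
    then show ?thesis using core_maps_forced(1)[OF f k1] by (simp add: k_def)
  qed
  have im: "h ` inf_words n (dots r) = cantor_dot n r" using bij by (simp add: bij_betw_def cantor_dot_def)
  have clop1: "clop (dots r) 1 (cantor_dot n r)" by (auto simp: clop_def cantor_dot_def)
  have "[cnt 1 (h ` inf_words n (dots r)) = (\<Sum>v\<in>V. cnt p (loc n h v ` C))] (mod (n - 1))"
  proof (rule cnt_decomposition[where E = "dots r"])
    show "finite V" by (rule finV)
    show "\<exists>v\<in>V. take_word (length v) x = v" if "x \<in> inf_words n (dots r)" for x
      using VI[of "take_word (Suc k) x"] take_inf_words_ne[OF that, of "Suc k"]
      by (intro bexI[of _ "take_word (Suc k) x"]) simp_all
    show "u = v" if "u \<in> V" "v \<in> V" "take_word (length u) x = u" "take_word (length v) x = v" for u v x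
      using V(2)[OF that(1)] V(2)[OF that(2)] that(3,4) by simp
    show "v \<frown> x \<in> inf_words n (dots r) \<longleftrightarrow> x \<in> C" if "v \<in> V" for v x
      using V(1)[OF that] inf_words_append[of v x n "dots r"] by (simp add: nefin_iff)
    show "gcpf n h v \<frown> x \<in> inf_words n (dots r) \<longleftrightarrow> x \<in> C" if "v \<in> V" for v x
    proof -
      have "gcpf n h v \<noteq> []" using k2[OF V(1)[OF that]] V(2)[OF that] by (fastforce simp: k_def)
      then show ?thesis
        using gcpf_fin_words[OF f V(1)[OF that]] inf_words_append[of "gcpf n h v" x n "dots r"] by simp
    qed
    show "h (v \<frown> x) = gcpf n h v \<frown> loc n h v x" if "v \<in> V" "x \<in> C" for v x
      by (rule sync_map_loc_eq[OF f V(1)[OF that(1)] that(2)])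
    show "inj_on h (inf_words n (dots r))" by (rule sync_mapD(2)[OF f])
    show "clop (letters n) p (loc n h v ` C)" if "v \<in> V" for v by (rule p[OF locK[OF that]])
    show "clop (dots r) 1 (h ` inf_words n (dots r))" unfolding im by (rule clop1)
  qed simp_all
  moreover have "cnt 1 (cantor_dot n r) = r"
  proof -
    have "take_word 1 ` cantor_dot n r = (\<lambda>d. [d]) ` dots r"
    proof (intro equalityI subsetI)
      fix w assume "w \<in> take_word 1 ` cantor_dot n r"
      then show "w \<in> (\<lambda>d. [d]) ` dots r" by (auto simp: take_word_def cantor_dot_def inf_words_def)
    next
      fix w assume "w \<in> (\<lambda>d. [d]) ` dots r"
      then obtain d where d: "d \<in> dots r" "w = [d]" by blast
      have "[d] \<frown> (\<lambda>_. Lt 0) \<in> cantor_dot n r" unfolding cantor_dot_def by (rule inf_words_appendI) (use d in simp_all)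
      moreover have "take_word 1 ([d] \<frown> (\<lambda>_. Lt 0)) = w" using d take_word_append_word_eq[of "[d]"] by simp
      ultimately show "w \<in> take_word 1 ` cantor_dot n r" by blast
    qed
    then show ?thesis unfolding cnt_def by (simp add: card_image inj_on_def)
  qed
  ultimately have 1: "[r = (\<Sum>v\<in>V. cnt p (loc n h v ` C))] (mod (n - 1))" using im by simp
  have 2: "[(\<Sum>v\<in>V. cnt p (loc n h v ` C)) = (\<Sum>v\<in>V. s)] (mod (n - 1))"
    by (rule cong_sum) (rule sigD[OF s locK p[OF locK]])
  have "card V = r * n ^ k"
    unfolding V_def by (subst card_image) (auto simp: inj_on_def card_cartesian_product card_words_of_length)
  then have 3: "(\<Sum>v\<in>V. s) = (r * s) * n ^ k" by simp
  have "[(r * s) * n ^ k = r * s] (mod (n - 1))"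
    using cong_scalar_left[OF pow_cong_1, of "r * s" k] by simp
  then show ?thesis using 1 2 unfolding 3 by (metis cong_sym cong_trans)
qed

section \<open>Realizing a core over another circle\<close>

text \<open>Finite complete prefix codes, that is, the finite partitions of
  \<open>inf_words n D\<close> into cones of nonempty words.\<close>

definition pcode :: "letter set \<Rightarrow> letter list set \<Rightarrow> bool" where
  "pcode D E \<longleftrightarrow> finite E \<and> E \<subseteq> nefin n D \<and> (\<forall>x\<in>inf_words n D. \<exists>e\<in>E. take_word (length e) x = e)
     \<and> (\<forall>e\<in>E. \<forall>e'\<in>E. \<forall>x. take_word (length e) x = e \<longrightarrow> take_word (length e') x = e' \<longrightarrow> e = e')"

lemma pcode_letters: "finite D \<Longrightarrow> pcode D ((\<lambda>d. [d]) ` D)"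
  unfolding pcode_def
  by (auto simp: take_word_def inf_words_def)

text \<open>A cone is replaced by its \<open>n\<close> subcones, which accounts for the steps of n -
  1 in the possible sizes.\<close>

lemma pcode_split:
  assumes E: "pcode D E" and e: "e \<in> E"
  shows "pcode D (E - {e} \<union> (\<lambda>i. e @ [i]) ` letters n)"
    "card (E - {e} \<union> (\<lambda>i. e @ [i]) ` letters n) = card E + (n - 1)"
proof -
  let ?F = "(\<lambda>i. e @ [i]) ` letters n"
  have E': "finite E" "E \<subseteq> nefin n D" "\<And>x. x \<in> inf_words n D \<Longrightarrow> \<exists>e\<in>E. take_word (length e) x = e"
    "\<And>a b x. a \<in> E \<Longrightarrow> b \<in> E \<Longrightarrow> take_word (length a) x = a \<Longrightarrow> take_word (length b) x = b \<Longrightarrow> a = b"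
    using E unfolding pcode_def by blast+
  have pre: "take_word (length e) x = e" if "take_word (length (e @ [i])) x = e @ [i]" for x i
    using that by (simp add: take_word_Suc)
  have eD: "e \<in> nefin n D" using e E'(2) by blast
  show "pcode D (E - {e} \<union> ?F)"
    unfolding pcode_def
  proof (intro conjI ballI allI impI)
    show "finite (E - {e} \<union> ?F)" using E'(1) by simp
    show "E - {e} \<union> ?F \<subseteq> nefin n D" using E'(2) nefin_append[OF eD] by auto
  next
    fix x assume x: "x \<in> inf_words n D"
    obtain a where a: "a \<in> E" "take_word (length a) x = a" using E'(3)[OF x] by blast
    show "\<exists>a\<in>E - {e} \<union> ?F. take_word (length a) x = a"
    proof (cases "a = e")
      case True
      have "length e > 0" using eD by (cases e) auto
      then have "x (length e) \<in> letters n"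
        using x by (cases "length e") (auto simp: inf_words_def)
      moreover have "take_word (length (e @ [x (length e)])) x = e @ [x (length e)]"
        using a True by (simp add: take_word_Suc)
      ultimately show ?thesis by blast
    next
      case False then show ?thesis using a by blast
    qed
  next
    fix a b x assume a: "a \<in> E - {e} \<union> ?F" and b: "b \<in> E - {e} \<union> ?F"
      and ax: "take_word (length a) x = a" and bx: "take_word (length b) x = b"
    consider "a \<in> E - {e}" "b \<in> E - {e}" | i where "a = e @ [i]" "b \<in> E - {e}"
      | i where "a \<in> E - {e}" "b = e @ [i]" | i j where "a = e @ [i]" "b = e @ [j]"
      using a b by blast
    then show "a = b"
    proof cases
      case 1 then show ?thesis using E'(4) ax bx by blast
    next
      case (2 i) then show ?thesis using E'(4)[OF e, of b x] pre[of i x] ax bx by auto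
    next
      case (3 i) then show ?thesis using E'(4)[OF e, of a x] pre[of i x] ax bx by auto
    next
      case (4 i j) then show ?thesis using ax bx by simp
    qed
  qed
  have "(E - {e}) \<inter> ?F = {}"
  proof (rule ccontr)
    assume "(E - {e}) \<inter> ?F \<noteq> {}"
    then obtain i where i: "e @ [i] \<in> E" by blast
    have "e @ [i] = e"
      by (rule E'(4)[OF i e, of "(e @ [i]) \<frown> (\<lambda>_. Lt 0)"])
        (rule take_word_append_word_eq, simp only: append_word_append take_word_append_word_eq)
    then show False by simp
  qed
  moreover have "card ?F = n" by (simp add: card_image inj_on_def)
  ultimately have "card (E - {e} \<union> ?F) = card E - 1 + n" using E'(1) e by (simp add: card_Un_disjoint)
  moreover have "card E > 0" using E'(1) e by (auto simp: card_gt_0_iff)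
  ultimately show "card (E - {e} \<union> ?F) = card E + (n - 1)" using n2 by simp
qed

text \<open>Starts from the \<open>r\<close> one-letter words and splits repeatedly.\<close>

lemma ex_pcode:
  assumes r: "1 \<le> r" and M: "r \<le> M" "[M = r] (mod (n - 1))"
  shows "\<exists>E. pcode (dots r) E \<and> card E = M"
proof -
  have "\<exists>E. pcode (dots r) E \<and> card E = r + j * (n - 1)" for j
  proof (induction j)
    case 0
    have "card ((\<lambda>d. [d]) ` dots r) = r" by (simp add: card_image inj_on_def)
    then show ?case using pcode_letters[of "dots r"] by (metis add_0_right finite_dots mult_0)
  next
    case (Suc j)
    then obtain E where E: "pcode (dots r) E" "card E = r + j * (n - 1)" by blast
    then have "E \<noteq> {}" using r by auto
    then obtain e where "e \<in> E" by blast
    from pcode_split[OF E(1) this] show ?case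
      unfolding E(2) by (metis (no_types, lifting) add.assoc add.commute mult_Suc)
  qed
  moreover obtain j where "M = r + j * (n - 1)"
    using M by (metis cong_le_nat cong_sym add.commute mult.commute)
  ultimately show ?thesis by blast
qed

text \<open>In a triple \<open>(d, u, c)\<close> the letter \<open>d\<close> ranges over the new
  space, while the core map forced by \<open>u\<close> is taken from the old one through
  \<open>Dot 0\<close>; \<open>c\<close> is a possible beginning of its values.\<close>

definition pieces :: "nat \<Rightarrow> nat \<Rightarrow> nat \<Rightarrow> (iword \<Rightarrow> iword) \<Rightarrow> (letter \<times> letter list \<times> letter list) set" where
  "pieces r k p h = dots r \<times> (SIGMA u:words_of_length n k. take_word p ` loc n h (Dot 0 # u) ` C)"

lemma loc_prepend:
  assumes "sync_map n D E f" "w \<in> nefin n D" "\<And>x. x \<in> C \<Longrightarrow> g (v \<frown> x) = a \<frown> loc n f w x"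
  shows "loc n g v = loc n f w"
proof -
  have s: "splits n f w" using splits_ne sync_mapD(2)[OF assms(1)] assms(2) by blast
  then have "splits n (loc n f w) []" using splits_loc[OF s, of "[]"] by simp
  then have "loc n g v = loc n (loc n f w) []"
    using gcpf_prepend(2)[of n "loc n f w" "[]" g v a] assms(3) by simp
  then show ?thesis using sync_map_loc_append[OF assms(1,2), of "[]"] by simp
qed

end

text \<open>The pieces of the cones \<open>d u\<close>, on which the image of the core map forced by \<open>u\<close> starts with a
  fixed word \<open>c\<close>, are moved to the cones of an arbitrary complete prefix code.\<close>

locale transplant = alphabet +
  fixes r r' k p :: nat and h :: "iword \<Rightarrow> iword" and E :: "letter list set"
    and \<iota> :: "letter \<times> letter list \<times> letter list \<Rightarrow> letter list"
  assumes r: "1 \<le> r" and r': "1 \<le> r'" and h: "h \<in> B_nr n r"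
    and ksync: "syncs n (dots r) h k"
    and kgcp: "\<And>w. w \<in> nefin n (dots r) \<Longrightarrow> k \<le> length w \<Longrightarrow> gcpf n h w \<noteq> []"
    and pclop: "\<And>q. q \<in> core_maps n (dots r) h \<Longrightarrow> clop (letters n) p (q ` C)"
    and E: "pcode (dots r') E"
    and \<iota>: "bij_betw \<iota> (pieces r' k p h) E"
begin

definition Q :: "letter list \<Rightarrow> iword \<Rightarrow> iword" where
  "Q u = loc n h (Dot 0 # u)"

text \<open>The core map forced by the letters after the first is applied to the tail, and the first
  \<open>p\<close> letters of its value, which single out the piece, are exchanged for the code word
  of that piece.\<close>

definition moved :: "iword \<Rightarrow> iword" where
  "moved = (\<lambda>x\<in>cantor_dot n r'. let z = Q (take_word k (drop_word 1 x)) (drop_word (Suc k) x)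
     in \<iota> (x 0, take_word k (drop_word 1 x), take_word p z) \<frown> drop_word p z)"

lemma hB: "bij_betw h (cantor_dot n r) (cantor_dot n r)" "sync_map n (dots r) (dots r) h"
    "sync_map n (dots r) (dots r) (binv r h)"
  using h unfolding B_nr_iff[OF r] by auto

lemma dot0: "Dot 0 \<in> dots r" and dot0': "Dot 0 \<in> dots r'"
  using r r' by (auto simp: dots_def)

lemma E_facts: "finite E" "e \<in> E \<Longrightarrow> e \<in> nefin n (dots r')"
  "x \<in> cantor_dot n r' \<Longrightarrow> \<exists>e\<in>E. take_word (length e) x = e"
  "e \<in> E \<Longrightarrow> e' \<in> E \<Longrightarrow> take_word (length e) x = e \<Longrightarrow> take_word (length e') x = e' \<Longrightarrow> e = e'"
  using E unfolding pcode_def cantor_dot_def by blast+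

lemma W: "u \<in> words_of_length n k \<longleftrightarrow> u \<in> L \<and> length u = k"
  by (simp add: words_of_length_def)

lemma Qu:
  assumes u: "u \<in> words_of_length n k"
  shows "Dot 0 # u \<in> nefin n (dots r)" "gcpf n h (Dot 0 # u) \<noteq> []" "Q u \<in> core_maps n (dots r) h"
    "sync_map n (letters n) (letters n) (Q u)" "clop (letters n) p (Q u ` C)"
    "x \<in> C \<Longrightarrow> Q u x \<in> C" "x \<in> C \<Longrightarrow> h ((Dot 0 # u) \<frown> x) = gcpf n h (Dot 0 # u) \<frown> Q u x"
proof -
  show 1: "Dot 0 # u \<in> nefin n (dots r)" using u dot0 by (simp add: W)
  then show "gcpf n h (Dot 0 # u) \<noteq> []" using u by (intro kgcp) (auto simp: W)
  show 3: "Q u \<in> core_maps n (dots r) h"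
    unfolding Q_def using u by (intro core_maps_forced(1)[OF hB(2) ksync dot0]) (auto simp: W)
  show 4: "sync_map n (letters n) (letters n) (Q u)" by (rule sync_map_core[OF hB(2) 3])
  show "clop (letters n) p (Q u ` C)" by (rule pclop[OF 3])
  show "x \<in> C \<Longrightarrow> Q u x \<in> C" using sync_mapD(1)[OF 4, of x] by simp
  show "x \<in> C \<Longrightarrow> h ((Dot 0 # u) \<frown> x) = gcpf n h (Dot 0 # u) \<frown> Q u x"
    unfolding Q_def by (rule sync_map_loc_eq[OF hB(2) 1])
qed

lemma dotE:
  assumes "x \<in> cantor_dot n r'"
  obtains d u y where "x = (d # u) \<frown> y" "d \<in> dots r'" "u \<in> words_of_length n k" "y \<in> C"
proof -
  obtain w y where w: "x = w \<frown> y" "w \<in> nefin n (dots r')" "length w = Suc k" "y \<in> C"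
    using inf_words_split[of x n "dots r'" "Suc k"] assms by (auto simp: cantor_dot_def)
  then obtain d u where "w = d # u" by (cases w) auto
  then show ?thesis using that[of d u y] w by (simp add: W)
qed

lemma dotI: "d \<in> dots r' \<Longrightarrow> u \<in> words_of_length n k \<Longrightarrow> y \<in> C \<Longrightarrow> (d # u) \<frown> y \<in> cantor_dot n r'"
  unfolding cantor_dot_def by (rule inf_words_appendI) (simp_all add: W)

lemma moved_eq:
  assumes "d \<in> dots r'" "u \<in> words_of_length n k" "y \<in> C"
  shows "moved ((d # u) \<frown> y) = \<iota> (d, u, take_word p (Q u y)) \<frown> drop_word p (Q u y)"
proof -
  let ?x = "(d # u) \<frown> y"
  have len: "length u = k" using assms(2) by (simp add: W)
  have 0: "?x 0 = d" by (simp add: append_word_def)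
  have "drop_word 1 ?x = u \<frown> y" using drop_word_append_le[of 1 "d # u" y] by simp
  then have 1: "take_word k (drop_word 1 ?x) = u" using take_word_append_word_eq[of u y] len by simp
  have 2: "drop_word (Suc k) ?x = y" using drop_word_append_word[of "d # u" y] len by simp
  show ?thesis
    unfolding moved_def using dotI[OF assms] 0 1 2 by (simp add: Let_def del: One_nat_def)
qed

lemma pieceI: "d \<in> dots r' \<Longrightarrow> u \<in> words_of_length n k \<Longrightarrow> y \<in> C \<Longrightarrow> (d, u, take_word p (Q u y)) \<in> pieces r' k p h"
  by (auto simp: pieces_def Q_def)

lemma piece_E: "P \<in> pieces r' k p h \<Longrightarrow> \<iota> P \<in> E"
  using \<iota> by (auto simp: bij_betw_def)

text \<open>The image of \<open>Q u\<close> is a union of cones of depth \<open>p\<close>; one value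
  beginning with \<open>c\<close> thus makes every point beginning with \<open>c\<close> a value.
  This is what makes \<open>moved\<close> surjective.\<close>

lemma piece_cover:
  assumes P: "(d, u, c) \<in> pieces r' k p h" and z: "z \<in> C"
  shows "\<exists>y\<in>C. Q u y = c \<frown> z" "length c = p" "c \<in> L" "d \<in> dots r'" "u \<in> words_of_length n k"
proof -
  show d: "d \<in> dots r'" and u: "u \<in> words_of_length n k" using P by (auto simp: pieces_def)
  obtain x where x: "x \<in> C" "c = take_word p (Q u x)" using P by (auto simp: pieces_def Q_def)
  show len: "length c = p" using x by simp
  show cL: "c \<in> L" using x take_cantor[OF Qu(6)[OF u]] by simp
  have "take_word p (Q u x) = take_word p (c \<frown> z)" using x len take_word_append_word_eq by metis
  moreover have "c \<frown> z \<in> inf_words n (letters n)" using cL z by simp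
  ultimately have "c \<frown> z \<in> Q u ` C" using Qu(5)[OF u] x(1) unfolding clop_def by blast
  then show "\<exists>y\<in>C. Q u y = c \<frown> z" by force
qed

lemma moved_preimage:
  assumes "y \<in> cantor_dot n r'"
  obtains d u c e z x where "(d, u, c) \<in> pieces r' k p h" "e = \<iota> (d, u, c)" "e \<in> E" "y = e \<frown> z" "z \<in> C"
    "x \<in> C" "Q u x = c \<frown> z" "moved ((d # u) \<frown> x) = y"
proof -
  obtain e where e: "e \<in> E" "take_word (length e) y = e" using E_facts(3)[OF assms] by blast
  let ?z = "drop_word (length e) y"
  have ez: "y = e \<frown> ?z" by (rule take_word_eqD[OF e(2)])
  have "e \<noteq> []" using E_facts(2)[OF e(1)] by auto
  then have z: "?z \<in> C" using ez assms inf_words_append[of e ?z n "dots r'"] by (simp add: cantor_dot_def)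
  obtain d u c where P: "(d, u, c) \<in> pieces r' k p h" "e = \<iota> (d, u, c)"
    using e(1) \<iota> unfolding bij_betw_def by (metis (no_types, lifting) imageE prod_cases3)
  note pc = piece_cover[OF P(1) z]
  obtain x where x: "x \<in> C" "Q u x = c \<frown> ?z" using pc(1) by blast
  have "moved ((d # u) \<frown> x) = y"
    unfolding moved_eq[OF pc(4,5) x(1)] x(2)
    using P(2) ez pc(2) take_word_append_word_eq[of c ?z] drop_word_append_word[of c ?z] by simp
  then show ?thesis using that P e(1) ez z x by blast
qed

text \<open>The code word at the start of a value determines the piece, hence the letters
  \<open>c\<close> that were exchanged; putting them back leaves a value of the injective
  \<open>Q u\<close>.\<close>

lemma moved_bij: "bij_betw moved (cantor_dot n r') (cantor_dot n r')"
proof (rule bij_betw_imageI)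
  have m: "moved x \<in> cantor_dot n r'" if x: "x \<in> cantor_dot n r'" for x
  proof -
    obtain d u y where y: "x = (d # u) \<frown> y" "d \<in> dots r'" "u \<in> words_of_length n k" "y \<in> C"
      using dotE[OF x] by blast
    show ?thesis
      unfolding y(1) moved_eq[OF y(2-4)] cantor_dot_def
      by (rule inf_words_appendI[OF E_facts(2)[OF piece_E[OF pieceI[OF y(2-4)]]] drop_cantor[OF Qu(6)[OF y(3,4)]]])
  qed
  show "moved ` cantor_dot n r' = cantor_dot n r'"
  proof (intro equalityI subsetI)
    fix y assume "y \<in> cantor_dot n r'"
    then obtain d u c z x where "(d, u, c) \<in> pieces r' k p h" "z \<in> C" "x \<in> C" "moved ((d # u) \<frown> x) = y"
      using moved_preimage by metis
    then show "y \<in> moved ` cantor_dot n r'"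
      using dotI piece_cover(4,5) by (metis image_eqI)
  qed (use m in blast)
  show "inj_on moved (cantor_dot n r')"
  proof (rule inj_onI)
    fix x1 x2 assume x1: "x1 \<in> cantor_dot n r'" and x2: "x2 \<in> cantor_dot n r'" and eq: "moved x1 = moved x2"
    obtain d1 u1 y1 where y1: "x1 = (d1 # u1) \<frown> y1" "d1 \<in> dots r'" "u1 \<in> words_of_length n k" "y1 \<in> C"
      using dotE[OF x1] by blast
    obtain d2 u2 y2 where y2: "x2 = (d2 # u2) \<frown> y2" "d2 \<in> dots r'" "u2 \<in> words_of_length n k" "y2 \<in> C"
      using dotE[OF x2] by blast
    let ?P1 = "(d1, u1, take_word p (Q u1 y1))" and ?P2 = "(d2, u2, take_word p (Q u2 y2))"
    have P: "?P1 \<in> pieces r' k p h" "?P2 \<in> pieces r' k p h" using pieceI y1 y2 by blast+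
    have m: "moved x1 = \<iota> ?P1 \<frown> drop_word p (Q u1 y1)" "moved x2 = \<iota> ?P2 \<frown> drop_word p (Q u2 y2)"
      using moved_eq y1 y2 by simp_all
    have "\<iota> ?P1 = \<iota> ?P2"
      by (rule E_facts(4)[OF piece_E[OF P(1)] piece_E[OF P(2)], of "moved x1"])
        (simp_all only: m(1), simp_all only: take_word_append_word_eq, simp only: m(1)[symmetric] eq m(2) take_word_append_word_eq)
    then have PP: "?P1 = ?P2" using \<iota> P by (auto simp: bij_betw_def inj_on_def)
    then have "drop_word p (Q u1 y1) = drop_word p (Q u2 y2)" using m eq by (metis append_word_cancel)
    then have "Q u1 y1 = Q u2 y2" using PP by (metis prod.inject take_drop_word)
    moreover have "inj_on (Q u1) C" using sync_mapD(2)[OF Qu(4)[OF y1(3)]] by simp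
    ultimately have "y1 = y2" using PP y1(4) y2(4) by (auto simp: inj_on_def)
    then show "x1 = x2" using PP y1(1) y2(1) by simp
  qed
qed

lemma moved_ucont: "ucont n (dots r') moved"
  unfolding ucont_def
proof
  fix l
  have "\<forall>u\<in>words_of_length n k. \<exists>m. \<forall>x\<in>C. \<forall>y\<in>C. take_word m x = take_word m y
      \<longrightarrow> take_word (p + l) (Q u x) = take_word (p + l) (Q u y)"
    using sync_mapD(3)[OF Qu(4)] unfolding ucont_def inf_words_letters by blast
  from bchoice[OF this] obtain m where m: "\<forall>u\<in>words_of_length n k. \<forall>x\<in>C. \<forall>y\<in>C.
      take_word (m u) x = take_word (m u) y \<longrightarrow> take_word (p + l) (Q u x) = take_word (p + l) (Q u y)" ..
  define M where "M = Suc k + Max (m ` words_of_length n k)"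
  have "take_word l (moved x1) = take_word l (moved x2)"
    if x1: "x1 \<in> cantor_dot n r'" and x2: "x2 \<in> cantor_dot n r'" and eq: "take_word M x1 = take_word M x2" for x1 x2
  proof -
    obtain d1 u1 y1 where y1: "x1 = (d1 # u1) \<frown> y1" "d1 \<in> dots r'" "u1 \<in> words_of_length n k" "y1 \<in> C"
      using dotE[OF x1] by blast
    obtain d2 u2 y2 where y2: "x2 = (d2 # u2) \<frown> y2" "d2 \<in> dots r'" "u2 \<in> words_of_length n k" "y2 \<in> C"
      using dotE[OF x2] by blast
    have len: "length (d1 # u1) = Suc k" "length (d2 # u2) = Suc k" using y1(3) y2(3) by (simp_all add: W)
    have e: "take_word M x1 = (d1 # u1) @ take_word (M - Suc k) y1" "take_word M x2 = (d2 # u2) @ take_word (M - Suc k) y2"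
      unfolding y1(1) y2(1) take_word_append_word using len by (simp_all add: M_def)
    then have du: "d1 # u1 = d2 # u2" "take_word (M - Suc k) y1 = take_word (M - Suc k) y2"
      using eq len by (metis append_eq_append_conv)+
    have "m u1 \<le> M - Suc k" using y1(3) by (simp add: M_def)
    then have "take_word (m u1) y1 = take_word (m u1) y2" using take_word_mono[OF du(2)] by blast
    then have pl: "take_word (p + l) (Q u1 y1) = take_word (p + l) (Q u1 y2)" using m y1(3,4) y2(4) by blast
    then have "take_word p (Q u1 y1) = take_word p (Q u1 y2)" using take_word_mono by (metis le_add1)
    moreover from pl this have "take_word l (drop_word p (Q u1 y1)) = take_word l (drop_word p (Q u1 y2))"
      by (simp add: take_word_add)
    then have "take_word j (drop_word p (Q u1 y1)) = take_word j (drop_word p (Q u1 y2))" if "j \<le> l" for j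
      using that take_word_mono by blast
    ultimately show ?thesis
      using moved_eq[OF y1(2-4)] moved_eq[OF y2(2-4)] y1(1) y2(1) du(1)
      by (simp add: take_word_append_word)
  qed
  then show "\<exists>m. \<forall>x\<in>inf_words n (dots r'). \<forall>y\<in>inf_words n (dots r').
      take_word m x = take_word m y \<longrightarrow> take_word l (moved x) = take_word l (moved y)"
    unfolding cantor_dot_def by blast
qed

text \<open>Once \<open>c\<close> is complete the exchange is over, and from then on
  \<open>moved\<close> runs like \<open>h\<close>. The bound is uniform in \<open>w\<close>, so
  synchronization and equality of the cores both follow.\<close>

lemma loc_moved:
  "\<exists>m. \<forall>w\<in>nefin n (dots r'). \<forall>t\<in>L. m \<le> length t \<longrightarrow> loc n moved (w @ t) = loc n h ([Dot 0] @ t)"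
proof -
  have "\<forall>u\<in>words_of_length n k. \<exists>m. \<forall>v\<in>nefin n (letters n). m \<le> length v \<longrightarrow> p \<le> length (gcpf n (Q u) v)"
    using ucont_gcpf[OF sync_mapD(3,2)[OF Qu(4)]] by blast
  from bchoice[OF this] obtain m where m: "\<forall>u\<in>words_of_length n k. \<forall>v\<in>nefin n (letters n).
      m u \<le> length v \<longrightarrow> p \<le> length (gcpf n (Q u) v)" ..
  define M where "M = Suc (Max (m ` words_of_length n k))"
  have A: "loc n moved (d # u @ v) = loc n h (Dot 0 # u @ v)"
    if d: "d \<in> dots r'" and u: "u \<in> words_of_length n k" and v: "v \<in> L" "M \<le> length v" for d u v
  proof -
    have vn: "v \<in> nefin n (letters n)" using v by (auto simp: M_def)
    have "m u \<le> Max (m ` words_of_length n k)" using u by simp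
    then have "m u \<le> length v" using v(2) by (simp add: M_def)
    then have g: "p \<le> length (gcpf n (Q u) v)" using m u vn by blast
    let ?g = "gcpf n (Q u) v"
    have "moved ((d # u @ v) \<frown> x) = (\<iota> (d, u, take p ?g) @ drop p ?g) \<frown> loc n (Q u) v x" if x: "x \<in> C" for x
    proof -
      have q: "Q u (v \<frown> x) = ?g \<frown> loc n (Q u) v x" by (rule sync_map_loc_eq[OF Qu(4)[OF u] vn x])
      have t: "take_word p (Q u (v \<frown> x)) = take p ?g" "drop_word p (Q u (v \<frown> x)) = drop p ?g \<frown> loc n (Q u) v x"
        unfolding q using g by (simp_all add: take_word_append_word drop_word_append_le)
      have "moved ((d # u) \<frown> (v \<frown> x)) = \<iota> (d, u, take_word p (Q u (v \<frown> x))) \<frown> drop_word p (Q u (v \<frown> x))"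
        by (rule moved_eq[OF d u]) (use v x in simp)
      then show ?thesis unfolding t by (simp flip: append_word_append)
    qed
    then have "loc n moved (d # u @ v) = loc n (Q u) v" by (rule loc_prepend[OF Qu(4)[OF u] vn])
    also have "\<dots> = loc n h ((Dot 0 # u) @ v)"
      unfolding Q_def using sync_map_loc_append[OF hB(2) Qu(1)[OF u] v(1)] by simp
    finally show ?thesis by simp
  qed
  have "loc n moved (w @ t) = loc n h ([Dot 0] @ t)"
    if w: "w \<in> nefin n (dots r')" and t: "t \<in> L" "k + M \<le> length t" for w t
  proof -
    obtain d w' where dw: "w = d # w'" "d \<in> dots r'" "w' \<in> L" using nefinE[OF w] by blast
    define u where "u = take k (w' @ t)"
    define v where "v = drop k (w' @ t)"
    have uv: "w' @ t = u @ v" unfolding u_def v_def by (rule append_take_drop_id[symmetric])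
    have L': "u \<in> L" "v \<in> L" using dw(3) t(1) uv by (metis append_in_lists_conv)+
    have len: "length u = k" "M \<le> length v" using t(2) by (auto simp: u_def v_def)
    have "loc n moved (d # u @ v) = loc n h (Dot 0 # u @ v)" by (rule A) (use dw L' len in \<open>simp_all add: W\<close>)
    then have "loc n moved (w @ t) = loc n h ((Dot 0 # w') @ t)" using dw(1) uv by simp
    also have "\<dots> = loc n h ([Dot 0] @ t)"
      by (rule syncsD[OF ksync]) (use dw dot0 t in auto)
    finally show ?thesis .
  qed
  then show ?thesis by blast
qed

lemma moved_syncs: "\<exists>k. syncs n (dots r') moved k"
proof -
  obtain m where "\<forall>w\<in>nefin n (dots r'). \<forall>t\<in>L. m \<le> length t \<longrightarrow> loc n moved (w @ t) = loc n h ([Dot 0] @ t)"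
    using loc_moved by blast
  then have "syncs n (dots r') moved m" unfolding syncs_def by simp
  then show ?thesis by blast
qed

lemma core_maps_moved: "core_maps n (dots r') moved = core_maps n (dots r) h"
proof -
  obtain m where m: "\<forall>w\<in>nefin n (dots r'). \<forall>t\<in>L. m \<le> length t \<longrightarrow> loc n moved (w @ t) = loc n h ([Dot 0] @ t)"
    using loc_moved by blast
  show ?thesis
  proof (rule core_maps_eqI[OF moved_syncs sync_mapD(4)[OF hB(2)], where w = "[Dot 0]" and v = "[Dot 0]" and m = m])
    show 1: "[Dot 0] \<in> nefin n (dots r')" using dot0' by simp
    show "[Dot 0] \<in> nefin n (dots r)" using dot0 by simp
    show "loc n moved ([Dot 0] @ u) = loc n h ([Dot 0] @ u)" if "u \<in> L" "m \<le> length u" for u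
      using m 1 that by blast
  qed
qed

lemma moved_sync_map: "sync_map n (dots r') (dots r') moved"
  unfolding sync_map_def using moved_bij moved_ucont moved_syncs by (auto simp: bij_betw_def cantor_dot_def)

text \<open>To invert, exchange the code word for \<open>c\<close>, put back what \<open>h\<close>
  had written on \<open>Dot 0 # u\<close>, apply the inverse of \<open>h\<close>, and replace
  \<open>Dot 0\<close> by \<open>d\<close>. Continuity and synchronization of the new inverse are
  thereby inherited from the old one.\<close>

lemma binv_moved:
  assumes P: "(d, u, c) \<in> pieces r' k p h" and z: "z \<in> C"
  shows "binv r' moved (\<iota> (d, u, c) \<frown> z) = [d] \<frown> drop_word 1 (binv r h ((gcpf n h (Dot 0 # u) @ c) \<frown> z))"
proof -
  note pc = piece_cover[OF P z]
  obtain x where x: "x \<in> C" "Q u x = c \<frown> z" using pc(1) by blast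
  have m: "moved ((d # u) \<frown> x) = \<iota> (d, u, c) \<frown> z"
    unfolding moved_eq[OF pc(4,5) x(1)] x(2)
    using pc(2) take_word_append_word_eq[of c z] drop_word_append_word[of c z] by simp
  have in1: "\<iota> (d, u, c) \<frown> z \<in> cantor_dot n r'"
    unfolding cantor_dot_def by (rule inf_words_appendI[OF E_facts(2)[OF piece_E[OF P]] z])
  have 1: "binv r' moved (\<iota> (d, u, c) \<frown> z) = (d # u) \<frown> x"
    using bij_betw_inv_into_left[OF moved_bij dotI[OF pc(4,5) x(1)]] m in1 by simp
  have hx: "h ((Dot 0 # u) \<frown> x) = (gcpf n h (Dot 0 # u) @ c) \<frown> z"
    using Qu(7)[OF pc(5) x(1)] x(2) by simp
  have dx: "(Dot 0 # u) \<frown> x \<in> cantor_dot n r"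
    unfolding cantor_dot_def by (rule inf_words_appendI[OF Qu(1)[OF pc(5)] x(1)])
  then have "binv r h ((gcpf n h (Dot 0 # u) @ c) \<frown> z) = (Dot 0 # u) \<frown> x"
    using bij_betw_inv_into_left[OF hB(1) dx] bij_betw_apply[OF hB(1) dx] hx by simp
  then have "drop_word 1 (binv r h ((gcpf n h (Dot 0 # u) @ c) \<frown> z)) = u \<frown> x"
    using drop_word_append_le[of 1 "Dot 0 # u" x] by simp
  then show ?thesis using 1 by (simp flip: append_word_append)
qed

definition maxE :: nat where "maxE = Max (length ` E)"

lemma maxE: "e \<in> E \<Longrightarrow> length e \<le> maxE"
  unfolding maxE_def using E_facts(1) by simp

lemma binv_moved_ucont: "ucont n (dots r') (binv r' moved)"
  unfolding ucont_def
proof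
  fix l
  \<comment> \<open>\<open>Suc l\<close>, because the first letter of the value is dropped
    afterwards.\<close>
  obtain m where m: "\<forall>x\<in>inf_words n (dots r). \<forall>y\<in>inf_words n (dots r). take_word m x = take_word m y
      \<longrightarrow> take_word (Suc l) (binv r h x) = take_word (Suc l) (binv r h y)"
    using sync_mapD(3)[OF hB(3)] unfolding ucont_def by blast
  have "take_word l (binv r' moved y1) = take_word l (binv r' moved y2)"
    if y1: "y1 \<in> cantor_dot n r'" and y2: "y2 \<in> cantor_dot n r'"
      and eq: "take_word (maxE + m) y1 = take_word (maxE + m) y2" for y1 y2
  proof -
    obtain d u c e z where z: "(d, u, c) \<in> pieces r' k p h" "e = \<iota> (d, u, c)" "e \<in> E" "y1 = e \<frown> z" "z \<in> C"
      using moved_preimage[OF y1] by metis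
    have le: "length e \<le> maxE" by (rule maxE[OF z(3)])
    have "take_word (length e) y2 = e"
      using take_word_mono[OF eq, of "length e"] le z(4) by simp
    then have y2e: "y2 = e \<frown> drop_word (length e) y2" by (rule take_word_eqD)
    let ?z2 = "drop_word (length e) y2"
    have "e \<noteq> []" using E_facts(2)[OF z(3)] by auto
    then have z2: "?z2 \<in> C" using y2 y2e inf_words_append[of e ?z2 n "dots r'"] by (simp add: cantor_dot_def)
    have "take_word (length e + m) y1 = take_word (length e + m) y2"
      by (rule take_word_mono[OF eq]) (use le in simp)
    then have zm: "take_word m z = take_word m ?z2" using z(4) by (simp add: take_word_add)
    note pc = piece_cover[OF z(1,5)]
    let ?a = "gcpf n h (Dot 0 # u) @ c"
    have a: "?a \<in> nefin n (dots r)"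
      using gcpf_fin_words[OF hB(2) Qu(1)[OF pc(5)]] Qu(2)[OF pc(5)] pc(3)
      by (intro nefin_append) (auto simp: nefin_iff)
    have "take_word m (?a \<frown> z) = take_word m (?a \<frown> ?z2)"
      using take_word_mono[OF zm] unfolding take_word_append_word[of m ?a] by simp
    then have "take_word (Suc l) (binv r h (?a \<frown> z)) = take_word (Suc l) (binv r h (?a \<frown> ?z2))"
      using m inf_words_appendI[OF a z(5)] inf_words_appendI[OF a z2] by blast
    then have "take_word l (drop_word 1 (binv r h (?a \<frown> z))) = take_word l (drop_word 1 (binv r h (?a \<frown> ?z2)))"
      using take_word_add[of 1 l] by simp
    then have "take_word (l - 1) (drop_word 1 (binv r h (?a \<frown> z))) = take_word (l - 1) (drop_word 1 (binv r h (?a \<frown> ?z2)))"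
      using take_word_mono by (meson diff_le_self)
    moreover have "binv r' moved y1 = [d] \<frown> drop_word 1 (binv r h (?a \<frown> z))"
      using binv_moved[OF z(1,5)] unfolding z(4) z(2) .
    moreover have "binv r' moved y2 = [d] \<frown> drop_word 1 (binv r h (?a \<frown> ?z2))"
      using binv_moved[OF z(1) z2] y2e z(2) by metis
    ultimately show ?thesis
      by (simp only: take_word_append_word list.size One_nat_def add_0 plus_1_eq_Suc)
  qed
  then show "\<exists>m. \<forall>x\<in>inf_words n (dots r'). \<forall>y\<in>inf_words n (dots r').
      take_word m x = take_word m y \<longrightarrow> take_word l (binv r' moved x) = take_word l (binv r' moved y)"
    unfolding cantor_dot_def by blast
qed

text \<open>The first \<open>maxE\<close> letters of \<open>t\<close> are given up: they complete
  whatever code word the input begins with, so the letters behind them are read as by the inverse of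
  \<open>h\<close>.\<close>

lemma binv_moved_syncs: "\<exists>k. syncs n (dots r') (binv r' moved) k"
proof -
  obtain k2 where k2: "syncs n (dots r) (binv r h) k2" using sync_mapD(4)[OF hB(3)] by blast
  \<comment> \<open>The first letter, which is going to be dropped, has to lie in the prefix already
    written.\<close>
  obtain m where m: "\<And>w. w \<in> nefin n (dots r) \<Longrightarrow> m \<le> length w \<Longrightarrow> 1 \<le> length (gcpf n (binv r h) w)"
    using ucont_gcpf[OF sync_mapD(3,2)[OF hB(3)]] by meson
  have "loc n (binv r' moved) (w @ t) = loc n (binv r h) ([Dot 0] @ drop maxE t)"
    if w: "w \<in> nefin n (dots r')" and t: "t \<in> L" "maxE + k2 + m \<le> length t" for w t
  proof -
    have wt: "w @ t \<in> nefin n (dots r')" by (rule nefin_append[OF w t(1)])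
    have "(w @ t) \<frown> (\<lambda>_. Lt 0) \<in> cantor_dot n r'"
      unfolding cantor_dot_def by (rule inf_words_appendI[OF wt zeros_C])
    then obtain e where e: "e \<in> E" "take_word (length e) ((w @ t) \<frown> (\<lambda>_. Lt 0)) = e"
      using E_facts(3) by blast
    have le: "length e \<le> maxE" by (rule maxE[OF e(1)])
    have "e = take (length e) (w @ t)"
      using e(2) le t(2) by (simp add: take_word_append_word del: append_word_append take_append)
    then have ev: "w @ t = e @ drop (length e) (w @ t)" by (metis append_take_drop_id)
    define v where "v = drop (length e) (w @ t)"
    define v1 where "v1 = drop (length e) (w @ take maxE t)"
    define t2 where "t2 = drop maxE t"
    have "w @ t = (w @ take maxE t) @ t2" by (simp add: t2_def)
    then have "v = drop (length e) ((w @ take maxE t) @ t2)" unfolding v_def by (rule arg_cong)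
    moreover have "length e \<le> length (w @ take maxE t)" using le t(2) by simp
    ultimately have vv: "v = v1 @ t2" unfolding v1_def drop_append[of _ "w @ take maxE t" t2] by simp
    have "e \<noteq> []" using E_facts(2)[OF e(1)] by auto
    then have vL: "v \<in> L" using wt ev append_fin_words[of e v n "dots r'"] by (simp add: v_def nefin_iff)
    then have L': "v1 \<in> L" "t2 \<in> L" unfolding vv by simp_all
    obtain d u c where P: "(d, u, c) \<in> pieces r' k p h" "e = \<iota> (d, u, c)"
      using e(1) \<iota> unfolding bij_betw_def by (metis (no_types, lifting) imageE prod_cases3)
    note pc = piece_cover[OF P(1) zeros_C]
    let ?a = "gcpf n h (Dot 0 # u) @ c"
    have a: "?a \<in> nefin n (dots r)"
      using gcpf_fin_words[OF hB(2) Qu(1)[OF pc(5)]] Qu(2)[OF pc(5)] pc(3)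
      by (intro nefin_append) (auto simp: nefin_iff)
    have av: "?a @ v \<in> nefin n (dots r)" by (rule nefin_append[OF a vL])
    let ?g = "gcpf n (binv r h) (?a @ v)"
    have "length t2 \<ge> k2 + m" using t(2) by (simp add: t2_def)
    then have g: "1 \<le> length ?g" using m[OF av] vv by simp
    have "binv r' moved ((e @ v) \<frown> x) = ([d] @ drop 1 ?g) \<frown> loc n (binv r h) (?a @ v) x" if x: "x \<in> C" for x
    proof -
      have "v \<frown> x \<in> C" using vL x by simp
      from binv_moved[OF P(1) this]
      have "binv r' moved ((e @ v) \<frown> x) = [d] \<frown> drop_word 1 (binv r h ((?a @ v) \<frown> x))"
        by (simp only: P(2) append_word_append)
      also have "binv r h ((?a @ v) \<frown> x) = ?g \<frown> loc n (binv r h) (?a @ v) x"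
        by (rule sync_map_loc_eq[OF hB(3) av x])
      also have "drop_word 1 \<dots> = drop 1 ?g \<frown> loc n (binv r h) (?a @ v) x"
        by (rule drop_word_append_le[OF g])
      finally show ?thesis by (simp only: append_word_append)
    qed
    then have "loc n (binv r' moved) (e @ v) = loc n (binv r h) (?a @ v)"
      by (rule loc_prepend[OF hB(3) av])
    also have "?a @ v = (?a @ v1) @ t2" using vv by simp
    also have "loc n (binv r h) \<dots> = loc n (binv r h) ([Dot 0] @ t2)"
      by (rule syncsD[OF k2 nefin_append[OF a L'(1)] _ L'(2)]) (use dot0 t(2) in \<open>simp_all add: t2_def\<close>)
    finally have "loc n (binv r' moved) (e @ v) = loc n (binv r h) ([Dot 0] @ t2)" .
    moreover have "w @ t = e @ v" unfolding v_def by (rule ev)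
    ultimately show ?thesis by (simp only: t2_def)
  qed
  then have "syncs n (dots r') (binv r' moved) (maxE + k2 + m)" unfolding syncs_def by simp
  then show ?thesis by blast
qed

lemma moved_B: "moved \<in> B_nr n r'"
proof -
  have "bij_betw (binv r' moved) (cantor_dot n r') (cantor_dot n r')" by (rule bij_binv[OF moved_bij])
  then have "sync_map n (dots r') (dots r') (binv r' moved)"
    unfolding sync_map_def using binv_moved_ucont binv_moved_syncs by (auto simp: bij_betw_def cantor_dot_def)
  then show ?thesis
    unfolding B_nr_iff[OF r'] using moved_bij moved_sync_map by (simp add: moved_def)
qed

end

section \<open>Counting pieces and choosing the prefix code\<close>

context alphabet
begin

text \<open>Modulo n - 1 there are r' n^k s pieces, hence r', and at least r' because each dotted
  letter contributes one; so a code of the same size exists. The bijection is left open: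
  \<open>ex_core_B\<close> takes any, \<open>ex_core_TB\<close> one that follows the order.\<close>

lemma ex_transplant:
  assumes r: "1 \<le> r" and h: "h \<in> B_nr n r" and s: "sig (core_maps n (dots r) h) s"
    and r': "1 \<le> r'" "[r' * s = r'] (mod (n - 1))"
  obtains k p E where "\<And>\<iota>. bij_betw \<iota> (pieces r' k p h) E \<Longrightarrow> transplant n r r' k p h E \<iota>"
    "finite (pieces r' k p h)" "finite E" "card (pieces r' k p h) = card E"
proof -
  have f: "sync_map n (dots r) (dots r) h" using h unfolding B_nr_iff[OF r] by auto
  have d: "Dot 0 \<in> dots r" using r by (auto simp: dots_def)
  obtain k1 where k1: "syncs n (dots r) h k1" using sync_mapD(4)[OF f] by blast
  obtain k2 where k2: "\<And>w. w \<in> nefin n (dots r) \<Longrightarrow> k2 \<le> length w \<Longrightarrow> 1 \<le> length (gcpf n h w)"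
    using ucont_gcpf[OF sync_mapD(3,2)[OF f]] by meson
  define k where "k = max k1 k2"
  have ks: "syncs n (dots r) h k" unfolding syncs_def k_def by (intro ballI impI syncsD[OF k1]) simp_all
  have kg: "gcpf n h w \<noteq> []" if "w \<in> nefin n (dots r)" "k \<le> length w" for w
    using k2[OF that(1)] that(2) by (fastforce simp: k_def)
  obtain p where p: "\<And>q. q \<in> core_maps n (dots r) h \<Longrightarrow> clop (letters n) p (q ` C)"
    using core_maps_clop[OF r h] by blast
  let ?Q = "\<lambda>u. loc n h (Dot 0 # u)"
  have Q: "?Q u \<in> core_maps n (dots r) h" if "u \<in> words_of_length n k" for u
    using that by (intro core_maps_forced(1)[OF f ks d]) (auto simp: words_of_length_def)
  have fin: "finite (take_word p ` ?Q u ` C)" if "u \<in> words_of_length n k" for u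
    using p[OF Q[OF that]] by (intro finite_take[of "letters n"]) (auto simp: clop_def)
  have finP: "finite (pieces r' k p h)" unfolding pieces_def using fin by auto
  have card: "card (pieces r' k p h) = r' * (\<Sum>u\<in>words_of_length n k. cnt p (?Q u ` C))"
    unfolding pieces_def cnt_def using fin by (simp add: card_cartesian_product card_SigmaI)
  have "[(\<Sum>u\<in>words_of_length n k. cnt p (?Q u ` C)) = (\<Sum>u\<in>words_of_length n k. s)] (mod (n - 1))"
    by (rule cong_sum) (rule sigD[OF s Q p[OF Q]])
  then have "[card (pieces r' k p h) = r' * (n ^ k * s)] (mod (n - 1))"
    unfolding card by (intro cong_scalar_left) (simp add: card_words_of_length)
  moreover have "[(r' * s) * n ^ k = (r' * s) * 1] (mod (n - 1))" by (rule cong_scalar_left[OF pow_cong_1])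
  ultimately have "[card (pieces r' k p h) = r'] (mod (n - 1))"
    using r'(2) by (metis cong_trans mult.assoc mult.commute mult.right_neutral)
  moreover have "r' \<le> card (pieces r' k p h)"
  proof -
    have "replicate k (Lt 0) \<in> words_of_length n k" by (simp add: words_of_length_def del: in_lists_conv_set set_replicate_conv_if)
    then have u0: "replicate k (Lt 0) \<in> words_of_length n k" (is "?u \<in> _") .
    have "take_word p ` ?Q ?u ` C \<noteq> {}" using zeros_C by blast
    then have "0 < cnt p (?Q ?u ` C)" unfolding cnt_def card_gt_0_iff using fin[OF u0] by blast
    also have "cnt p (?Q ?u ` C) \<le> (\<Sum>u\<in>words_of_length n k. cnt p (?Q u ` C))"
      by (rule member_le_sum[OF u0]) simp_all
    finally have "1 \<le> (\<Sum>u\<in>words_of_length n k. cnt p (?Q u ` C))" by simp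
    then show ?thesis unfolding card by simp
  qed
  ultimately obtain E where E: "pcode (dots r') E" "card E = card (pieces r' k p h)"
    using ex_pcode[OF r'(1)] by blast
  show ?thesis
  proof (rule that[of k p E])
    fix \<iota> assume "bij_betw \<iota> (pieces r' k p h) E"
    then show "transplant n r r' k p h E \<iota>"
      by unfold_locales (use r r' h ks kg p E in auto)
  qed (use finP E in \<open>auto simp: pcode_def\<close>)
qed

lemma ex_core_B:
  assumes "1 \<le> r" "h \<in> B_nr n r" "sig (core_maps n (dots r) h) s" "1 \<le> r'" "[r' * s = r'] (mod (n - 1))"
  shows "\<exists>g\<in>B_nr n r'. core_maps n (dots r') g = core_maps n (dots r) h"
proof -
  obtain k p E where T: "\<And>\<iota>. bij_betw \<iota> (pieces r' k p h) E \<Longrightarrow> transplant n r r' k p h E \<iota>"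
    "finite (pieces r' k p h)" "finite E" "card (pieces r' k p h) = card E"
    using ex_transplant[OF assms] by blast
  obtain \<iota> where "bij_betw \<iota> (pieces r' k p h) E" using finite_same_card_bij[OF T(2-4)] by blast
  then interpret transplant n r r' k p h E \<iota> by (rule T(1))
  show ?thesis using moved_B core_maps_moved by blast
qed

end

section \<open>Order-preserving cores\<close>

fun letter_val :: "letter \<Rightarrow> nat" where
  "letter_val (Lt a) = a"
| "letter_val (Dot a) = a"

definition lx :: "iword \<Rightarrow> iword \<Rightarrow> bool" where
  "lx x y \<longleftrightarrow> (\<exists>k. (\<forall>j<k. x j = y j) \<and> letter_val (x k) < letter_val (y k))"

text \<open>The flag selects the order or its reverse, so that increasing and decreasing maps share
  one argument.\<close>

definition lxs :: "bool \<Rightarrow> iword \<Rightarrow> iword \<Rightarrow> bool" where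
  "lxs s x y = (if s then lx x y else lx y x)"

text \<open>The two expansions of one point, the lower one first. Comparing values of letters covers
  a change in a plain letter and in the dotted one alike.\<close>

definition twin :: "nat \<Rightarrow> iword \<Rightarrow> iword \<Rightarrow> bool" where
  "twin n x y \<longleftrightarrow> (\<exists>m. (\<forall>j<m. x j = y j) \<and> letter_val (y m) = Suc (letter_val (x m))
     \<and> (\<forall>j>m. x j = Lt (n - 1) \<and> y j = Lt 0))"

lemma lx_irrefl [simp]: "\<not> lx x x"
  by (auto simp: lx_def)

lemma lx_trans:
  assumes "lx x y" "lx y z" shows "lx x z"
proof -
  obtain k where k: "\<forall>j<k. x j = y j" "letter_val (x k) < letter_val (y k)" using assms(1) by (auto simp: lx_def)
  obtain l where l: "\<forall>j<l. y j = z j" "letter_val (y l) < letter_val (z l)" using assms(2) by (auto simp: lx_def)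
  show ?thesis
    unfolding lx_def
  proof (intro exI[of _ "min k l"] conjI allI impI)
    fix j assume "j < min k l" then show "x j = z j" using k l by simp
  next
    show "letter_val (x (min k l)) < letter_val (z (min k l))"
      using k l by (cases k l rule: linorder_cases) (auto simp: min_def)
  qed
qed

lemma lx_asym: "lx x y \<Longrightarrow> \<not> lx y x"
  using lx_trans lx_irrefl by blast

lemma lxs_irrefl [simp]: "\<not> lxs s x x"
  by (simp add: lxs_def)

lemma lxs_trans: "lxs s x y \<Longrightarrow> lxs s y z \<Longrightarrow> lxs s x z"
  unfolding lxs_def using lx_trans by (auto split: if_splits)

lemma lxs_asym: "lxs s x y \<Longrightarrow> \<not> lxs s y x"
  unfolding lxs_def using lx_asym by (auto split: if_splits)

lemma lxs_not: "lxs (\<not> s) x y = lxs s y x"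
  by (simp add: lxs_def)

lemma lx_append [simp]: "lx (w \<frown> x) (w \<frown> y) \<longleftrightarrow> lx x y"
proof
  assume "lx (w \<frown> x) (w \<frown> y)"
  then obtain k where k: "\<forall>j<k. (w \<frown> x) j = (w \<frown> y) j" "letter_val ((w \<frown> x) k) < letter_val ((w \<frown> y) k)"
    by (auto simp: lx_def)
  have "k \<ge> length w" using k(2) by (auto simp: append_word_def split: if_splits)
  moreover have "x j = y j" if "j < k - length w" for j
    using k(1)[rule_format, of "length w + j"] that by (simp add: append_word_def)
  ultimately show "lx x y"
    using k(2) unfolding lx_def by (intro exI[of _ "k - length w"]) (auto simp: append_word_def)
next
  assume "lx x y"
  then obtain k where k: "\<forall>j<k. x j = y j" "letter_val (x k) < letter_val (y k)" by (auto simp: lx_def)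
  show "lx (w \<frown> x) (w \<frown> y)"
    unfolding lx_def using k by (intro exI[of _ "length w + k"]) (auto simp: append_word_def)
qed

lemma lxs_append [simp]: "lxs s (w \<frown> x) (w \<frown> y) \<longleftrightarrow> lxs s x y"
  by (simp add: lxs_def)

lemma lx_take:
  assumes "lx x y" "take_word m x \<noteq> take_word m y" "take_word m x' = take_word m x" "take_word m y' = take_word m y"
  shows "lx x' y'"
proof -
  obtain k where k: "\<forall>j<k. x j = y j" "letter_val (x k) < letter_val (y k)" using assms(1) by (auto simp: lx_def)
  have "k < m" using assms(2) k(1) by (auto simp: take_word_eq_iff) (metis less_trans linorder_neqE_nat)
  then show ?thesis
    unfolding lx_def using k assms(3,4) by (intro exI[of _ k]) (auto simp: take_word_eq_iff)
qed

lemma lxs_take: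
  assumes "lxs s x y" "take_word m x \<noteq> take_word m y" "take_word m x' = take_word m x" "take_word m y' = take_word m y"
  shows "lxs s x' y'"
  using assms(1) lx_take[OF _ assms(2-4)] lx_take[OF _ assms(2)[symmetric] assms(4,3)]
  by (cases s) (simp_all add: lxs_def)

text \<open>Convexity of cones: a point outside a cone lies on the same side of all its points, by
  \<open>lx_take\<close>.\<close>

lemma lx_between:
  assumes "lx x y" "lx y z" "take_word m x = take_word m z" shows "take_word m y = take_word m x"
proof (rule ccontr)
  assume ne: "take_word m y \<noteq> take_word m x"
  have "lx z y" by (rule lx_take[OF assms(1), of m]) (use ne assms(3) in simp_all)
  then show False using assms(2) lx_asym by blast
qed

lemma lxs_between:
  assumes "lxs s x y" "lxs s y z" "take_word m x = take_word m z" shows "take_word m y = take_word m x"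
proof (cases s)
  case True
  then have "lx x y" "lx y z" using assms(1,2) by (simp_all add: lxs_def)
  then show ?thesis using lx_between assms(3) by blast
next
  case False
  then have "lx z y" "lx y x" using assms(1,2) by (simp_all add: lxs_def)
  then have "take_word m y = take_word m z" using lx_between assms(3)[symmetric] by blast
  then show ?thesis using assms(3) by (rule trans[OF _ sym])
qed

lemma inj_letter_val [simp]: "inj_on letter_val (letters n)" "inj_on letter_val (dots n)"
  by (auto simp: inj_on_def letters_def dots_def)

lemma lx_total:
  assumes x: "x \<in> inf_words n D" and y: "y \<in> inf_words n D" and D: "inj_on letter_val D" and ne: "x \<noteq> y"
  shows "lx x y \<or> lx y x"
proof -
  define k where "k = (LEAST k. x k \<noteq> y k)"
  have ex: "\<exists>k. x k \<noteq> y k" using ne by auto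
  have k: "x k \<noteq> y k" unfolding k_def by (rule LeastI_ex[OF ex])
  have kl: "x j = y j" if "j < k" for j using not_less_Least[OF that[unfolded k_def]] by blast
  have "letter_val (x k) \<noteq> letter_val (y k)"
  proof (cases k)
    case 0
    then have "x k \<in> D" "y k \<in> D" using x y by (simp_all add: inf_words_def)
    then show ?thesis using k inj_on_eq_iff[OF D] by blast
  next
    case (Suc j)
    then have "x k \<in> letters n" "y k \<in> letters n" using x y by (simp_all add: inf_words_def)
    then show ?thesis using k inj_on_eq_iff[OF inj_letter_val(1)] by blast
  qed
  then have "letter_val (x k) < letter_val (y k) \<or> letter_val (y k) < letter_val (x k)" by linarith
  moreover have "\<forall>j<k. x j = y j" "\<forall>j<k. y j = x j" using kl by simp_all
  ultimately show ?thesis unfolding lx_def by blast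
qed

lemma lxs_total:
  assumes "x \<in> inf_words n D" "y \<in> inf_words n D" "inj_on letter_val D" "x \<noteq> y"
  shows "lxs s x y \<or> lxs s y x"
  using lx_total[OF assms] by (auto simp: lxs_def)

text \<open>Elements are matched by rank, the number of smaller elements, which enumerates each
  finite linear order from 0 on.\<close>

lemma finite_order_iso:
  fixes lt1 :: "'a \<Rightarrow> 'a \<Rightarrow> bool" and lt2 :: "'b \<Rightarrow> 'b \<Rightarrow> bool"
  assumes fin: "finite A" "finite B" "card A = card B"
    and A: "\<And>x. \<not> lt1 x x" "\<And>x y z. lt1 x y \<Longrightarrow> lt1 y z \<Longrightarrow> lt1 x z"
      "\<And>x y. x \<in> A \<Longrightarrow> y \<in> A \<Longrightarrow> x \<noteq> y \<Longrightarrow> lt1 x y \<or> lt1 y x"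
    and B: "\<And>x. \<not> lt2 x x" "\<And>x y z. lt2 x y \<Longrightarrow> lt2 y z \<Longrightarrow> lt2 x z"
      "\<And>x y. x \<in> B \<Longrightarrow> y \<in> B \<Longrightarrow> x \<noteq> y \<Longrightarrow> lt2 x y \<or> lt2 y x"
  obtains f where "bij_betw f A B" "\<And>x y. x \<in> A \<Longrightarrow> y \<in> A \<Longrightarrow> lt1 x y \<Longrightarrow> lt2 (f x) (f y)"
proof -
  have rank: "bij_betw (\<lambda>a. card {x \<in> S. lt x a}) S {..<card S} \<and>
      (\<forall>x\<in>S. \<forall>y\<in>S. lt x y \<longrightarrow> card {z \<in> S. lt z x} < card {z \<in> S. lt z y})"
    if S: "finite S" and irr: "\<And>x. \<not> lt x x" and tr: "\<And>x y z. lt x y \<Longrightarrow> lt y z \<Longrightarrow> lt x z"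
      and tot: "\<And>x y. x \<in> S \<Longrightarrow> y \<in> S \<Longrightarrow> x \<noteq> y \<Longrightarrow> lt x y \<or> lt y x"
    for S :: "'c set" and lt
  proof -
    let ?r = "\<lambda>a. card {x \<in> S. lt x a}"
    have mono: "?r x < ?r y" if "x \<in> S" "y \<in> S" "lt x y" for x y
    proof (rule psubset_card_mono)
      have "x \<in> {z \<in> S. lt z y}" "x \<notin> {z \<in> S. lt z x}" using that irr by auto
      moreover have "{z \<in> S. lt z x} \<subseteq> {z \<in> S. lt z y}" using tr that(3) by blast
      ultimately show "{z \<in> S. lt z x} \<subset> {z \<in> S. lt z y}" by blast
    qed (use S in simp)
    have inj: "inj_on ?r S"
    proof (rule inj_onI)
      fix x y assume "x \<in> S" "y \<in> S" "?r x = ?r y"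
      then show "x = y" using mono[of x y] mono[of y x] tot[of x y] by linarith
    qed
    have "?r a < card S" if "a \<in> S" for a
      by (rule psubset_card_mono) (use S irr that in auto)
    then have "?r ` S \<subseteq> {..<card S}" by auto
    moreover have "card (?r ` S) = card {..<card S}" using card_image[OF inj] by simp
    ultimately have "?r ` S = {..<card S}" by (intro card_subset_eq) auto
    then show ?thesis using inj mono by (simp add: bij_betw_def)
  qed
  let ?ra = "\<lambda>a. card {x \<in> A. lt1 x a}" and ?rb = "\<lambda>b. card {x \<in> B. lt2 x b}"
  have ra: "bij_betw ?ra A {..<card A}" "\<And>x y. x \<in> A \<Longrightarrow> y \<in> A \<Longrightarrow> lt1 x y \<Longrightarrow> ?ra x < ?ra y"
    using rank[of A lt1] fin(1) A by blast+
  have rb: "bij_betw ?rb B {..<card A}" "\<And>x y. x \<in> B \<Longrightarrow> y \<in> B \<Longrightarrow> lt2 x y \<Longrightarrow> ?rb x < ?rb y"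
    using rank[of B lt2] fin(2,3) B by simp_all
  define f where "f = inv_into B ?rb \<circ> ?ra"
  have f: "bij_betw f A B" unfolding f_def by (rule bij_betw_trans[OF ra(1) bij_betw_inv_into[OF rb(1)]])
  have rbf: "?rb (f x) = ?ra x" if "x \<in> A" for x
  proof -
    have "?ra x \<in> {..<card A}" using ra(1) that by (auto simp: bij_betw_def)
    then show ?thesis unfolding f_def using bij_betw_inv_into_right[OF rb(1)] by simp
  qed
  have "lt2 (f x) (f y)" if xy: "x \<in> A" "y \<in> A" "lt1 x y" for x y
  proof (rule ccontr)
    assume n: "\<not> lt2 (f x) (f y)"
    have fB: "f x \<in> B" "f y \<in> B" using f xy by (auto simp: bij_betw_def)
    have lt: "?rb (f x) < ?rb (f y)" using rbf[OF xy(1)] rbf[OF xy(2)] ra(2)[OF xy] by simp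
    then have "f x \<noteq> f y" by auto
    then have "lt2 (f y) (f x)" using B(3)[OF fB] n by blast
    then show False using rb(2)[OF fB(2,1)] lt by simp
  qed
  then show ?thesis using that f by blast
qed

section \<open>Twins as gaps of the lexicographic order\<close>

context alphabet
begin

lemma twin_lx: "twin n x y \<Longrightarrow> lx x y"
  unfolding twin_def lx_def by (metis lessI)

text \<open>A point in between shares the first \<open>m\<close> letters and must leave
  \<open>x\<close> upwards and \<open>y\<close> downwards. Behind position \<open>m\<close> the
  tails are extreme, which forbids this, and at \<open>m\<close> the values are consecutive.\<close>

lemma twin_no_between:
  assumes t: "twin n x y" and D: "inj_on letter_val D" and x: "x \<in> inf_words n D" "y \<in> inf_words n D" "z \<in> inf_words n D"
  shows "\<not> (lx x z \<and> lx z y)"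
proof
  assume a: "lx x z \<and> lx z y"
  obtain m where m: "\<forall>j<m. x j = y j" "letter_val (y m) = Suc (letter_val (x m))"
      "\<forall>j>m. x j = Lt (n - 1) \<and> y j = Lt 0"
    using t by (auto simp: twin_def)
  have "take_word m x = take_word m y" using m(1) by (simp add: take_word_eq_iff)
  then have xz: "\<And>j. j < m \<Longrightarrow> z j = x j" using lx_between[of x z y m] a by (auto simp: take_word_eq_iff)
  obtain k where k: "\<forall>j<k. x j = z j" "letter_val (x k) < letter_val (z k)" using a by (auto simp: lx_def)
  obtain l where l: "\<forall>j<l. z j = y j" "letter_val (z l) < letter_val (y l)" using a by (auto simp: lx_def)
  have zk: "letter_val (z j) \<le> n - 1" if j: "j > m" for j
  proof -
    obtain i where "j = Suc i" using j by (cases j) auto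
    then have "z j \<in> letters n" using x(3) by (simp add: inf_words_def)
    then show ?thesis by (auto simp: letters_def)
  qed
  have "k \<ge> m" using xz k(2) by (metis less_irrefl not_le)
  moreover have "\<not> k > m" using zk[of k] m(3) k(2) by auto
  ultimately have km: "k = m" by simp
  have "l \<ge> m" using xz m(1) l(2) by (metis less_irrefl not_le)
  moreover have "\<not> l > m" using m(3) l(2) by auto
  ultimately have "l = m" by simp
  then show False using km k(2) l(2) m(2) by simp
qed

lemma twin_no_between_lxs:
  assumes "twin n x y \<or> twin n y x" "x \<in> C" "y \<in> C" "z \<in> C" "lxs s x z" "lxs s z y"
  shows False
  using assms twin_no_between[of x y "letters n" z] twin_no_between[of y x "letters n" z]
    twin_lx[of x y] twin_lx[of y x] lx_asym[of x y] lxs_trans[of s x z y]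
  by (cases s) (auto simp: lxs_def)

lemma twin_append: "twin n x y \<Longrightarrow> twin n (w \<frown> x) (w \<frown> y)"
proof -
  assume "twin n x y"
  then obtain m where m: "\<forall>j<m. x j = y j" "letter_val (y m) = Suc (letter_val (x m))"
      "\<forall>j>m. x j = Lt (n - 1) \<and> y j = Lt 0"
    by (auto simp: twin_def)
  show ?thesis
    unfolding twin_def using m by (intro exI[of _ "length w + m"]) (auto simp: append_word_def)
qed

lemma twin_cancel:
  assumes "twin n (w \<frown> x) (w \<frown> y)" shows "twin n x y"
proof -
  obtain m where m: "\<forall>j<m. (w \<frown> x) j = (w \<frown> y) j" "letter_val ((w \<frown> y) m) = Suc (letter_val ((w \<frown> x) m))"
      "\<forall>j>m. (w \<frown> x) j = Lt (n - 1) \<and> (w \<frown> y) j = Lt 0"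
    using assms by (auto simp: twin_def)
  have le: "length w \<le> m" using m(2) by (auto simp: append_word_def split: if_splits)
  have sh: "(w \<frown> z) (length w + j) = z j" for z j by (simp add: append_word_def)
  show ?thesis
    unfolding twin_def
  proof (intro exI[of _ "m - length w"] conjI allI impI)
    fix j assume "j < m - length w"
    then show "x j = y j" using m(1)[rule_format, of "length w + j"] by (simp add: sh)
  next
    show "letter_val (y (m - length w)) = Suc (letter_val (x (m - length w)))"
      using m(2) sh[of _ "m - length w"] le by simp
  next
    fix j assume "m - length w < j"
    then have "length w + j > m" using le by simp
    then have "(w \<frown> x) (length w + j) = Lt (n - 1) \<and> (w \<frown> y) (length w + j) = Lt 0" using m(3) by blast
    then show "x j = Lt (n - 1)" "y j = Lt 0" by (simp_all add: sh)
  qed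
qed

lemma nines_C [simp]: "(\<lambda>_. Lt (n - 1)) \<in> C"
  using n2 by (auto simp: cantor_eq letters_def)

lemma LtL: "i < n \<Longrightarrow> Lt i \<in> letters n"
  by (simp add: letters_def)

text \<open>The interval obtained from \<open>C\<close> by gluing twins is connected.\<close>

lemma twin_connected:
  assumes "\<exists>m. \<forall>x\<in>C. \<forall>y\<in>C. take_word m x = take_word m y \<longrightarrow> P x = P y"
    and tw: "\<And>x y. x \<in> C \<Longrightarrow> y \<in> C \<Longrightarrow> twin n x y \<Longrightarrow> P x = P y"
    and x: "x \<in> C" and y: "y \<in> C"
  shows "P x = P y"
proof -
  have "(\<forall>x\<in>C. \<forall>y\<in>C. take_word m x = take_word m y \<longrightarrow> P x = P y) \<longrightarrow> (\<forall>x\<in>C. \<forall>y\<in>C. P x = P y)" for m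
  proof (induction m)
    case 0
    have "take_word 0 x = take_word 0 y" for x y by simp
    then show ?case by blast
  next
    case (Suc m)
    show ?case
    proof
      assume lev: "\<forall>x\<in>C. \<forall>y\<in>C. take_word (Suc m) x = take_word (Suc m) y \<longrightarrow> P x = P y"
      \<comment> \<open>Neighbouring subcones of \<open>w\<close> meet in a pair of twins, so local
        constancy at depth \<open>Suc m\<close> passes to depth \<open>m\<close>.\<close>
      have st: "P ((w @ [Lt i]) \<frown> (\<lambda>_. Lt 0)) = P (w \<frown> (\<lambda>_. Lt 0))"
        if w: "w \<in> L" "length w = m" and i: "i < n" for w i
        using i
      proof (induction i)
        case 0
        have eq: "(w @ [Lt 0]) \<frown> (\<lambda>_. Lt 0) = w \<frown> (\<lambda>_. Lt 0)"
          by (auto simp: append_word_def fun_eq_iff nth_append nth_Cons')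
        show ?case unfolding eq ..
      next
        case (Suc i)
        let ?a = "(w @ [Lt i]) \<frown> (\<lambda>_. Lt (n - 1))" and ?b = "(w @ [Lt (Suc i)]) \<frown> (\<lambda>_. Lt 0)"
        have C': "?a \<in> C" "?b \<in> C" "(w @ [Lt i]) \<frown> (\<lambda>_. Lt 0) \<in> C"
          using w(1) Suc.prems LtL[of i] LtL[of "Suc i"] nines_C by simp_all
        have "twin n ([Lt i] \<frown> (\<lambda>_. Lt (n - 1))) ([Lt (Suc i)] \<frown> (\<lambda>_. Lt 0))"
          unfolding twin_def by (intro exI[of _ 0]) (auto simp: append_word_def)
        then have "P ?a = P ?b" using tw[OF C'(1,2)] twin_append by simp
        moreover have "take_word (length (w @ [Lt i])) ?a = take_word (length (w @ [Lt i])) ((w @ [Lt i]) \<frown> (\<lambda>_. Lt 0))"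
          by (simp only: take_word_append_word_eq)
        then have "P ?a = P ((w @ [Lt i]) \<frown> (\<lambda>_. Lt 0))"
          using lev C'(1,3) w(2) by (metis length_append_singleton)
        ultimately show ?case using Suc by simp
      qed
      have rep: "P x = P (take_word m x \<frown> (\<lambda>_. Lt 0))" if x: "x \<in> C" for x
      proof -
        have "x m \<in> letters n" using x by (simp add: cantor_eq)
        then obtain i where i: "x m = Lt i" "i < n" by (auto simp: letters_def)
        have tL: "take_word m x \<in> L" using take_cantor[OF x] .
        let ?b = "(take_word m x @ [Lt i]) \<frown> (\<lambda>_. Lt 0)"
        have "?b \<in> C" using tL LtL[OF i(2)] by simp
        moreover have "take_word (Suc m) x = take_word (Suc m) ?b"
          using take_word_append_word_eq[of "take_word m x @ [Lt i]"] i(1) by (simp add: take_word_Suc)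
        ultimately have "P x = P ?b" using lev x by blast
        then show ?thesis using st[OF tL _ i(2)] by simp
      qed
      have "P x = P y" if "x \<in> C" "y \<in> C" "take_word m x = take_word m y" for x y
        using rep[OF that(1)] rep[OF that(2)] that(3) by simp
      then show "\<forall>x\<in>C. \<forall>y\<in>C. P x = P y" using Suc.IH by blast
    qed
  qed
  then show ?thesis using assms(1) x y by blast
qed

section \<open>Maps preserving twins are monotone\<close>

definition monot :: "bool \<Rightarrow> (iword \<Rightarrow> iword) \<Rightarrow> bool" where
  "monot s q \<longleftrightarrow> (\<forall>x\<in>C. \<forall>y\<in>C. lx x y \<longrightarrow> lxs s (q x) (q y))"

text \<open>A discrete intermediate value argument: the set of the \<open>t\<close> up to \<open>x\<close>, or up to \<open>y\<close> and with
  value below \<open>q z\<close>, is locally constant and closed under twins.\<close>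

lemma no_peak:
  assumes q: "\<And>x. x \<in> C \<Longrightarrow> q x \<in> C" "inj_on q C" "ucont n (letters n) q"
    and qi: "\<And>l. \<exists>m. \<forall>x\<in>C. \<forall>y\<in>C. take_word m (q x) = take_word m (q y) \<longrightarrow> take_word l x = take_word l y"
    and tw: "\<And>x y. x \<in> C \<Longrightarrow> y \<in> C \<Longrightarrow> twin n x y \<Longrightarrow> twin n (q x) (q y) \<or> twin n (q y) (q x)"
    and C': "x \<in> C" "y \<in> C" "z \<in> C" and xyz: "lxs s x y" "lxs s y z"
    and pk: "lxs t (q x) (q z)" "lxs t (q z) (q y)"
  shows False
proof -
  have tot: "lxs s a b \<or> lxs s b a" if "a \<in> C" "b \<in> C" "a \<noteq> b" for a b s
    using lxs_total[of a n "letters n" b s] that by simp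
  define P where "P a \<longleftrightarrow> lxs s a x \<or> a = x \<or> ((lxs s a y \<or> a = y) \<and> lxs t (q a) (q z))" for a
  have yz: "y \<noteq> z" "x \<noteq> y" using xyz by auto
  have nz: "a \<noteq> z" if "lxs s a y \<or> a = y" for a using that xyz(2) lxs_trans lxs_asym lxs_irrefl by metis
  have Px: "P x" by (simp add: P_def)
  have nPy: "\<not> P y" unfolding P_def using xyz(1) pk(2) lxs_asym yz by blast
  \<comment> \<open>Between a point with \<open>P\<close> and one without, the argument crosses
    \<open>x\<close> or \<open>y\<close>, or the value crosses \<open>q z\<close>. Twins and nearby
    points are excluded by the same alternatives.\<close>
  have cases: "(a = x \<or> lxs s a x) \<and> lxs s x b \<and> (lxs s b y \<or> b = y) \<and> lxs t (q z) (q b)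
     \<or> (a = x \<or> lxs s a x) \<and> lxs s x y \<and> lxs s y b
     \<or> lxs s x a \<and> (lxs s b y \<or> b = y) \<and> lxs t (q a) (q z) \<and> lxs t (q z) (q b)
     \<or> (lxs s a y \<or> a = y) \<and> lxs s y b \<and> lxs t (q a) (q z)"
    if ab: "a \<in> C" "b \<in> C" "P a" "\<not> P b" for a b
  proof -
    have xb: "lxs s x b" using ab tot[OF ab(2) C'(1), of s] unfolding P_def by blast
    have b: "lxs s b y \<or> b = y \<or> lxs s y b" using tot[OF ab(2) C'(2)] by blast
    have qb: "lxs t (q z) (q b)" if "lxs s b y \<or> b = y"
    proof -
      have "\<not> lxs t (q b) (q z)" using ab(4) that unfolding P_def by blast
      moreover have "q b \<noteq> q z" using nz[OF that] inj_on_eq_iff[OF q(2) ab(2) C'(3)] by blast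
      ultimately show ?thesis using tot[OF q(1)[OF ab(2)] q(1)[OF C'(3)]] by blast
    qed
    have a: "a = x \<or> lxs s a x \<or> lxs s x a" using tot[OF ab(1) C'(1)] by blast
    show ?thesis using xb b qb a ab(3) xyz(1) unfolding P_def by blast
  qed
  have tw': "False" if ab: "a \<in> C" "b \<in> C" "P a" "\<not> P b" and tab: "twin n a b \<or> twin n b a" for a b
  proof -
    have tq: "twin n (q a) (q b) \<or> twin n (q b) (q a)" using tw tab ab by blast
    note nb = twin_no_between_lxs[OF tab ab(1,2)] and nbq = twin_no_between_lxs[OF tq q(1)[OF ab(1)] q(1)[OF ab(2)]]
    have "a = x" if "a = x \<or> lxs s a x" "lxs s x b" using nb[OF C'(1), of s] that by blast
    moreover have "a = y" if "lxs s a y \<or> a = y" "lxs s y b" using nb[OF C'(2), of s] that by blast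
    ultimately show False
      using cases[OF ab] pk nbq[OF q(1)[OF C'(3)], of t] nb[OF C'(2), of s] xyz(1) lxs_asym lxs_trans lxs_irrefl
      by metis
  qed
  have loc: "\<exists>m. \<forall>a\<in>C. \<forall>b\<in>C. take_word m a = take_word m b \<longrightarrow> P a = P b"
  proof -
    \<comment> \<open>\<open>l\<close> separates \<open>y\<close> from both \<open>x\<close> and
      \<open>z\<close>. Uniform continuity of the inverse turns the distance from \<open>z\<close>
      into a distance between \<open>q z\<close> and the values at points up to
      \<open>y\<close>.\<close>
    obtain l where l: "take_word l y \<noteq> take_word l z" "take_word l x \<noteq> take_word l y"
    proof -
      obtain i where "y i \<noteq> z i" using yz by auto
      moreover obtain j where "x j \<noteq> y j" using yz by auto
      ultimately show ?thesis using that[of "Suc (i + j)"] by (force simp: take_word_eq_iff)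
    qed
    obtain k where k: "\<And>a b. a \<in> C \<Longrightarrow> b \<in> C \<Longrightarrow> take_word k (q a) = take_word k (q b) \<Longrightarrow> take_word l a = take_word l b"
      using qi[of l] by blast
    obtain m' where m': "\<And>a b. a \<in> C \<Longrightarrow> b \<in> C \<Longrightarrow> take_word m' a = take_word m' b \<Longrightarrow> take_word k (q a) = take_word k (q b)"
      using q(3) unfolding ucont_def inf_words_letters by blast
    define m where "m = max m' l"
    have mk: "take_word k (q a) = take_word k (q b)" if "a \<in> C" "b \<in> C" "take_word m a = take_word m b" for a b
      by (rule m'[OF that(1,2) take_word_mono[OF that(3)]]) (simp add: m_def)
    have far: "take_word k (q b) \<noteq> take_word k (q z)" if b: "b \<in> C" "lxs s b y \<or> b = y" for b
    proof
      assume "take_word k (q b) = take_word k (q z)"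
      then have bz: "take_word l b = take_word l z" by (rule k[OF b(1) C'(3)])
      have "take_word l y = take_word l z"
        using b(2) lxs_between[OF _ xyz(2) bz] bz by auto
      then show False using l(1) by simp
    qed
    have "False" if ab: "a \<in> C" "b \<in> C" "P a" "\<not> P b" and eq: "take_word m a = take_word m b" for a b
    proof -
      have mid: "take_word m v = take_word m b" if "a = v \<or> lxs s a v" "lxs s v b" for v
        using that lxs_between[OF _ that(2) eq] eq by auto
      \<comment> \<open>Nearby points with values on both sides of \<open>q z\<close> would bring
        \<open>q z\<close> close to the value at \<open>w\<close>, against
        \<open>far\<close>.\<close>
      have midq: False if v: "v \<in> C" "lxs t (q v) (q z)" "lxs t (q z) (q w)" "take_word m v = take_word m w"
        "w \<in> C" "lxs s w y \<or> w = y" for v w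
      proof -
        have e: "take_word k (q v) = take_word k (q w)" by (rule mk[OF v(1,5,4)])
        have "take_word k (q z) = take_word k (q v)" by (rule lxs_between[OF v(2,3) e])
        then show False using far[OF v(5,6)] e by simp
      qed
      consider (1) "a = x \<or> lxs s a x" "lxs s x b" "lxs s b y \<or> b = y" "lxs t (q z) (q b)"
        | (2) "a = x \<or> lxs s a x" "lxs s x y" "lxs s y b"
        | (3) "lxs s b y \<or> b = y" "lxs t (q a) (q z)" "lxs t (q z) (q b)"
        | (4) "lxs s a y \<or> a = y" "lxs s y b" "lxs t (q a) (q z)"
        using cases[OF ab] by blast
      then show False
      proof cases
        case 1
        then show ?thesis using midq[OF C'(1) pk(1) 1(4) mid[OF 1(1,2)] ab(2) 1(3)] by blast
      next
        case 2
        have "take_word m x = take_word m b" by (rule mid[OF 2(1)]) (use 2 lxs_trans in blast)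
        moreover have "take_word m y = take_word m b" by (rule mid) (use 2 lxs_trans in blast)+
        ultimately have "take_word l x = take_word l y" using take_word_mono[of m x y l] by (simp add: m_def)
        then show ?thesis using l(2) by simp
      next
        case 3
        then show ?thesis using midq[OF ab(1) 3(2,3) eq ab(2) 3(1)] by blast
      next
        case 4
        have "take_word m y = take_word m b" by (rule mid) (use 4 in auto)
        then have "take_word m a = take_word m y" using eq by simp
        then show ?thesis using midq[OF ab(1) 4(3) pk(2) _ C'(2)] by blast
      qed
    qed
    then show ?thesis by metis
  qed
  have "P x = P y"
    by (rule twin_connected[OF loc _ C'(1,2)]) (use tw' in blast)
  then show False using Px nPy by simp
qed

lemma lx_zeros: "x \<in> C \<Longrightarrow> x = (\<lambda>_. Lt 0) \<or> lx (\<lambda>_. Lt 0) x"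
proof -
  assume x: "x \<in> C"
  have "\<not> lx x (\<lambda>_. Lt 0)" by (auto simp: lx_def)
  then show ?thesis using lx_total[of x n "letters n" "\<lambda>_. Lt 0"] x by auto
qed

lemma lx_nines: "x \<in> C \<Longrightarrow> x = (\<lambda>_. Lt (n - 1)) \<or> lx x (\<lambda>_. Lt (n - 1))"
proof -
  assume x: "x \<in> C"
  have "letter_val (x k) \<le> n - 1" for k using x by (auto simp: cantor_eq letters_def dest!: spec[of _ k])
  then have "\<not> lx (\<lambda>_. Lt (n - 1)) x" by (auto simp: lx_def not_less)
  then show ?thesis using lx_total[of x n "letters n" "\<lambda>_. Lt (n - 1)"] x nines_C by auto
qed

text \<open>With peaks excluded in both directions, the value at a middle point lies between the
  values at the outer ones. The least and the greatest point of \<open>C\<close> fix the direction,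
  which is passed on to every pair.\<close>

lemma twin_map_monot:
  assumes q: "\<And>x. x \<in> C \<Longrightarrow> q x \<in> C" "inj_on q C" "ucont n (letters n) q"
    and qi: "\<And>l. \<exists>m. \<forall>x\<in>C. \<forall>y\<in>C. take_word m (q x) = take_word m (q y) \<longrightarrow> take_word l x = take_word l y"
    and tw: "\<And>x y. x \<in> C \<Longrightarrow> y \<in> C \<Longrightarrow> twin n x y \<Longrightarrow> twin n (q x) (q y) \<or> twin n (q y) (q x)"
  shows "\<exists>s. monot s q"
proof -
  have np: False if "x \<in> C" "y \<in> C" "z \<in> C" "lxs s x y" "lxs s y z" "lxs t (q x) (q z)" "lxs t (q z) (q y)"
    for x y z s t
    by (rule no_peak[where q = q and x = x and y = y and z = z and s = s and t = t])
      (fact q qi tw that)+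
  have tot: "lxs s (q a) (q b) \<or> lxs s (q b) (q a)" if "a \<in> C" "b \<in> C" "a \<noteq> b" for a b s
    using lxs_total[of "q a" n "letters n" "q b" s] that q(1) inj_on_eq_iff[OF q(2)] by auto
  have mid: "lxs t (q x) (q y) \<and> lxs t (q y) (q z)"
    if C': "x \<in> C" "y \<in> C" "z \<in> C" and xyz: "lx x y" "lx y z" and t: "lxs t (q x) (q z)" for x y z t
  proof (intro conjI)
    have ne: "x \<noteq> y" "y \<noteq> z" using xyz by auto
    show "lxs t (q x) (q y)"
    proof (rule ccontr)
      assume "\<not> lxs t (q x) (q y)"
      then have "lxs t (q y) (q x)" using tot C' ne by blast
      \<comment> \<open>The exclusion of peaks with both orders reversed.\<close>
      then show False
        using np[OF C'(3,2,1), of False "\<not> t"] xyz t by (simp add: lxs_not) (simp add: lxs_def)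
    qed
    show "lxs t (q y) (q z)"
    proof (rule ccontr)
      assume "\<not> lxs t (q y) (q z)"
      then have "lxs t (q z) (q y)" using tot C' ne by blast
      then show False using np[OF C', of True t] xyz t by (simp add: lxs_def)
    qed
  qed
  let ?a = "\<lambda>_::nat. Lt 0" and ?b = "\<lambda>_::nat. Lt (n - 1)"
  have ab: "lx ?a ?b" using n2 by (auto simp: lx_def)
  have "?a \<noteq> ?b" using n2 by (auto dest: fun_cong)
  from tot[OF zeros_C nines_C this, of True]
  have "lxs True (q ?a) (q ?b) \<or> lxs False (q ?a) (q ?b)" by (simp add: lxs_def)
  then obtain s where s: "lxs s (q ?a) (q ?b)" by blast
  have "lxs s (q x) (q y)" if xy: "x \<in> C" "y \<in> C" "lx x y" for x y
  proof -
    have ay: "lx ?a y" using lx_zeros[OF xy(1)] xy(3) lx_trans by blast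
    have y: "lxs s (q ?a) (q y)"
      using lx_nines[OF xy(2)] s mid[OF zeros_C xy(2) nines_C ay _ s] by blast
    show ?thesis
      using lx_zeros[OF xy(1)] y mid[OF zeros_C xy(1,2) _ xy(3) y] by blast
  qed
  then show ?thesis unfolding monot_def by blast
qed

text \<open>With \<open>high\<close>, the two ends of the linear order; they form the one identified
  pair that is not a gap.\<close>

definition low :: iword where "low = [Dot 0] \<frown> (\<lambda>_. Lt 0)"

definition high :: "nat \<Rightarrow> iword" where "high r = [Dot (r - 1)] \<frown> (\<lambda>_. Lt (n - 1))"

section \<open>The circle relation in terms of the order\<close>

lemma dot_split:
  assumes "x \<in> cantor_dot n r"
  obtains a y where "x = [Dot a] \<frown> y" "a < r" "y \<in> C"
proof -
  obtain w y where w: "x = w \<frown> y" "w \<in> nefin n (dots r)" "length w = 1" "y \<in> C"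
    using inf_words_split[of x n "dots r" 1] assms by (auto simp: cantor_dot_def)
  then obtain d where "w = [d]" by (cases w) auto
  moreover have "d \<in> dots r" using w(2) calculation by simp
  then obtain a where "d = Dot a" "a < r" by (auto simp: dots_def)
  ultimately show ?thesis using that w by blast
qed

lemma lx_first: "a < b \<Longrightarrow> lx ([Dot a] \<frown> x) ([Dot b] \<frown> y)"
  unfolding lx_def by (intro exI[of _ 0]) (simp add: append_word_def)

lemma low_least:
  assumes "x \<in> cantor_dot n r" shows "x = low \<or> lx low x"
proof -
  obtain a y where x: "x = [Dot a] \<frown> y" "a < r" "y \<in> C" by (rule dot_split[OF assms])
  show ?thesis
    unfolding low_def x(1) using lx_zeros[OF x(3)] lx_first[of 0 a] by (cases "a = 0") auto
qed

lemma high_greatest: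
  assumes "x \<in> cantor_dot n r" shows "x = high r \<or> lx x (high r)"
proof -
  obtain a y where x: "x = [Dot a] \<frown> y" "a < r" "y \<in> C" by (rule dot_split[OF assms])
  show ?thesis
  proof (cases "a = r - 1")
    case True then show ?thesis unfolding high_def x(1) using lx_nines[OF x(3)] by (metis lx_append)
  next
    case False then show ?thesis unfolding high_def x(1) using lx_first[of a "r - 1"] x(2) by simp
  qed
qed

lemma low_high_in:
  assumes "1 \<le> r" shows "low \<in> cantor_dot n r" "high r \<in> cantor_dot n r"
  unfolding low_def high_def cantor_dot_def
  by (rule inf_words_appendI; use assms nines_C in \<open>simp add: dots_def\<close>)+

lemma twin_iff_words:
  assumes x: "x \<in> cantor_dot n r" and y: "y \<in> cantor_dot n r"
  shows "twin n x y \<longleftrightarrow>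
     (\<exists>w\<in>dot_words n r. \<exists>i. 0 < i \<and> i \<le> n - 1 \<and> x = (w @ [Lt (i - 1)]) \<frown> (\<lambda>_. Lt (n - 1))
        \<and> y = (w @ [Lt i]) \<frown> (\<lambda>_. Lt 0))
   \<or> (\<exists>a. 0 < a \<and> a \<le> r - 1 \<and> x = [Dot (a - 1)] \<frown> (\<lambda>_. Lt (n - 1)) \<and> y = [Dot a] \<frown> (\<lambda>_. Lt 0))"
    (is "?l \<longleftrightarrow> ?r1 \<or> ?r2")
proof
  assume ?l
  then obtain m where m: "\<forall>j<m. x j = y j" "letter_val (y m) = Suc (letter_val (x m))"
      "\<forall>j>m. x j = Lt (n - 1) \<and> y j = Lt 0"
    by (auto simp: twin_def)
  have xm: "x = (take_word m x @ [x m]) \<frown> (\<lambda>_. Lt (n - 1))"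
  proof
    fix k show "x k = ((take_word m x @ [x m]) \<frown> (\<lambda>_. Lt (n - 1))) k"
      using m(3) by (cases k m rule: linorder_cases) (auto simp: append_word_def nth_append)
  qed
  have ym: "y = (take_word m x @ [y m]) \<frown> (\<lambda>_. Lt 0)"
  proof
    fix k show "y k = ((take_word m x @ [y m]) \<frown> (\<lambda>_. Lt 0)) k"
      using m(1,3) by (cases k m rule: linorder_cases) (auto simp: append_word_def nth_append)
  qed
  show "?r1 \<or> ?r2"
  proof (cases m)
    case 0
    have "x 0 \<in> dots r" "y 0 \<in> dots r" using x y by (auto simp: cantor_dot_def inf_words_def)
    then obtain a b where ab: "x 0 = Dot a" "y 0 = Dot b" "b < r" by (auto simp: dots_def)
    then have "b = Suc a" using m(2) 0 by simp
    then have ?r2 using xm ym ab 0 by (intro exI[of _ b]) auto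
    then show ?thesis ..
  next
    case (Suc j)
    have "x m \<in> letters n" "y m \<in> letters n" using x y Suc by (simp_all add: cantor_dot_def inf_words_def)
    then obtain a b where ab: "x m = Lt a" "y m = Lt b" "b < n" by (auto simp: letters_def)
    then have b: "b = Suc a" using m(2) by simp
    have "take_word m x \<in> dot_words n r"
      using take_inf_words_ne[of x n "dots r" m] x Suc by (simp add: cantor_dot_def dot_words_def nefin_iff)
    then have ?r1 using xm ym ab b by (intro bexI[of _ "take_word m x"] exI[of _ b]) auto
    then show ?thesis ..
  qed
next
  assume "?r1 \<or> ?r2"
  then show ?l
  proof
    assume ?r1
    then obtain w i where w: "0 < i" "x = (w @ [Lt (i - 1)]) \<frown> (\<lambda>_. Lt (n - 1))" "y = (w @ [Lt i]) \<frown> (\<lambda>_. Lt 0)"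
      by blast
    have "twin n ([Lt (i - 1)] \<frown> (\<lambda>_. Lt (n - 1))) ([Lt i] \<frown> (\<lambda>_. Lt 0))"
      unfolding twin_def using w(1) by (intro exI[of _ 0]) (simp add: append_word_def)
    then show ?l unfolding w by (simp add: twin_append)
  next
    assume ?r2
    then obtain a where "0 < a" "x = [Dot (a - 1)] \<frown> (\<lambda>_. Lt (n - 1))" "y = [Dot a] \<frown> (\<lambda>_. Lt 0)" by blast
    then show ?l
      unfolding twin_def by (intro exI[of _ 0]) (simp add: append_word_def)
  qed
qed

lemma circ_equiv_iff:
  assumes x: "x \<in> cantor_dot n r" and y: "y \<in> cantor_dot n r"
  shows "circ_equiv n r x y \<longleftrightarrow> x = y \<or> twin n x y \<or> twin n y x
     \<or> (x = low \<and> y = high r) \<or> (x = high r \<and> y = low)"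
  unfolding twin_iff_words[OF x y] twin_iff_words[OF y x] circ_equiv_def low_def high_def doubleton_eq_iff
  by blast

text \<open>In a gap, \<open>x\<close> must be the greatest and \<open>y\<close> the least point of
  the cones in which they first differ, and a skipped letter value would leave a whole cone in
  between.\<close>

lemma twin_iff_adjacent:
  assumes x: "x \<in> cantor_dot n r" and y: "y \<in> cantor_dot n r"
  shows "twin n x y \<longleftrightarrow> lx x y \<and> \<not> (\<exists>z\<in>cantor_dot n r. lx x z \<and> lx z y)"
proof
  assume t: "twin n x y"
  show "lx x y \<and> \<not> (\<exists>z\<in>cantor_dot n r. lx x z \<and> lx z y)"
    using twin_lx[OF t] twin_no_between[OF t inj_letter_val(2)] x y unfolding cantor_dot_def by blast
next
  assume a: "lx x y \<and> \<not> (\<exists>z\<in>cantor_dot n r. lx x z \<and> lx z y)"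
  then obtain m where m: "\<forall>j<m. x j = y j" "letter_val (x m) < letter_val (y m)" by (auto simp: lx_def)
  define w where "w = take_word m x"
  define w' where "w' = take_word (Suc m) x"
  define v' where "v' = take_word (Suc m) y"
  have wy: "w = take_word m y" using m(1) by (simp add: w_def take_word_eq_iff)
  have ne: "w' \<in> nefin n (dots r)" "v' \<in> nefin n (dots r)"
    using take_inf_words_ne[of x n "dots r" "Suc m"] take_inf_words_ne[of y n "dots r" "Suc m"] x y
    by (simp_all add: w'_def v'_def cantor_dot_def)
  have w'w: "w' = w @ [x m]" "v' = w @ [y m]" unfolding w'_def v'_def w_def wy[unfolded w_def] take_word_Suc by simp_all
  have xs: "x = w' \<frown> drop_word (Suc m) x" "y = v' \<frown> drop_word (Suc m) y" by (simp_all add: w'_def v'_def)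
  have dC: "drop_word (Suc m) x \<in> C" "drop_word (Suc m) y \<in> C"
    using drop_inf_words x y by (auto simp: cantor_dot_def)
  have lt: "lx (w' \<frown> s) (v' \<frown> t)" for s t
    unfolding w'w append_word_append lx_append unfolding lx_def
    using m(2) by (intro exI[of _ 0]) (simp add: append_word_def)
  have z1: "w' \<frown> (\<lambda>_. Lt (n - 1)) \<in> cantor_dot n r" "v' \<frown> (\<lambda>_. Lt 0) \<in> cantor_dot n r"
    unfolding cantor_dot_def using inf_words_appendI ne nines_C zeros_C by blast+
  have "\<not> lx x (w' \<frown> (\<lambda>_. Lt (n - 1)))" using a z1(1) lt xs(2) by metis
  then have xn: "drop_word (Suc m) x = (\<lambda>_. Lt (n - 1))"
    using lx_nines[OF dC(1)] xs(1) by (metis lx_append)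
  have "\<not> lx (v' \<frown> (\<lambda>_. Lt 0)) y" using a z1(2) lt xs(1) by metis
  then have yn: "drop_word (Suc m) y = (\<lambda>_. Lt 0)"
    using lx_zeros[OF dC(2)] xs(2) by (metis lx_append)
  have "letter_val (y m) = Suc (letter_val (x m))"
  proof (rule ccontr)
    assume "letter_val (y m) \<noteq> Suc (letter_val (x m))"
    then have big: "Suc (letter_val (x m)) < letter_val (y m)" using m(2) by simp
    obtain b where b: "letter_val b = Suc (letter_val (x m))" "w @ [b] \<in> nefin n (dots r)"
    proof (cases "w = []")
      case True
      have "y m \<in> dots r" using ne(2) w'w True by simp
      then show ?thesis using that[of "Dot (Suc (letter_val (x m)))"] big True by (auto simp: dots_def)
    next
      case False
      have "y m \<in> letters n" "w \<in> fin_words n (dots r)"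
        using ne(2) False unfolding w'w by (simp_all add: nefin_iff append_fin_words)
      then show ?thesis
        using that[of "Lt (Suc (letter_val (x m)))"] big False
        by (auto simp: letters_def nefin_iff append_fin_words)
    qed
    have "(w @ [b]) \<frown> (\<lambda>_. Lt 0) \<in> cantor_dot n r"
      unfolding cantor_dot_def by (rule inf_words_appendI[OF b(2) zeros_C])
    moreover have "lx (w \<frown> [x m] \<frown> s) (w \<frown> [b] \<frown> t)" "lx (w \<frown> [b] \<frown> t) (w \<frown> [y m] \<frown> s)" for s t
      unfolding lx_append unfolding lx_def using b(1) big
      by (auto simp: append_word_def intro!: exI[of _ 0])
    then have "lx x ((w @ [b]) \<frown> (\<lambda>_. Lt 0))" "lx ((w @ [b]) \<frown> (\<lambda>_. Lt 0)) y"
      using xs unfolding w'w append_word_append by metis+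
    ultimately show False using a by blast
  qed
  moreover have "x j = Lt (n - 1)" "y j = Lt 0" if "j > m" for j
    using fun_cong[OF xn, of "j - Suc m"] fun_cong[OF yn, of "j - Suc m"] that by (simp_all add: drop_word_def)
  ultimately show "twin n x y" unfolding twin_def using m(1) by blast
qed

text \<open>Gaps and ends are notions of the order, so a monotone bijection permutes gaps and
  permutes the ends; by \<open>circ_equiv_iff\<close> these determine the relation.\<close>

lemma monotone_TB:
  assumes r: "1 \<le> r" and g: "g \<in> B_nr n r"
    and mono: "\<And>x y. x \<in> cantor_dot n r \<Longrightarrow> y \<in> cantor_dot n r \<Longrightarrow> lx x y \<Longrightarrow> lxs s (g x) (g y)"
  shows "g \<in> TB_nr n r"
proof -
  let ?C = "cantor_dot n r"
  have bij: "bij_betw g ?C ?C" using g unfolding B_nr_iff[OF r] by blast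
  have gC: "g x \<in> ?C" if "x \<in> ?C" for x using bij_betw_apply[OF bij that] .
  have onto: "\<exists>x\<in>?C. g x = y" if "y \<in> ?C" for y
    using bij that unfolding bij_betw_def by (metis imageE)
  have tot: "lx x y \<or> lx y x" if "x \<in> ?C" "y \<in> ?C" "x \<noteq> y" for x y
    using lx_total[OF _ _ inj_letter_val(2) that(3)] that(1,2) unfolding cantor_dot_def by blast
  have iff: "lx x y \<longleftrightarrow> lxs s (g x) (g y)" if xy: "x \<in> ?C" "y \<in> ?C" for x y
  proof
    assume l: "lxs s (g x) (g y)"
    then have "x \<noteq> y" by auto
    moreover have "\<not> lx y x" using mono[OF xy(2,1)] l lxs_asym by blast
    ultimately show "lx x y" using tot xy by blast
  qed (use mono xy in blast)
  have adj: "(lx x y \<and> \<not> (\<exists>z\<in>?C. lx x z \<and> lx z y)) \<longleftrightarrow>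
      (lxs s (g x) (g y) \<and> \<not> (\<exists>z\<in>?C. lxs s (g x) z \<and> lxs s z (g y)))" if xy: "x \<in> ?C" "y \<in> ?C" for x y
  proof -
    have "(\<exists>z\<in>?C. lx x z \<and> lx z y) \<longleftrightarrow> (\<exists>z\<in>?C. lxs s (g x) z \<and> lxs s z (g y))"
    proof
      assume "\<exists>z\<in>?C. lx x z \<and> lx z y"
      then show "\<exists>z\<in>?C. lxs s (g x) z \<and> lxs s z (g y)" using iff xy gC by blast
    next
      assume "\<exists>z\<in>?C. lxs s (g x) z \<and> lxs s z (g y)"
      then obtain z where z: "z \<in> ?C" "lxs s (g x) (g z)" "lxs s (g z) (g y)" using onto by blast
      then show "\<exists>z\<in>?C. lx x z \<and> lx z y" using iff xy by blast
    qed
    then show ?thesis using iff[OF xy] by blast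
  qed
  have tw: "twin n x y \<longleftrightarrow> (if s then twin n (g x) (g y) else twin n (g y) (g x))" if xy: "x \<in> ?C" "y \<in> ?C" for x y
    unfolding twin_iff_adjacent[OF xy] twin_iff_adjacent[OF gC[OF xy(1)] gC[OF xy(2)]]
      twin_iff_adjacent[OF gC[OF xy(2)] gC[OF xy(1)]] adj[OF xy]
    by (auto simp: lxs_def)
  have lowC: "low \<in> ?C" "high r \<in> ?C" using low_high_in[OF r] by auto
  have low_iff: "x = low \<longleftrightarrow> (\<forall>z\<in>?C. \<not> lx z x)" and high_iff: "x = high r \<longleftrightarrow> (\<forall>z\<in>?C. \<not> lx x z)" if x: "x \<in> ?C" for x
    using low_least high_greatest lowC lx_asym lx_irrefl x by metis+
  have ends: "x = low \<longleftrightarrow> g x = (if s then low else high r)" "x = high r \<longleftrightarrow> g x = (if s then high r else low)"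
    if x: "x \<in> ?C" for x
  proof -
    have "(\<forall>z\<in>?C. \<not> lx z x) \<longleftrightarrow> (\<forall>z\<in>?C. \<not> lxs s z (g x))" using iff x gC onto by metis
    then show "x = low \<longleftrightarrow> g x = (if s then low else high r)"
      unfolding low_iff[OF x] using low_iff[OF gC[OF x]] high_iff[OF gC[OF x]] by (simp add: lxs_def)
    have "(\<forall>z\<in>?C. \<not> lx x z) \<longleftrightarrow> (\<forall>z\<in>?C. \<not> lxs s (g x) z)" using iff x gC onto by metis
    then show "x = high r \<longleftrightarrow> g x = (if s then high r else low)"
      unfolding high_iff[OF x] using low_iff[OF gC[OF x]] high_iff[OF gC[OF x]] by (simp add: lxs_def)
  qed
  have eq: "x = y \<longleftrightarrow> g x = g y" if "x \<in> ?C" "y \<in> ?C" for x y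
    using bij that by (auto simp: bij_betw_def inj_on_def)
  have "circ_equiv n r x y \<longleftrightarrow> circ_equiv n r (g x) (g y)" if xy: "x \<in> ?C" "y \<in> ?C" for x y
    unfolding circ_equiv_iff[OF xy] circ_equiv_iff[OF gC[OF xy(1)] gC[OF xy(2)]]
    using tw[OF xy] tw[OF xy(2,1)] ends[OF xy(1)] ends[OF xy(2)] eq[OF xy] by (cases s) auto
  then show ?thesis using g by (simp add: TB_nr_def)
qed

text \<open>The obstacle is a pair of twins sent to the two ends. A core map recurs, so it can be
  read on two disjoint cones, and by injectivity at most one of their images contains
  \<open>low\<close>; on the other cone twins go to twins.\<close>

lemma TB_core_monot:
  assumes r: "1 \<le> r" and h: "h \<in> TB_nr n r" and q: "q \<in> core_maps n (dots r) h"
  shows "\<exists>s. monot s q"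
proof -
  let ?C = "cantor_dot n r"
  have hB: "h \<in> B_nr n r" and hc: "\<And>x y. x \<in> ?C \<Longrightarrow> y \<in> ?C \<Longrightarrow> circ_equiv n r x y \<longleftrightarrow> circ_equiv n r (h x) (h y)"
    using h by (auto simp: TB_nr_def)
  have bij: "bij_betw h ?C ?C" and f: "sync_map n (dots r) (dots r) h" and fi: "sync_map n (dots r) (dots r) (binv r h)"
    using hB unfolding B_nr_iff[OF r] by auto
  have d: "Dot 0 \<in> dots r" using r by (auto simp: dots_def)
  obtain k where k: "syncs n (dots r) h k" using sync_mapD(4)[OF f] by blast
  obtain k2 where k2: "\<And>w. w \<in> nefin n (dots r) \<Longrightarrow> k2 \<le> length w \<Longrightarrow> 1 \<le> length (gcpf n h w)"
    using ucont_gcpf[OF sync_mapD(3,2)[OF f]] by meson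
  obtain w0 where w0: "w0 \<in> nefin n (dots r)" "Suc (max k k2) \<le> length w0" "q = loc n h w0"
    using core_mapsE[OF f q] by metis
  obtain a u where au: "w0 = a # u" "a \<in> dots r" "u \<in> L" using nefinE[OF w0(1)] by blast
  \<comment> \<open>Two incomparable starts, to be followed by the same synchronizing word
    \<open>u\<close>.\<close>
  define z1 where "z1 = [Dot 0, Lt 0]"
  define z2 where "z2 = [Dot 0, Lt 1]"
  have Lt1: "Lt 1 \<in> letters n" using n2 by (auto simp: letters_def)
  have z: "z1 \<in> nefin n (dots r)" "z2 \<in> nefin n (dots r)" using d Lt1 by (simp_all add: z1_def z2_def)
  have lz: "loc n h (z @ u) = q" "z @ u \<in> nefin n (dots r)" "gcpf n h (z @ u) \<noteq> []" if zz: "z \<in> nefin n (dots r)" for z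
  proof -
    show 1: "z @ u \<in> nefin n (dots r)" by (rule nefin_append[OF zz au(3)])
    have "loc n h (z @ u) = loc n h ([a] @ u)" by (rule syncsD[OF k zz _ au(3)]) (use w0 au in simp_all)
    then show "loc n h (z @ u) = q" using w0 au by simp
    show "gcpf n h (z @ u) \<noteq> []" using k2[OF 1] w0(2) au(1) by fastforce
  qed
  have inC: "(z @ u) \<frown> x \<in> ?C" if "z \<in> nefin n (dots r)" "x \<in> C" for z x
    unfolding cantor_dot_def by (rule inf_words_appendI[OF lz(2)[OF that(1)] that(2)])
  have "\<exists>z\<in>nefin n (dots r). \<forall>x\<in>C. h ((z @ u) \<frown> x) \<noteq> low"
  proof (rule ccontr)
    assume "\<not> ?thesis"
    then obtain x1 x2 where x: "x1 \<in> C" "x2 \<in> C" "h ((z1 @ u) \<frown> x1) = low" "h ((z2 @ u) \<frown> x2) = low"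
      using z by blast
    have "(z1 @ u) \<frown> x1 = (z2 @ u) \<frown> x2"
      using inj_on_eq_iff[OF sync_mapD(2)[OF f], of "(z1 @ u) \<frown> x1" "(z2 @ u) \<frown> x2"] x
        inC[OF z(1) x(1)] inC[OF z(2) x(2)] unfolding cantor_dot_def by simp
    then have "((z1 @ u) \<frown> x1) 1 = ((z2 @ u) \<frown> x2) 1" by simp
    then show False by (simp add: z1_def z2_def append_word_def)
  qed
  then obtain z where zz: "z \<in> nefin n (dots r)" and nlow: "\<And>x. x \<in> C \<Longrightarrow> h ((z @ u) \<frown> x) \<noteq> low" by blast
  define w where "w = z @ u"
  define b where "b = gcpf n h w"
  have w: "w \<in> nefin n (dots r)" "q = loc n h w" "b \<noteq> []" using lz[OF zz] by (simp_all add: w_def b_def)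
  have hw: "h (w \<frown> x) = b \<frown> q x" if "x \<in> C" for x
    unfolding b_def w(2) by (rule sync_map_loc_eq[OF f w(1) that])
  have wC: "w \<frown> x \<in> ?C" if "x \<in> C" for x using inC[OF zz that] by (simp only: w_def)
  note sq = sync_map_core[OF f q]
  show ?thesis
  proof (rule twin_map_monot)
    show "q x \<in> C" if "x \<in> C" for x using sync_mapD(1)[OF sq, of x] that by simp
    show "inj_on q C" "ucont n (letters n) q" using sync_mapD(2,3)[OF sq] by simp_all
    show "\<exists>m. \<forall>x\<in>C. \<forall>y\<in>C. take_word m (q x) = take_word m (q y) \<longrightarrow> take_word l x = take_word l y" for l
    proof -
      obtain m where m: "\<forall>x\<in>?C. \<forall>y\<in>?C. take_word m x = take_word m y \<longrightarrow>
          take_word (length w + l) (binv r h x) = take_word (length w + l) (binv r h y)"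
        using sync_mapD(3)[OF fi] unfolding ucont_def cantor_dot_def by blast
      have "take_word l x = take_word l y" if xy: "x \<in> C" "y \<in> C" "take_word m (q x) = take_word m (q y)" for x y
      proof -
        have hC: "h (w \<frown> x) \<in> ?C" "h (w \<frown> y) \<in> ?C" using bij_betw_apply[OF bij] wC xy by blast+
        have "take_word m (h (w \<frown> x)) = take_word m (h (w \<frown> y))"
          unfolding hw[OF xy(1)] hw[OF xy(2)] take_word_append_word using take_word_mono[OF xy(3)] by simp
        then have "take_word (length w + l) (binv r h (h (w \<frown> x))) = take_word (length w + l) (binv r h (h (w \<frown> y)))"
          using m hC by blast
        moreover have "binv r h (h (w \<frown> x)) = w \<frown> x" "binv r h (h (w \<frown> y)) = w \<frown> y"
          using bij_betw_inv_into_left[OF bij] wC xy hC by simp_all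
        ultimately show ?thesis by (simp add: take_word_append_word)
      qed
      then show ?thesis by blast
    qed
    fix x y assume xy: "x \<in> C" "y \<in> C" "twin n x y"
    have "circ_equiv n r (w \<frown> x) (w \<frown> y)"
      unfolding circ_equiv_iff[OF wC[OF xy(1)] wC[OF xy(2)]] using twin_append[OF xy(3)] by blast
    then have c: "circ_equiv n r (h (w \<frown> x)) (h (w \<frown> y))" using hc wC xy by blast
    have hC: "h (w \<frown> x) \<in> ?C" "h (w \<frown> y) \<in> ?C" using bij_betw_apply[OF bij] wC xy by blast+
    have "x \<noteq> y" using twin_lx[OF xy(3)] by auto
    then have "h (w \<frown> x) \<noteq> h (w \<frown> y)"
      using inj_on_eq_iff[OF sync_mapD(2)[OF f], of "w \<frown> x" "w \<frown> y"] wC[OF xy(1)] wC[OF xy(2)]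
      unfolding cantor_dot_def by simp
    moreover have "h (w \<frown> x) \<noteq> low" "h (w \<frown> y) \<noteq> low" unfolding w_def by (rule nlow[OF xy(1)], rule nlow[OF xy(2)])
    ultimately have "twin n (h (w \<frown> x)) (h (w \<frown> y)) \<or> twin n (h (w \<frown> y)) (h (w \<frown> x))"
      using c circ_equiv_iff[OF hC] by blast
    then show "twin n (q x) (q y) \<or> twin n (q y) (q x)"
      unfolding hw[OF xy(1)] hw[OF xy(2)] using twin_cancel by blast
  qed
qed

text \<open>The directions agree because \<open>?u\<close> leads every core map to the same map
  \<open>?p\<close>, whose values at two comparable points reveal the direction of each.\<close>

lemma TB_cores_monot:
  assumes r: "1 \<le> r" and h: "h \<in> TB_nr n r"
  shows "\<exists>s. \<forall>q\<in>core_maps n (dots r) h. monot s q"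
proof -
  have hB: "h \<in> B_nr n r" using h by (auto simp: TB_nr_def)
  have f: "sync_map n (dots r) (dots r) h" using hB unfolding B_nr_iff[OF r] by auto
  have d: "Dot 0 \<in> dots r" using r by (auto simp: dots_def)
  obtain k where k: "syncs n (dots r) h k" using sync_mapD(4)[OF f] by blast
  let ?u = "replicate k (Lt 0)"
  let ?p = "loc n h (Dot 0 # ?u)"
  have *: "lxs s (?p (\<lambda>_. Lt 0)) (?p (\<lambda>_. Lt 1))" if q: "q \<in> core_maps n (dots r) h" and s: "monot s q" for q s
  proof -
    have "inj_on q C" using sync_mapD(2)[OF sync_map_core[OF f q]] by simp
    then have sp: "splits n q ?u" by (rule splits_C) simp
    have p: "loc n q ?u = ?p" by (rule core_maps_forced(3)[OF f k d _ _ q]) simp_all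
    have "lx (?u \<frown> (\<lambda>_. Lt 0)) (?u \<frown> (\<lambda>_. Lt 1))" unfolding lx_append by (auto simp: lx_def)
    moreover have "?u \<frown> (\<lambda>_. Lt 0) \<in> C" "?u \<frown> (\<lambda>_. Lt 1) \<in> C"
      using ones_C by (simp_all del: in_lists_conv_set set_replicate_conv_if)
    ultimately have "lxs s (q (?u \<frown> (\<lambda>_. Lt 0))) (q (?u \<frown> (\<lambda>_. Lt 1)))" using s unfolding monot_def by blast
    then show ?thesis
      unfolding loc_eq[OF sp zeros_C] loc_eq[OF sp ones_C] p by simp
  qed
  have "core_maps n (dots r) h \<noteq> {}" by (rule core_maps_nonempty[OF f d])
  then obtain q0 where q0: "q0 \<in> core_maps n (dots r) h" by blast
  obtain s0 where s0: "monot s0 q0" using TB_core_monot[OF r h q0] by blast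
  have "monot s0 q" if q: "q \<in> core_maps n (dots r) h" for q
  proof -
    obtain s where s: "monot s q" using TB_core_monot[OF r h q] by blast
    have "s = s0" using *[OF q s] *[OF q0 s0] lx_asym by (cases s; cases s0) (auto simp: lxs_def)
    then show ?thesis using s by simp
  qed
  then show ?thesis by blast
qed

text \<open>A point of a piece; comparing these points orders the pieces.\<close>

definition rep :: "nat \<Rightarrow> (iword \<Rightarrow> iword) \<Rightarrow> letter \<times> letter list \<times> letter list \<Rightarrow> iword" where
  "rep p h P = (case P of (d, u, c) \<Rightarrow> (d # u) \<frown> (SOME y. y \<in> C \<and> take_word p (loc n h (Dot 0 # u) y) = c))"

end

section \<open>Order of the pieces and of the code words\<close>

context transplant
begin

lemma rep_eq:
  assumes "(d, u, c) \<in> pieces r' k p h"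
  obtains y where "rep p h (d, u, c) = (d # u) \<frown> y" "y \<in> C" "take_word p (Q u y) = c" "d \<in> dots r'"
    "u \<in> words_of_length n k"
proof -
  have "\<exists>y. y \<in> C \<and> take_word p (Q u y) = c" using assms by (auto simp: pieces_def Q_def)
  then have "(SOME y. y \<in> C \<and> take_word p (Q u y) = c) \<in> C \<and>
      take_word p (Q u (SOME y. y \<in> C \<and> take_word p (Q u y) = c)) = c" by (rule someI_ex)
  then show ?thesis using that[of "SOME y. y \<in> C \<and> take_word p (Q u y) = c"] assms
    by (auto simp: rep_def Q_def pieces_def)
qed

lemma rep_total:
  assumes "P \<in> pieces r' k p h" "P' \<in> pieces r' k p h" "P \<noteq> P'"
  shows "lx (rep p h P) (rep p h P') \<or> lx (rep p h P') (rep p h P)"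
proof -
  obtain d u c where P: "P = (d, u, c)" by (cases P) auto
  obtain d' u' c' where P': "P' = (d', u', c')" by (cases P') auto
  obtain y where y: "rep p h P = (d # u) \<frown> y" "y \<in> C" "take_word p (Q u y) = c" "d \<in> dots r'"
    "u \<in> words_of_length n k" using rep_eq assms(1) unfolding P by metis
  obtain y' where y': "rep p h P' = (d' # u') \<frown> y'" "y' \<in> C" "take_word p (Q u' y') = c'" "d' \<in> dots r'"
    "u' \<in> words_of_length n k" using rep_eq assms(2) unfolding P' by metis
  have "rep p h P \<noteq> rep p h P'"
  proof
    assume eq: "rep p h P = rep p h P'"
    have "d # u = d' # u'"
      using y y' eq take_word_append_word_eq[of "d # u" y] take_word_append_word_eq[of "d' # u'" y'] by (simp add: W)
    then show False using eq y y' assms(3) P P' by simp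
  qed
  moreover have "rep p h P \<in> inf_words n (dots r')" "rep p h P' \<in> inf_words n (dots r')"
    using dotI[OF y(4,5,2)] dotI[OF y'(4,5,2)] y(1) y'(1) by (simp_all add: cantor_dot_def)
  ultimately show ?thesis using lx_total inj_letter_val(2) by blast
qed

text \<open>Neither of two distinct code words is a prefix of the other, so they differ within the
  shorter length.\<close>

lemma code_take:
  assumes "e \<in> E" "e' \<in> E" "e \<noteq> e'"
  shows "take_word (min (length e) (length e')) (e \<frown> z) \<noteq> take_word (min (length e) (length e')) (e' \<frown> z')"
proof
  assume eq: "take_word (min (length e) (length e')) (e \<frown> z) = take_word (min (length e) (length e')) (e' \<frown> z')"
  show False
  proof (cases "length e \<le> length e'")
    case True
    then have "take_word (length e) (e' \<frown> z') = e" using eq by simp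
    then show False using E_facts(4)[OF assms(1,2), of "e' \<frown> z'"] assms(3) by simp
  next
    case False
    then have "take_word (length e') (e \<frown> z) = e'" using eq by simp
    then show False using E_facts(4)[OF assms(1,2), of "e \<frown> z"] assms(3) by simp
  qed
qed

lemma code_total:
  assumes "e \<in> E" "e' \<in> E" "e \<noteq> e'"
  shows "lxs s (e \<frown> (\<lambda>_. Lt 0)) (e' \<frown> (\<lambda>_. Lt 0)) \<or> lxs s (e' \<frown> (\<lambda>_. Lt 0)) (e \<frown> (\<lambda>_. Lt 0))"
proof (rule lxs_total[where n = n and D = "dots r'"])
  show "e \<frown> (\<lambda>_. Lt 0) \<noteq> e' \<frown> (\<lambda>_. Lt 0)" using code_take[OF assms] by metis
qed (use E_facts(2) assms inf_words_appendI in auto)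

lemma code_lxs:
  assumes "e \<in> E" "e' \<in> E" "e \<noteq> e'" "lxs s (e \<frown> (\<lambda>_. Lt 0)) (e' \<frown> (\<lambda>_. Lt 0))"
  shows "lxs s (e \<frown> z) (e' \<frown> z')"
  by (rule lxs_take[OF assms(4) code_take[OF assms(1-3)]]) (simp_all add: take_word_append_word)

text \<open>Within a piece \<open>Q u\<close> decides. Within a cone of \<open>d # u\<close> the
  words \<open>c\<close> are compared through the monotone \<open>Q u\<close>, and across such cones
  the first k + 1 letters decide; in both cases \<open>ord\<close> passes the order of the pieces on
  to the code words.\<close>

lemma moved_monotone:
  assumes mono: "\<And>q. q \<in> core_maps n (dots r) h \<Longrightarrow> monot s q"
    and ord: "\<And>P P'. P \<in> pieces r' k p h \<Longrightarrow> P' \<in> pieces r' k p h \<Longrightarrow> lx (rep p h P) (rep p h P')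
      \<Longrightarrow> lxs s (\<iota> P \<frown> (\<lambda>_. Lt 0)) (\<iota> P' \<frown> (\<lambda>_. Lt 0))"
    and x: "x1 \<in> cantor_dot n r'" "x2 \<in> cantor_dot n r'" "lx x1 x2"
  shows "lxs s (moved x1) (moved x2)"
proof -
  obtain d1 u1 y1 where y1: "x1 = (d1 # u1) \<frown> y1" "d1 \<in> dots r'" "u1 \<in> words_of_length n k" "y1 \<in> C"
    using dotE[OF x(1)] by blast
  obtain d2 u2 y2 where y2: "x2 = (d2 # u2) \<frown> y2" "d2 \<in> dots r'" "u2 \<in> words_of_length n k" "y2 \<in> C"
    using dotE[OF x(2)] by blast
  define c1 where "c1 = take_word p (Q u1 y1)"
  define c2 where "c2 = take_word p (Q u2 y2)"
  let ?P1 = "(d1, u1, c1)" and ?P2 = "(d2, u2, c2)"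
  have P: "?P1 \<in> pieces r' k p h" "?P2 \<in> pieces r' k p h" using pieceI y1 y2 unfolding c1_def c2_def by blast+
  have m: "moved x1 = \<iota> ?P1 \<frown> drop_word p (Q u1 y1)" "moved x2 = \<iota> ?P2 \<frown> drop_word p (Q u2 y2)"
    using moved_eq y1 y2 unfolding c1_def c2_def by simp_all
  have Qm: "lxs s (Q u a) (Q u b)" if "u \<in> words_of_length n k" "a \<in> C" "b \<in> C" "lx a b" for u a b
    using mono[OF Qu(3)[OF that(1)]] that unfolding monot_def by blast
  show ?thesis
  proof (cases "?P1 = ?P2")
    case True
    then have "lx y1 y2" using x(3) y1(1) y2(1) by simp
    then have "lxs s (Q u1 y1) (Q u1 y2)" using Qm y1 y2 by blast
    moreover have "Q u1 y1 = c1 \<frown> drop_word p (Q u1 y1)" "Q u1 y2 = c1 \<frown> drop_word p (Q u1 y2)"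
      using True unfolding c1_def c2_def by (metis prod.inject take_drop_word)+
    ultimately have "lxs s (drop_word p (Q u1 y1)) (drop_word p (Q u1 y2))" by (metis lxs_append)
    then show ?thesis unfolding m using True by simp
  next
    case False
    obtain z1 where z1: "rep p h ?P1 = (d1 # u1) \<frown> z1" "z1 \<in> C" "take_word p (Q u1 z1) = c1"
      using rep_eq[OF P(1)] by metis
    obtain z2 where z2: "rep p h ?P2 = (d2 # u2) \<frown> z2" "z2 \<in> C" "take_word p (Q u2 z2) = c2"
      using rep_eq[OF P(2)] by metis
    have len: "length (d1 # u1) = Suc k" "length (d2 # u2) = Suc k" using y1(3) y2(3) by (simp_all add: W)
    have tk: "take_word (Suc k) ((d1 # u1) \<frown> a) = d1 # u1" "take_word (Suc k) ((d2 # u2) \<frown> a) = d2 # u2" for a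
      using take_word_append_word_eq[of "d1 # u1" a] take_word_append_word_eq[of "d2 # u2" a] len by simp_all
    have "lx (rep p h ?P1) (rep p h ?P2)"
    proof (cases "d1 # u1 = d2 # u2")
      case True
      then have c: "c1 \<noteq> c2" using False by simp
      have u: "u2 = u1" using True by simp
      have "lx y1 y2" using x(3) True unfolding y1(1) y2(1) by simp
      then have "lxs s (Q u1 y1) (Q u1 y2)" using Qm y1 y2 by blast
      then have z: "lxs s (Q u1 z1) (Q u1 z2)"
        by (rule lxs_take[where m = p]) (use c z1(3) z2(3) u in \<open>simp_all add: c1_def c2_def\<close>)
      have "\<not> lx z2 z1" using Qm[OF y1(3) z2(2) z1(2)] z lxs_asym by blast
      moreover have "z1 \<noteq> z2" using z by auto
      ultimately have "lx z1 z2" using lx_total[of z1 n "letters n" z2] z1(2) z2(2) by simp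
      then show ?thesis unfolding z1(1) z2(1) True by simp
    next
      case False
      show ?thesis
        unfolding z1(1) z2(1)
        by (rule lx_take[OF x(3), of "Suc k"]) (use False in \<open>simp_all only: y1(1) y2(1) tk not_False_eq_True\<close>)
    qed
    then have l: "lxs s (\<iota> ?P1 \<frown> (\<lambda>_. Lt 0)) (\<iota> ?P2 \<frown> (\<lambda>_. Lt 0))" by (rule ord[OF P])
    moreover have "\<iota> ?P1 \<noteq> \<iota> ?P2" using False \<iota> P by (auto simp: bij_betw_def inj_on_def)
    ultimately show ?thesis unfolding m using code_lxs[OF piece_E[OF P(1)] piece_E[OF P(2)]] by blast
  qed
qed

end

context alphabet
begin

lemma ex_core_TB:
  assumes r: "1 \<le> r" and h: "h \<in> TB_nr n r" and s: "sig (core_maps n (dots r) h) s"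
    and r': "1 \<le> r'" "[r' * s = r'] (mod (n - 1))"
  shows "\<exists>g\<in>TB_nr n r'. core_maps n (dots r') g = core_maps n (dots r) h"
proof -
  have hB: "h \<in> B_nr n r" using h by (auto simp: TB_nr_def)
  obtain k p E where T: "\<And>\<iota>. bij_betw \<iota> (pieces r' k p h) E \<Longrightarrow> transplant n r r' k p h E \<iota>"
    "finite (pieces r' k p h)" "finite E" "card (pieces r' k p h) = card E"
    using ex_transplant[OF r hB s r'] by blast
  \<comment> \<open>Any bijection will do here: it only gives access to the facts of the locale
    needed to construct the ordered one.\<close>
  obtain \<iota>0 where "bij_betw \<iota>0 (pieces r' k p h) E" using finite_same_card_bij[OF T(2-4)] by blast
  then interpret T0: transplant n r r' k p h E \<iota>0 by (rule T(1))
  obtain t where t: "\<And>q. q \<in> core_maps n (dots r) h \<Longrightarrow> monot t q" using TB_cores_monot[OF r h] by blast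
  obtain \<iota> where \<iota>: "bij_betw \<iota> (pieces r' k p h) E"
    "\<And>P P'. P \<in> pieces r' k p h \<Longrightarrow> P' \<in> pieces r' k p h \<Longrightarrow> lx (rep p h P) (rep p h P')
      \<Longrightarrow> lxs t (\<iota> P \<frown> (\<lambda>_. Lt 0)) (\<iota> P' \<frown> (\<lambda>_. Lt 0))"
  proof (rule finite_order_iso[OF T(2-4), of "\<lambda>P P'. lx (rep p h P) (rep p h P')"
        "\<lambda>e e'. lxs t (e \<frown> (\<lambda>_. Lt 0)) (e' \<frown> (\<lambda>_. Lt 0))"])
    show "lx (rep p h P) (rep p h P'')" if "lx (rep p h P) (rep p h P')" "lx (rep p h P') (rep p h P'')" for P P' P''
      using lx_trans that by blast
    show "lxs t (e \<frown> (\<lambda>_. Lt 0)) (e'' \<frown> (\<lambda>_. Lt 0))"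
      if "lxs t (e \<frown> (\<lambda>_. Lt 0)) (e' \<frown> (\<lambda>_. Lt 0))" "lxs t (e' \<frown> (\<lambda>_. Lt 0)) (e'' \<frown> (\<lambda>_. Lt 0))" for e e' e''
      using lxs_trans that by blast
  qed (use T0.rep_total T0.code_total in auto)
  interpret T: transplant n r r' k p h E \<iota> by (rule T(1)[OF \<iota>(1)])
  have "T.moved \<in> TB_nr n r'"
    by (rule monotone_TB[OF r'(1) T.moved_B, of t], rule T.moved_monotone[OF t \<iota>(2)])
  then show ?thesis using T.core_maps_moved by blast
qed

section \<open>Divisibility of the admissible circles\<close>

lemma core_of_eq_iff:
  assumes "1 \<le> r" "h \<in> B_nr n r" "1 \<le> r'" "g \<in> B_nr n r'"
  shows "core_of r h = core_of r' g \<longleftrightarrow> core_maps n (dots r) h = core_maps n (dots r') g"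
proof
  have d: "Dot 0 \<in> dots r" "Dot 0 \<in> dots r'" using assms by (auto simp: dots_def)
  have "sync_map n (dots r) (dots r) h" "sync_map n (dots r') (dots r') g"
    using assms B_nr_iff by blast+
  then have "core_set (core_maps n (dots r) h)" "core_set (core_maps n (dots r') g)"
    using core_set_core_maps d by blast+
  then show "core_of r h = core_of r' g \<Longrightarrow> core_maps n (dots r) h = core_maps n (dots r') g"
    using core_class_inj by blast
qed simp

lemma TO_nr_eq: "1 \<le> r \<Longrightarrow> TO_nr n r = core_of r ` TB_nr n r"
  unfolding TO_nr_def by (rule Cores_eq) (auto simp: TB_nr_def)

lemma O_nr_eq: "1 \<le> r \<Longrightarrow> O_nr n r = core_of r ` B_nr n r"
  unfolding O_nr_def by (rule Cores_eq) auto

text \<open>The least solution is (n - 1) / gcd (n - 1, s - 1). Integers are used because s - 1 is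
  negative for s = 0.\<close>

lemma cong_dvd: "\<exists>m\<ge>1. \<forall>r. [r * s = r] (mod (n - 1)) \<longleftrightarrow> m dvd r"
proof -
  define N where "N = int (n - 1)"
  define g where "g = gcd N (int s - 1)"
  have N: "N > 0" using n2 by (simp add: N_def)
  have g: "g > 0" using N by (simp add: g_def)
  obtain a b where ab: "N = a * g" "int s - 1 = b * g" "coprime a b"
    using gcd_coprime_exists[of N "int s - 1"] g unfolding g_def by fastforce
  have ap: "a > 0" using N g ab(1) by (simp add: zero_less_mult_iff)
  have "[r * s = r] (mod (n - 1)) \<longleftrightarrow> nat a dvd r" for r
  proof -
    have "[r * s = r] (mod (n - 1)) \<longleftrightarrow> [int (r * s) = int r] (mod N)"
      unfolding N_def by (simp only: cong_int_iff)
    also have "\<dots> \<longleftrightarrow> N dvd int r * (int s - 1)"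
      by (simp add: cong_iff_dvd_diff right_diff_distrib)
    also have "int r * (int s - 1) = int r * b * g" using ab(2) by (simp add: mult.assoc)
    also have "N dvd \<dots> \<longleftrightarrow> a dvd int r * b" using ab(1) g by simp
    also have "\<dots> \<longleftrightarrow> a dvd int r" using ab(3) by (rule coprime_dvd_mult_left_iff)
    also have "\<dots> \<longleftrightarrow> nat a dvd r" using ap by (metis int_dvd_int_iff nat_0_le less_imp_le)
    finally show ?thesis .
  qed
  then show ?thesis using ap by (intro exI[of _ "nat a"]) auto
qed

text \<open>The signature alone decides: its congruence is necessary by \<open>sig_fixes_r\<close>
  and sufficient by transplanting. The order divides n - 1 because the congruence is trivial
  there.\<close>

lemma ex_order:
  assumes X: "X \<in> {TO_nr, O_nr}" and r: "1 \<le> r" and T: "T \<in> X n r"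
  shows "\<exists>m\<ge>1. m dvd n - 1 \<and> (\<forall>r'\<ge>1. T \<in> X n r' \<longleftrightarrow> m dvd r')"
proof -
  define G where "G = (\<lambda>r. if X = TO_nr then TB_nr n r else B_nr n r)"
  have XG: "X n r = core_of r ` G r" if "1 \<le> r" for r
    using X O_nr_eq[OF that] TO_nr_eq[OF that] unfolding G_def by (cases "X = TO_nr") auto
  have GB: "G r \<subseteq> B_nr n r" for r by (auto simp: G_def TB_nr_def)
  obtain h where h: "h \<in> G r" "T = core_of r h" using T XG[OF r] by blast
  have hB: "h \<in> B_nr n r" using h GB by blast
  obtain s where s: "sig (core_maps n (dots r) h) s" using ex_sig[OF r hB] by blast
  have "T \<in> X n r' \<longleftrightarrow> [r' * s = r'] (mod (n - 1))" if r': "1 \<le> r'" for r'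
  proof
    assume "T \<in> X n r'"
    then obtain g where g: "g \<in> G r'" "T = core_of r' g" using XG[OF r'] by blast
    have gB: "g \<in> B_nr n r'" using g GB by blast
    have "core_maps n (dots r) h = core_maps n (dots r') g"
      using core_of_eq_iff[OF r hB r' gB] h(2) g(2) by simp
    then show "[r' * s = r'] (mod (n - 1))" using sig_fixes_r[OF r' gB] s by simp
  next
    assume c: "[r' * s = r'] (mod (n - 1))"
    have "\<exists>g\<in>G r'. core_maps n (dots r') g = core_maps n (dots r) h"
    proof (cases "X = TO_nr")
      case True
      then show ?thesis using ex_core_TB[OF r _ s r' c] h(1) unfolding G_def by simp
    next
      case False
      then show ?thesis using ex_core_B[OF r hB s r' c] unfolding G_def by simp
    qed
    then obtain g where g: "g \<in> G r'" "core_maps n (dots r') g = core_maps n (dots r) h" by blast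
    then have "T = core_of r' g" using h(2) by simp
    then show "T \<in> X n r'" unfolding XG[OF r'] using g(1) by blast
  qed
  moreover obtain m where m: "m \<ge> 1" "\<forall>r. [r * s = r] (mod (n - 1)) \<longleftrightarrow> m dvd r" using cong_dvd by blast
  moreover have "[(n - 1) * s = n - 1] (mod (n - 1))" by (simp add: cong_def)
  then have "m dvd n - 1" using m(2) by blast
  ultimately show ?thesis by blast
qed

lemma X_le_top:
  assumes "X \<in> {TO_nr, O_nr}" "1 \<le> r" "T \<in> X n r" shows "T \<in> X n (n - 1)"
proof -
  obtain m where "m dvd n - 1" "\<forall>r'\<ge>1. T \<in> X n r' \<longleftrightarrow> m dvd r'" using ex_order[OF assms] by blast
  moreover have "1 \<le> n - 1" using n2 by simp
  ultimately show ?thesis by blast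
qed

lemma carrier_O_group: "(\<Union>r\<in>{1..n - 1}. O_nr n r) = O_nr n (n - 1)"
proof
  show "(\<Union>r\<in>{1..n - 1}. O_nr n r) \<subseteq> O_nr n (n - 1)" using X_le_top[of O_nr] by auto
  show "O_nr n (n - 1) \<subseteq> (\<Union>r\<in>{1..n - 1}. O_nr n r)" by (rule UN_upper) (use n2 in simp)
qed

section \<open>The ambient group and its subgroups\<close>

lemma group_O: "group (O_group n)"
  by (rule group_O_group[OF carrier_O_group])

lemma subgroup_X:
  assumes X: "X \<in> {TO_nr, O_nr}" and r: "1 \<le> r" "r \<le> n - 1"
  shows "subgroup (X n r) (O_group n)"
proof -
  have c: "carrier (O_group n) = (\<Union>r\<in>{1..n - 1}. O_nr n r)" by (simp add: O_group_def)
  have "O_nr n r \<subseteq> carrier (O_group n)" unfolding c using r by auto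
  moreover have "TO_nr n r \<subseteq> O_nr n r"
    unfolding TO_nr_eq[OF r(1)] O_nr_eq[OF r(1)] by (auto simp: TB_nr_def)
  ultimately have "Cores n r (B_nr n r) \<subseteq> carrier (O_group n)" "Cores n r (TB_nr n r) \<subseteq> carrier (O_group n)"
    by (auto simp: O_nr_def TO_nr_def)
  then have "subgroup (O_nr n r) (O_group n)" "subgroup (TO_nr n r) (O_group n)"
    unfolding O_nr_def TO_nr_def
    using subgroup_Cores[OF group_O r(1)] closed_family_B[OF r(1)] closed_family_TB[OF r(1)] by blast+
  then show ?thesis using X by auto
qed

end

text \<open>What enters about cores is that the families consist of subgroups and that membership is
  divisibility by an order; the rest is arithmetic in the range from 1 to n - 1.\<close>

theorem mainTheorem12:
  fixes n i j :: nat and X :: "nat \<Rightarrow> nat \<Rightarrow> transducer_class set"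
  assumes "n \<ge> 2"
    and "X \<in> {TO_nr, O_nr}"
    and "1 \<le> i" "i \<le> n - 1" "1 \<le> j" "j \<le> n - 1"
    and "i = Min (cls X n i)"
    and "j = Min (cls X n j)"
  shows "(subgroup_le n (class_group X n (cls X n i)) (class_group X n (cls X n j))
            \<longleftrightarrow> class_dvd X n (cls X n i) (cls X n j))
       \<and> (\<forall>r\<in>{1..n - 1}. is_class_lcm X n (cls X n i) (cls X n j) (cls X n r) \<longrightarrow>
            minimal_class X n
              (\<lambda>c. subgroup_le n
                 (generate (O_group n) (class_group X n (cls X n i) \<union> class_group X n (cls X n j)))
                 (class_group X n c))
              (cls X n r))
       \<and> (\<forall>r\<in>{1..n - 1}. r = Min (cls X n r) \<longrightarrow>
            is_class_gcd X n (cls X n i) (cls X n j) (cls X n r) \<longrightarrow>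
            class_group X n (cls X n i) \<inter> class_group X n (cls X n j) = class_group X n (cls X n r))"
proof -
  interpret alphabet n by unfold_locales (rule assms(1))
  note G = group_O
  let ?R = "{1..n - 1}"
  have cg: "class_group X n (cls X n r) = X n r" if "r \<in> ?R" for r
  proof -
    have "X n ` cls X n r = {X n r}" using that by (auto simp: cls_def)
    then show ?thesis by (simp add: class_group_def)
  qed
  have sub: "subgroup (X n r) (O_group n)" if "r \<in> ?R" for r using subgroup_X[OF assms(2)] that by simp
  have finc: "finite (cls X n r)" for r by (simp add: cls_def)
  have self: "r \<in> cls X n r" if "r \<in> ?R" for r using that by (simp add: cls_def)
  have cls_cong: "cls X n a = cls X n b" if "X n a = X n b" for a b using that by (simp add: cls_def)
  have Min_cls: "Min (cls X n r) \<in> ?R" "X n (Min (cls X n r)) = X n r" "cls X n (Min (cls X n r)) = cls X n r"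
    "Min (cls X n r) \<le> r" if "r \<in> ?R" for r
  proof -
    have "Min (cls X n r) \<in> cls X n r" by (rule Min_in[OF finc]) (use self[OF that] in blast)
    then show "Min (cls X n r) \<in> ?R" "X n (Min (cls X n r)) = X n r" by (simp_all add: cls_def)
    then show "cls X n (Min (cls X n r)) = cls X n r" by (intro cls_cong)
    show "Min (cls X n r) \<le> r" by (rule Min_le[OF finc self[OF that]])
  qed
  \<comment> \<open>Both sides are subgroups of one group, so \<open>subgroup_le\<close> is mere
    inclusion.\<close>
  have le_iff: "subgroup_le n H (X n r) \<longleftrightarrow> H \<subseteq> X n r" if r: "r \<in> ?R" and H: "subgroup H (O_group n)" for H r
  proof
    assume "subgroup_le n H (X n r)"
    then show "H \<subseteq> X n r" unfolding subgroup_le_def using subgroup.subset by fastforce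
  next
    assume "H \<subseteq> X n r"
    then show "subgroup_le n H (X n r)"
      unfolding subgroup_le_def by (rule group.subgroup_incl[OF G H sub[OF r]])
  qed
  have ij: "i \<in> ?R" "j \<in> ?R" using assms by auto
  have ord: "\<exists>m\<ge>1. \<forall>r'\<in>?R. T \<in> X n r' \<longleftrightarrow> m dvd r'" if "r \<in> ?R" "T \<in> X n r" for r T
  proof -
    have "1 \<le> r" using that(1) by simp
    then show ?thesis using ex_order[OF assms(2) _ that(2)] by auto
  qed
  have dvd_sub: "X n a \<subseteq> X n b" if ab: "a \<in> ?R" "b \<in> ?R" "a dvd b" for a b
  proof
    fix T assume T: "T \<in> X n a"
    obtain m where m: "\<forall>r'\<in>?R. T \<in> X n r' \<longleftrightarrow> m dvd r'" using ord[OF ab(1) T] by blast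
    then have "m dvd a" using T ab(1) by blast
    then have "m dvd b" using ab(3) by (rule dvd_trans)
    then show "T \<in> X n b" using m ab(2) by blast
  qed
  have allc: "c \<in> all_classes X n \<longleftrightarrow> (\<exists>r\<in>?R. r = Min (cls X n r) \<and> c = cls X n r)" for c
  proof
    assume "c \<in> all_classes X n"
    then obtain r where r: "r \<in> ?R" "c = cls X n r" unfolding all_classes_def by blast
    then show "\<exists>r\<in>?R. r = Min (cls X n r) \<and> c = cls X n r"
      using Min_cls[OF r(1)] by (intro bexI[of _ "Min (cls X n r)"]) auto
  qed (auto simp: all_classes_def)
  text \<open>An element \<open>T\<close> of order \<open>m\<close> witnesses that \<open>[m]\<close> is an atom with smallest element \<open>m\<close>.\<close>
  have atom_ord: "m \<in> ?R" "m = Min (cls X n m)" "atom X n (cls X n m)" "X n m \<subseteq> X n r"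
    if r: "r \<in> ?R" "T \<in> X n r" and m: "m \<ge> 1" "\<forall>r'\<in>?R. T \<in> X n r' \<longleftrightarrow> m dvd r'" for r T m
  proof -
    have mr: "m dvd r" using m(2) r by blast
    then have "m \<le> r" using r(1) by (intro dvd_imp_le) auto
    then show mR: "m \<in> ?R" using m(1) r(1) by simp
    then have Tm: "T \<in> X n m" using m(2) by simp
    show "X n m \<subseteq> X n r" using dvd_sub[OF mR r(1) mr] .
    have "T \<in> X n (Min (cls X n m))" using Min_cls(2)[OF mR] Tm by simp
    then have "m dvd Min (cls X n m)" using m(2) Min_cls(1)[OF mR] by blast
    then have "m \<le> Min (cls X n m)" using Min_cls(1)[OF mR] by (intro dvd_imp_le) auto
    then show mM: "m = Min (cls X n m)" using Min_cls(4)[OF mR] by simp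
    have "T \<notin> class_group X n s" if s: "s \<in> all_classes X n" "class_less s (cls X n m)" for s
    proof -
      obtain t where t: "t \<in> ?R" "t = Min (cls X n t)" "s = cls X n t" using s(1) allc by blast
      have "t < m" using s(2) t mM unfolding class_less_def by simp
      then have "\<not> m dvd t" using t(1) by (auto dest: dvd_imp_le)
      then show ?thesis using m(2) t cg[OF t(1)] by simp
    qed
    then show "atom X n (cls X n m)"
      unfolding atom_def using Tm cg[OF mR] mR by (auto simp: all_classes_def)
  qed
  have A: "X n a \<subseteq> X n b \<longleftrightarrow> class_dvd X n (cls X n a) (cls X n b)"
    if ab: "a \<in> ?R" "b \<in> ?R" "b = Min (cls X n b)" for a b
  proof
    assume sab: "X n a \<subseteq> X n b"
    show "class_dvd X n (cls X n a) (cls X n b)"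
      unfolding class_dvd_def
    proof (intro allI impI)
      fix c assume c: "atom_of X n (cls X n a) c"
      then have ca: "c \<in> all_classes X n" by (simp add: atom_of_def atom_def)
      then obtain r where r: "r \<in> ?R" "r = Min (cls X n r)" "c = cls X n r" using allc by blast
      obtain T where T: "T \<in> X n r" "\<And>s. s \<in> all_classes X n \<Longrightarrow> class_less s c \<Longrightarrow> T \<notin> class_group X n s"
        using c cg[OF r(1)] r(3) unfolding atom_of_def atom_def by auto
      obtain m where m: "m \<ge> 1" "\<forall>r'\<in>?R. T \<in> X n r' \<longleftrightarrow> m dvd r'" using ord[OF r(1) T(1)] by blast
      note am = atom_ord[OF r(1) T(1) m]
      \<comment> \<open>The witness \<open>T\<close> of the atom lies in the class of its own order
        \<open>m\<close>, which therefore cannot be smaller than the atom; so \<open>m\<close> is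
        \<open>r\<close>.\<close>
      have "\<not> class_less (cls X n m) c"
        using T(2)[of "cls X n m"] am(1) m cg[OF am(1)] by (auto simp: all_classes_def)
      then have "r \<le> m" using am(2) r(2,3) by (simp add: class_less_def)
      moreover have "m dvd r" using m(2) r(1) T(1) by blast
      then have "m \<le> r" using r(1) by (intro dvd_imp_le) auto
      ultimately have mr: "m = r" by simp
      have "X n r \<subseteq> X n a"
        using c le_iff[OF ab(1) sub[OF r(1)]] cg[OF r(1)] cg[OF ab(1)] r(3) by (simp add: atom_of_def)
      then have "T \<in> X n b" using T(1) sab by blast
      then have "r dvd b" using m(2) ab(2) mr by blast
      then show "Min c dvd Min (cls X n b)" using r(2,3) ab(3) by simp
    qed
  next
    assume d: "class_dvd X n (cls X n a) (cls X n b)"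
    show "X n a \<subseteq> X n b"
    proof
      fix T assume T: "T \<in> X n a"
      obtain m where m: "m \<ge> 1" "\<forall>r'\<in>?R. T \<in> X n r' \<longleftrightarrow> m dvd r'" using ord[OF ab(1) T] by blast
      note am = atom_ord[OF ab(1) T m]
      \<comment> \<open>Every order occurring in \<open>X n a\<close> gives an atom, so divisibility
        of classes controls each element separately.\<close>
      have "atom_of X n (cls X n a) (cls X n m)"
        unfolding atom_of_def cg[OF am(1)] cg[OF ab(1)] using am le_iff[OF ab(1) sub[OF am(1)]] by blast
      then have "Min (cls X n m) dvd Min (cls X n b)" using d unfolding class_dvd_def by blast
      then have "m dvd b" using am(2) ab(3) by simp
      then show "T \<in> X n b" using m(2) ab(2) by blast
    qed
  qed
  have a: "subgroup_le n (class_group X n (cls X n i)) (class_group X n (cls X n j))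
      \<longleftrightarrow> class_dvd X n (cls X n i) (cls X n j)"
    unfolding cg[OF ij(1)] cg[OF ij(2)] le_iff[OF ij(2) sub[OF ij(1)]] by (rule A[OF ij assms(8)])
  have gen: "subgroup_le n (generate (O_group n) (X n i \<union> X n j)) (X n r) \<longleftrightarrow> X n i \<subseteq> X n r \<and> X n j \<subseteq> X n r"
    if r: "r \<in> ?R" for r
  proof -
    have "X n i \<union> X n j \<subseteq> carrier (O_group n)" using sub ij subgroup.subset by blast
    then have "subgroup (generate (O_group n) (X n i \<union> X n j)) (O_group n)"
      by (rule group.generate_is_subgroup[OF G])
    then have "subgroup_le n (generate (O_group n) (X n i \<union> X n j)) (X n r)
        \<longleftrightarrow> generate (O_group n) (X n i \<union> X n j) \<subseteq> X n r"
      by (rule le_iff[OF r])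
    also have "\<dots> \<longleftrightarrow> X n i \<union> X n j \<subseteq> X n r"
    proof
      assume "generate (O_group n) (X n i \<union> X n j) \<subseteq> X n r"
      then show "X n i \<union> X n j \<subseteq> X n r" using generate.incl by (metis subset_eq)
    next
      assume "X n i \<union> X n j \<subseteq> X n r"
      then show "generate (O_group n) (X n i \<union> X n j) \<subseteq> X n r"
        by (rule group.generate_subgroup_incl[OF G _ sub[OF r]])
    qed
    finally show ?thesis by blast
  qed
  \<comment> \<open>The two conditions to be minimized in (b) agree on every class, so a smallest
    class for one is minimal for the other.\<close>
  have P: "(class_dvd X n (cls X n i) c \<and> class_dvd X n (cls X n j) c) \<longleftrightarrow>
      subgroup_le n (generate (O_group n) (class_group X n (cls X n i) \<union> class_group X n (cls X n j)))
        (class_group X n c)" if c: "c \<in> all_classes X n" for c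
  proof -
    obtain r where r: "r \<in> ?R" "r = Min (cls X n r)" "c = cls X n r" using c allc by blast
    show ?thesis
      unfolding r(3) cg[OF r(1)] cg[OF ij(1)] cg[OF ij(2)] gen[OF r(1)]
        A[OF ij(1) r(1,2)] A[OF ij(2) r(1,2)] ..
  qed
  have b: "minimal_class X n
       (\<lambda>c. subgroup_le n (generate (O_group n) (class_group X n (cls X n i) \<union> class_group X n (cls X n j)))
           (class_group X n c)) (cls X n r)"
    if "is_class_lcm X n (cls X n i) (cls X n j) (cls X n r)" for r
    using that P unfolding is_class_lcm_def smallest_class_def minimal_class_def class_less_def
    by (metis less_asym less_irrefl)
  have c: "X n i \<inter> X n j = X n r"
    if r: "r \<in> ?R" "r = Min (cls X n r)" and g: "is_class_gcd X n (cls X n i) (cls X n j) (cls X n r)" for r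
  proof -
    \<comment> \<open>With the minima replaced by \<open>i\<close> and \<open>j\<close>, an order
      divides both of them exactly when it divides \<open>r\<close>.\<close>
    have rg: "r = gcd i j" using g r(2) assms(7,8) unfolding is_class_gcd_def by simp
    show ?thesis
    proof (intro equalityI subsetI)
      fix T assume T: "T \<in> X n i \<inter> X n j"
      obtain m where m: "\<forall>r'\<in>?R. T \<in> X n r' \<longleftrightarrow> m dvd r'" using ord[OF ij(1)] T by blast
      then have "m dvd i" "m dvd j" using T ij by blast+
      then have "m dvd r" using rg by simp
      then show "T \<in> X n r" using m r(1) by blast
    next
      fix T assume "T \<in> X n r"
      then show "T \<in> X n i \<inter> X n j" using dvd_sub[OF r(1) ij(1)] dvd_sub[OF r(1) ij(2)] rg by auto
    qed
  qed
  show ?thesis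
    using a b c cg ij by (intro conjI ballI impI) simp_all
qed

end
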